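(* Let $X$ be a linear diffusion on $I=(\ell,+\infty[$ as described in the context, let $f$ be a boundary, and let $H(t,y)=\mathbb{P}_y(T_{f\circ\theta_t}=+\infty)$. (Lower boundaries) Suppose that $f:[0,+\infty[\to[\ell,+\infty[$ is continuous, of class $\mathcal{C}^1$ on $]0,+\infty[$, with $\zeta(f):=\inf\{t\ge0:f(t)=\ell\}\in\,]0,+\infty]$; if $\zeta(f)=+\infty$, suppose that $\mathbb{P}_x(\lim_{t\to\zeta(f)}(X_t-f(t))>0)=1$ for all $x\in I$; and suppose that $H$ is of class $\mathcal{C}^{1,2}$ on $]0,\zeta(f)[\times]\ell,+\infty[$ with $\lim_{y\to+\infty}\frac{1}{s'(y)}\frac{\partial H(t,y)}{\partial y}q(t,x,y)=0$ for every $x\in\,]\ell,+\infty[$ and $t>0$. Then the function $\Phi(t)=\frac{1}{s'(f(t))}\frac{\partial}{\partial y}\mathbb{P}_y(T_{f\circ\theta_t}=+\infty)\big|_{y=f(t)}$ is a solution of the Fredholm equation of the first kind $$\int_0^{\zeta(f)}\Phi(t)\,q(t,x,f(t))\,dt=1,\qquad x<f(0).$$ (Upper boundaries) Suppose that $\ell$ is natural if $\ell=-\infty$ and entrance-not-exit if $\ell>-\infty$; that $f:[0,+\infty[\to\,]\ell,+\infty[$ is continuous, of class $\mathcal{C}^1$ on $]0,+\infty[$, with $\inf\{t\ge0:f(t)=\ell\}=+\infty$ and $\mathbb{P}_x(\lim_{t\to+\infty}(X_t-f(t))<0)=1$ for all $x\in I$; and that $H$ is of class $\mathcal{C}^{1,2}$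 on $]0,+\infty[\times]\ell,+\infty[$ with $\lim_{y\to\ell}\frac{1}{s'(y)}\frac{\partial H(t,y)}{\partial y}q(t,x,y)=0$ for every $x\in\,]\ell,+\infty[$ and $t>0$. Then the function $\Phi(t)=-\frac{1}{s'(f(t))}\frac{\partial}{\partial y}\mathbb{P}_y(T_{f\circ\theta_t}=+\infty)\big|_{y=f(t)}$ is a solution of the Fredholm equation of the first kind $$\int_0^{+\infty}\Phi(t)\,q(t,x,f(t))\,dt=1,\qquad x>f(0).$$
   Context: Setting: $\ell\in[-\infty,+\infty[$, and $(X_t,t\ge 0)$ is a linear regular conservative (infinite life-time) diffusion with values in $I=(\ell,+\infty[$, with $+\infty$ a natural boundary; $\mathbb{P}_x$ is its law started from $x$. Its speed measure is $m(dx)=\rho(x)dx$ (absolutely continuous), its scale function $s$ is of class $\mathcal{C}^2$, and its generator is $\mathcal{G}=\frac{1}{\rho(x)}\frac{\partial}{\partial x}\left(\frac{1}{s'(x)}\frac{\partial}{\partial x}\right)$. $X$ has a transition density $q(t,x,y)$ with respect to $m$, jointly continuous, symmetric in $(x,y)$, assumed of class $\mathcal{C}^{1,2,2}$ on $]0,+\infty[\times I\times I$; in particular, $\mathcal{G}q=\partial q/\partial t$ in the variables $(t,x)$ on $]0,+\infty[\times]\ell,+\infty[$. First passage time: for a function $g$, $T_g:=\inf\{t\ge 0: X_t=g(t)\}$, with $T_g=+\infty$ if this set is empty. Shift: $(f\circ\theta_t)(u)=f(t+u)$ for $u\ge 0$.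
   Formalization: For lower boundaries with ζ(f)<∞, H counts only passages before ζ(f) (literally false otherwise: 3-dim. Bessel, f(t)=(t−1)²); H need only be C^{1,2} on the non-crossing side up to y=f(t), and Φ uses the one-sided derivative there. *)

theory Defs
  imports "HOL-Probability.Probability"
begin

section \<open>Regularity classes\<close>

text \<open>
  On an open set \<open>D\<close> these are the usual classes.  If \<open>D\<close> contains boundary points, the derivatives
  exist in the interior and extend continuously to \<open>D\<close> (regularity up to the boundary).
\<close>

definition C12_on :: "(real \<times> real) set \<Rightarrow> (real \<Rightarrow> real \<Rightarrow> real) \<Rightarrow> bool" where
  "C12_on D h \<longleftrightarrow> continuous_on D (\<lambda>(t, y). h t y) \<and>
     (\<exists>ht hy hyy.
        continuous_on D (\<lambda>(t, y). ht t y) \<and>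
        continuous_on D (\<lambda>(t, y). hy t y) \<and>
        continuous_on D (\<lambda>(t, y). hyy t y) \<and>
        (\<forall>(t, y) \<in> interior D.
           ((\<lambda>r. h r y) has_real_derivative ht t y) (at t) \<and>
           ((\<lambda>z. h t z) has_real_derivative hy t y) (at y) \<and>
           ((\<lambda>z. hy t z) has_real_derivative hyy t y) (at y)))"

definition C122_on :: "(real \<times> real \<times> real) set \<Rightarrow> (real \<Rightarrow> real \<Rightarrow> real \<Rightarrow> real) \<Rightarrow> bool" where
  "C122_on D q \<longleftrightarrow> continuous_on D (\<lambda>(t, x, y). q t x y) \<and>
     (\<exists>qt qx qxx qy qyy.
        continuous_on D (\<lambda>(t, x, y). qt t x y) \<and>
        continuous_on D (\<lambda>(t, x, y). qx t x y) \<and>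
        continuous_on D (\<lambda>(t, x, y). qxx t x y) \<and>
        continuous_on D (\<lambda>(t, x, y). qy t x y) \<and>
        continuous_on D (\<lambda>(t, x, y). qyy t x y) \<and>
        (\<forall>(t, x, y) \<in> interior D.
           ((\<lambda>r. q r x y) has_real_derivative qt t x y) (at t) \<and>
           ((\<lambda>z. q t z y) has_real_derivative qx t x y) (at x) \<and>
           ((\<lambda>z. qx t z y) has_real_derivative qxx t x y) (at x) \<and>
           ((\<lambda>z. q t x z) has_real_derivative qy t x y) (at y) \<and>
           ((\<lambda>z. qy t x z) has_real_derivative qyy t x y) (at y)))"

section \<open>First passage times of moving boundaries\<close>

text \<open>
  Boundaries take values in \<open>ereal\<close>, because a lower boundary may reach the left end point
  \<open>l = -\<infinity>\<close>.  The infimum of the empty set is \<open>\<infinity>\<close>.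
\<close>

definition first_passage :: "(real \<Rightarrow> 'w \<Rightarrow> real) \<Rightarrow> (real \<Rightarrow> ereal) \<Rightarrow> 'w \<Rightarrow> ereal" where
  "first_passage X g \<omega> = Inf {ereal t | t. 0 \<le> t \<and> ereal (X t \<omega>) = g t}"

definition shift :: "real \<Rightarrow> (real \<Rightarrow> ereal) \<Rightarrow> real \<Rightarrow> ereal" where
  "shift t f = (\<lambda>u. f (t + u))"

text \<open>
  This vanishes when \<open>y\<close> lies on the side of \<open>f t\<close> from which the path must cross \<open>f\<close>, and in general
  it has a kink at \<open>y = f t\<close>.  Its smoothness is therefore a condition on the other side of the
  boundary, up to \<open>f t\<close>, and its derivative at \<open>f t\<close> is one-sided.
\<close>

definition no_passage_prob ::
    "(real \<Rightarrow> 'w measure) \<Rightarrow> (real \<Rightarrow> 'w \<Rightarrow> real) \<Rightarrow> (real \<Rightarrow> ereal) \<Rightarrow> real \<Rightarrow> real \<Rightarrow> real" where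
  "no_passage_prob P X f t y =
     measure (P y) {\<omega> \<in> space (P y). first_passage X (shift t f) \<omega> = \<infinity>}"

definition lifetime :: "ereal \<Rightarrow> (real \<Rightarrow> ereal) \<Rightarrow> ereal" where
  "lifetime l f = Inf {ereal t | t. 0 \<le> t \<and> f t = l}"

text \<open>
  A boundary ends when it reaches \<open>l\<close>.  From then on it is sent to \<open>-\<infinity>\<close>, which a real-valued path
  never meets.  Without this convention a boundary that leaves \<open>l\<close> again, or a process reflected
  at \<open>l\<close>, could produce passages after the lifetime.
\<close>

definition killed :: "ereal \<Rightarrow> (real \<Rightarrow> ereal) \<Rightarrow> real \<Rightarrow> ereal" where
  "killed l f = (\<lambda>t. if ereal t < lifetime l f then f t else -\<infinity>)"

section \<open>Speed measure, scale function, boundary classification\<close>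

definition speed_measure :: "real set \<Rightarrow> (real \<Rightarrow> real) \<Rightarrow> real measure" where
  "speed_measure I \<rho> = density lborel (\<lambda>y. ennreal (\<rho> y) * indicator I y)"

definition generator :: "(real \<Rightarrow> real) \<Rightarrow> (real \<Rightarrow> real) \<Rightarrow> (real \<Rightarrow> real) \<Rightarrow> real \<Rightarrow> real" where
  "generator s \<rho> u x = 1 / \<rho> x * deriv (\<lambda>z. 1 / deriv s z * deriv u z) x"

text \<open>
  Green function of \<open>]a, b[\<close>.  There is no factor 2, in accordance with the generator being
  \<open>d/dm d/ds\<close>: Brownian motion has \<open>s(x) = x\<close> and \<open>m(dx) = 2 dx\<close>.
\<close>

definition green :: "(real \<Rightarrow> real) \<Rightarrow> real \<Rightarrow> real \<Rightarrow> real \<Rightarrow> real \<Rightarrow> real" where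
  "green s a b x y = (s (min x y) - s a) * (s b - s (max x y)) / (s b - s a)"

text \<open>
  Feller's classification.  All conditions are independent of the choice of the interior point \<open>z\<close>.
  Since \<open>s\<close> is continuously differentiable, \<open>s(da) = s'(a) da\<close>.
\<close>

definition exit_left :: "ereal \<Rightarrow> (real \<Rightarrow> real) \<Rightarrow> real measure \<Rightarrow> bool" where
  "exit_left l s m \<longleftrightarrow> (\<exists>z. l < ereal z \<and>
     (\<integral>\<^sup>+a\<in>einterval l (ereal z). emeasure m {a<..<z} * ennreal (deriv s a) \<partial>lborel) < \<infinity>)"

definition entrance_left :: "ereal \<Rightarrow> (real \<Rightarrow> real) \<Rightarrow> real measure \<Rightarrow> bool" where
  "entrance_left l s m \<longleftrightarrow> (\<exists>z. l < ereal z \<and>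
     (\<integral>\<^sup>+a\<in>einterval l (ereal z). ennreal (s z - s a) \<partial>m) < \<infinity>)"

definition exit_at_top :: "ereal \<Rightarrow> (real \<Rightarrow> real) \<Rightarrow> real measure \<Rightarrow> bool" where
  "exit_at_top l s m \<longleftrightarrow> (\<exists>z. l < ereal z \<and>
     (\<integral>\<^sup>+b\<in>{z<..}. emeasure m {z<..<b} * ennreal (deriv s b) \<partial>lborel) < \<infinity>)"

definition entrance_at_top :: "ereal \<Rightarrow> (real \<Rightarrow> real) \<Rightarrow> real measure \<Rightarrow> bool" where
  "entrance_at_top l s m \<longleftrightarrow> (\<exists>z. l < ereal z \<and>
     (\<integral>\<^sup>+b\<in>{z<..}. ennreal (s b - s z) \<partial>m) < \<infinity>)"

definition natural_left :: "ereal \<Rightarrow> (real \<Rightarrow> real) \<Rightarrow> real measure \<Rightarrow> bool" where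
  "natural_left l s m \<longleftrightarrow> \<not> exit_left l s m \<and> \<not> entrance_left l s m"

definition entrance_not_exit_left :: "ereal \<Rightarrow> (real \<Rightarrow> real) \<Rightarrow> real measure \<Rightarrow> bool" where
  "entrance_not_exit_left l s m \<longleftrightarrow> entrance_left l s m \<and> \<not> exit_left l s m"

definition natural_at_top :: "ereal \<Rightarrow> (real \<Rightarrow> real) \<Rightarrow> real measure \<Rightarrow> bool" where
  "natural_at_top l s m \<longleftrightarrow> \<not> exit_at_top l s m \<and> \<not> entrance_at_top l s m"

section \<open>Linear diffusions\<close>

definition past :: "'w measure \<Rightarrow> (real \<Rightarrow> 'w \<Rightarrow> real) \<Rightarrow> real \<Rightarrow> 'w measure" where
  "past M X t = sigma (space M) {X u -` B \<inter> space M | u B. 0 \<le> u \<and> u \<le> t \<and> B \<in> sets borel}"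

definition path_from :: "(real \<Rightarrow> 'w \<Rightarrow> real) \<Rightarrow> real \<Rightarrow> 'w \<Rightarrow> real \<Rightarrow> real" where
  "path_from X r \<omega> = (\<lambda>u\<in>{0..}. X (r + u) \<omega>)"

text \<open>
  The end point \<open>l\<close> may or may not belong to the state space \<open>I\<close>; regularity is only required for
  interior targets, so that \<open>l\<close> may be an entrance point in \<open>I\<close>.  The scale function and the speed
  measure are characterised by exit probabilities and mean exit times of compact intervals.  The strong Markov property is
  stated for finite stopping times; the general case follows by truncation.
\<close>

locale linear_diffusion =
  fixes l :: ereal and I :: "real set"
    and M :: "'w measure" and P :: "real \<Rightarrow> 'w measure" and X :: "real \<Rightarrow> 'w \<Rightarrow> real"
    and s \<rho> :: "real \<Rightarrow> real" and q :: "real \<Rightarrow> real \<Rightarrow> real \<Rightarrow> real"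
  assumes left_end: "l < \<infinity>"
    and state_space: "I = {x. l < ereal x} \<or> I = {x. l \<le> ereal x}"
    and prob: "\<And>x. x \<in> I \<Longrightarrow> prob_space (P x)"
    and sets_P: "\<And>x. x \<in> I \<Longrightarrow> sets (P x) = sets M"
    and X_measurable: "\<And>t. 0 \<le> t \<Longrightarrow> X t \<in> borel_measurable M"
    and X_continuous: "\<And>\<omega>. \<omega> \<in> space M \<Longrightarrow> continuous_on {0..} (\<lambda>t. X t \<omega>)"
    and conservative: "\<And>t \<omega>. 0 \<le> t \<Longrightarrow> \<omega> \<in> space M \<Longrightarrow> X t \<omega> \<in> I"
    and start: "\<And>x. x \<in> I \<Longrightarrow> AE \<omega> in P x. X 0 \<omega> = x"
    and kernel: "\<And>B. B \<in> sets (\<Pi>\<^sub>M u\<in>{0..}. borel) \<Longrightarrow>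
      (\<lambda>x. measure (P x) {\<omega> \<in> space M. path_from X 0 \<omega> \<in> B})
        \<in> borel_measurable (restrict_space borel I)"
    and strong_markov: "\<And>x \<tau> A B.
      x \<in> I \<Longrightarrow> stopping_time (past M X) \<tau> \<Longrightarrow> (\<And>\<omega>. \<omega> \<in> space M \<Longrightarrow> 0 \<le> \<tau> \<omega>) \<Longrightarrow>
      A \<in> sets (filtration.pre_sigma (space M) (past M X) \<tau>) \<Longrightarrow>
      B \<in> sets (\<Pi>\<^sub>M u\<in>{0..}. borel) \<Longrightarrow>
      measure (P x) {\<omega> \<in> A. path_from X (\<tau> \<omega>) \<omega> \<in> B} =
        (LINT \<omega>:A|P x. measure (P (X (\<tau> \<omega>) \<omega>)) {\<omega>' \<in> space M. path_from X 0 \<omega>' \<in> B})"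
    and regular: "\<And>x y. x \<in> I \<Longrightarrow> l < ereal y \<Longrightarrow>
      0 < measure (P x) {\<omega> \<in> space M. first_passage X (\<lambda>_. ereal y) \<omega> < \<infinity>}"
    and scale_C2: "s C1_differentiable_on {x. l < ereal x}"
      "deriv s C1_differentiable_on {x. l < ereal x}"
    and scale_deriv_pos: "\<And>x. l < ereal x \<Longrightarrow> 0 < deriv s x"
    and scale: "\<And>a x b. l < ereal a \<Longrightarrow> a < x \<Longrightarrow> x < b \<Longrightarrow>
      measure (P x) {\<omega> \<in> space M.
          first_passage X (\<lambda>_. ereal a) \<omega> < first_passage X (\<lambda>_. ereal b) \<omega>} =
        (s b - s x) / (s b - s a)"
    and speed_measurable: "\<rho> \<in> borel_measurable borel"
    and speed_pos: "\<And>x. l < ereal x \<Longrightarrow> 0 < \<rho> x"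
    and speed_locally_finite: "\<And>a b. l < ereal a \<Longrightarrow> emeasure (speed_measure I \<rho>) {a..b} < \<infinity>"
    and speed: "\<And>a x b. l < ereal a \<Longrightarrow> a < x \<Longrightarrow> x < b \<Longrightarrow>
      (\<integral>\<^sup>+\<omega>. e2ennreal (min (first_passage X (\<lambda>_. ereal a) \<omega>)
          (first_passage X (\<lambda>_. ereal b) \<omega>)) \<partial>P x) =
        (\<integral>\<^sup>+y\<in>{a<..<b}. ennreal (green s a b x y) \<partial>speed_measure I \<rho>)"
    and natural_infinity: "natural_at_top l s (speed_measure I \<rho>)"
    and density_nonneg: "\<And>t x y. 0 < t \<Longrightarrow> x \<in> I \<Longrightarrow> y \<in> I \<Longrightarrow> 0 \<le> q t x y"
    and density: "\<And>t x A. 0 < t \<Longrightarrow> x \<in> I \<Longrightarrow> A \<in> sets borel \<Longrightarrow>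
      emeasure (P x) {\<omega> \<in> space M. X t \<omega> \<in> A} =
        (\<integral>\<^sup>+y\<in>A \<inter> I. ennreal (q t x y) \<partial>speed_measure I \<rho>)"
    and density_symmetric: "\<And>t x y. 0 < t \<Longrightarrow> x \<in> I \<Longrightarrow> y \<in> I \<Longrightarrow> q t x y = q t y x"
    and density_C122: "C122_on ({0<..} \<times> I \<times> I) q"
    and kolmogorov: "\<And>t x y. 0 < t \<Longrightarrow> l < ereal x \<Longrightarrow> y \<in> I \<Longrightarrow>
      generator s \<rho> (\<lambda>z. q t z y) x = deriv (\<lambda>r. q r x y) t"

end

theory Submission
  imports Defs
begin

text \<open>
  Start from \<open>x\<close> on the side of the boundary from which a passage is certain, and let \<open>u(t)\<close> be the
  probability of no passage after time \<open>t\<close>, the distribution function of the last passage time, so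
  that \<open>u\<close> increases from \<open>0\<close> to \<open>1\<close>.  By the Markov property, \<open>u(t + h) - u(t)\<close> is the integral of
  \<open>q(t,x,y)\<close> with respect to \<open>W(y) m(dy)\<close>, where \<open>W(y)\<close> is the probability that the last passage
  occurs before \<open>t + h\<close> when the process is at \<open>y\<close> at time \<open>t\<close>.  As \<open>W\<close> is \<open>o(h)\<close> away from the
  boundary, only a cut-off of \<open>q(t,x,\<cdot>)\<close> near \<open>f(t)\<close> matters.  Symmetry of the semigroup moves the
  generator onto this cut-off, and Green's formula together with the backward equation for \<open>H\<close>
  leaves the boundary term \<open>\<Phi>(t) q(t,x,f(t))\<close> as the right derivative of \<open>u\<close>.
\<close>

section \<open>Auxiliary real analysis\<close>

text \<open>The obstacle is lack of smoothness. \<open>H\<close> has in general a kink at the moving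
  boundary, so the generator cannot act on it; hence only compactly supported C^2 functions are ever
  put under the generator, while \<open>H\<close> enters through a Lipschitz bound in time and a
  pointwise limit off the null set \<open>{c t}\<close>. The speed density is given as a measurable
  function; its continuity, which makes the generator of a test function bounded and continuous, is
  recovered by solving the Kolmogorov equation for it. That \<open>H\<close> vanishes on the wrong
  side is not immediate either: the hypothesis on the final position of the path concerns a process
  started at time 0, and reaches a start at time \<open>t\<close> only through the law of
  \<open>X t\<close>; absolute continuity, symmetry and total mass one of that law carry it over.
  Finally the Markov property looks forward in time, so only a right derivative comes out. As it is
  continuous and \<open>u\<close> is continuous, it is a derivative, and as it is nonnegative the
  fundamental theorem of calculus yields integrability along with the value of the integral.\<close>

lemma eventually_at_right_0_real: "0 < d \<Longrightarrow> eventually (\<lambda>h::real. 0 < h \<and> h < d) (at_right 0)"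
  using eventually_at_right_real[of 0 d] by (simp add: greaterThanLessThan_iff)

text \<open>Limits at 0 from the right are tested along sequences, for which dominated convergence
  is available. Measurability and the bound are asked only for \<open>h < h0\<close>, since a time
  increment must not run past the lifetime of the boundary.\<close>

lemma integral_dominated_convergence_at_right:
  fixes f :: "real \<Rightarrow> 'a \<Rightarrow> real"
  assumes "0 < h0"
    and f: "\<And>h. 0 < h \<Longrightarrow> h < h0 \<Longrightarrow> f h \<in> borel_measurable M"
    and g: "g \<in> borel_measurable M" and w: "integrable M w"
    and lim: "AE x in M. ((\<lambda>h. f h x) \<longlongrightarrow> g x) (at_right 0)"
    and bound: "\<And>h. 0 < h \<Longrightarrow> h < h0 \<Longrightarrow> AE x in M. \<bar>f h x\<bar> \<le> w x"
  shows "((\<lambda>h. integral\<^sup>L M (f h)) \<longlongrightarrow> integral\<^sup>L M g) (at_right 0)"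
proof (rule tendsto_at_right_sequentially[OF \<open>0 < h0\<close>])
  fix S :: "nat \<Rightarrow> real"
  assume S: "\<And>n. 0 < S n" "\<And>n. S n < h0" "S \<longlonglongrightarrow> 0"
  then have "filterlim S (at_right 0) sequentially"
    by (auto simp: filterlim_at intro!: always_eventually less_imp_neq[symmetric])
  then have "AE x in M. (\<lambda>n. f (S n) x) \<longlonglongrightarrow> g x"
    using lim by (auto intro: filterlim_compose)
  then show "(\<lambda>n. integral\<^sup>L M (f (S n))) \<longlonglongrightarrow> integral\<^sup>L M g"
    by (rule integral_dominated_convergence[where w = w, rotated 3]) (use S f g w bound in auto)
qed

lemma DERIV_transform_nhds:
  assumes "DERIV f x :> D" "eventually (\<lambda>z. f z = g z) (nhds x)"
  shows "DERIV g x :> D"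
  by (rule iffD1[OF DERIV_cong_ev[OF refl assms(2) refl] assms(1)])

lemma has_field_derivative_continuous_on:
  "(\<And>z. z \<in> X \<Longrightarrow> DERIV f z :> f' z) \<Longrightarrow> continuous_on X f"
  by (rule DERIV_continuous_on, rule has_field_derivative_at_within) auto

lemma (in prob_space) integrable_if_bounded:
  fixes f :: "'a \<Rightarrow> real"
  assumes "f \<in> borel_measurable M" "AE x in M. \<bar>f x\<bar> \<le> C"
  shows "integrable M f"
  using assms by (intro integrable_const_bound[where B = C]) auto

lemma (in prob_space) abs_expectation_le:
  fixes f :: "'a \<Rightarrow> real"
  assumes "f \<in> borel_measurable M" "AE x in M. \<bar>f x\<bar> \<le> C"
  shows "\<bar>\<integral>x. f x \<partial>M\<bar> \<le> C"
proof -
  have "AE x in M. f x \<le> C" "AE x in M. - C \<le> f x"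
    using assms(2) by (auto elim!: eventually_mono)
  then show ?thesis
    using integral_le_const[of f C] integral_ge_const[of f "- C"] integrable_if_bounded[OF assms] by auto
qed

text \<open>Dominated convergence for indicators. Membership only has to stabilise path by path, so
  the sequence of events need not be monotone.\<close>

lemma (in prob_space) prob_tendsto:
  assumes "\<And>n. A n \<in> events" "B \<in> events"
    and "AE \<omega> in M. eventually (\<lambda>n. \<omega> \<in> A n \<longleftrightarrow> \<omega> \<in> B) sequentially"
  shows "(\<lambda>n. prob (A n)) \<longlonglongrightarrow> prob B"
proof -
  have "(\<lambda>n. \<integral>\<omega>. (indicator (A n) \<omega> :: real) \<partial>M) \<longlonglongrightarrow> (\<integral>\<omega>. indicator B \<omega> \<partial>M)"
  proof (rule integral_dominated_convergence[where w = "\<lambda>_. 1 :: real"])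
    show "AE \<omega> in M. (\<lambda>n. indicator (A n) \<omega> :: real) \<longlonglongrightarrow> indicator B \<omega>"
      using assms(3)
    proof eventually_elim
      case (elim \<omega>)
      then show ?case
        by (intro tendsto_eventually) (auto elim!: eventually_mono simp: indicator_def)
    qed
  qed (use assms in auto)
  then show ?thesis
    using assms(1,2) by (simp add: Int_absorb1 sets.sets_into_space)
qed

text \<open>Dini's argument: the last time up to which the deviation from \<open>d a\<close> is at
  most \<open>e\<close> times the elapsed time must be \<open>b\<close>, since earlier the zero
  right derivative would let the bound continue for a while. Then \<open>e\<close> tends to
  0.\<close>

lemma zero_right_derivative_imp_eq:
  fixes d :: "real \<Rightarrow> real"
  assumes "a \<le> b" and cont: "continuous_on {a..b} d"
    and der: "\<And>t. a \<le> t \<Longrightarrow> t < b \<Longrightarrow> ((\<lambda>h. (d (t + h) - d t) / h) \<longlongrightarrow> 0) (at_right 0)"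
  shows "d b = d a"
proof -
  have "\<bar>d b - d a\<bar> \<le> e * (b - a)" if "0 < e" for e
  proof (rule ccontr)
    assume neg: "\<not> ?thesis"
    define g where "g t = \<bar>d t - d a\<bar> - e * (t - a)" for t
    define Z where "Z = {t \<in> {a..b}. g t \<le> 0}"
    have "continuous_on {a..b} g"
      unfolding g_def by (intro continuous_intros cont)
    then have "closed Z"
      unfolding Z_def using continuous_closed_preimage[of "{a..b}" g "{..0}"]
      by (simp add: vimage_def Int_def)
    moreover have "Z \<noteq> {}" "bdd_above Z"
      using \<open>a \<le> b\<close> by (auto simp: Z_def g_def intro!: bdd_aboveI[of _ b])
    ultimately have sup: "Sup Z \<in> Z"
      by (intro closed_contains_Sup)
    define t where "t = Sup Z"
    have t: "a \<le> t" "t \<le> b" "g t \<le> 0"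
      using sup by (auto simp: t_def Z_def)
    have "g b > 0"
      using neg by (simp add: g_def)
    with t have "t < b" by (cases "t = b") auto
    have above: "g r > 0" if "t < r" "r \<le> b" for r
    proof (rule ccontr)
      assume "\<not> g r > 0"
      then have "r \<in> Z" using that t by (auto simp: Z_def)
      then have "r \<le> t" unfolding t_def by (intro cSup_upper \<open>bdd_above Z\<close>)
      with that show False by simp
    qed
    have "eventually (\<lambda>h. \<bar>(d (t + h) - d t) / h\<bar> < e) (at_right 0)"
      using tendstoD[OF der[OF t(1) \<open>t < b\<close>] \<open>0 < e\<close>] by (simp add: dist_real_def)
    moreover have "eventually (\<lambda>h. 0 < h \<and> h < b - t) (at_right 0)"
      using \<open>t < b\<close> by (intro eventually_at_right_0_real) simp
    ultimately have "eventually (\<lambda>h. \<bar>(d (t + h) - d t) / h\<bar> < e \<and> 0 < h \<and> h < b - t) (at_right 0)"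
      by eventually_elim auto
    then obtain h where h: "\<bar>(d (t + h) - d t) / h\<bar> < e" "0 < h" "h < b - t"
      using eventually_happens' [OF trivial_limit_at_right_real] by blast
    have "\<bar>d (t + h) - d t\<bar> \<le> e * h"
      using h by (simp add: abs_divide field_simps)
    then have "g (t + h) \<le> g t"
      unfolding g_def by (simp add: algebra_simps)
    with above[of "t + h"] h t show False by simp
  qed
  then have "\<bar>d b - d a\<bar> \<le> 0 + e" if "0 < e" for e
  proof (cases "a = b")
    case False
    then show ?thesis
      using \<open>\<And>e. 0 < e \<Longrightarrow> \<bar>d b - d a\<bar> \<le> e * (b - a)\<close>[of "e / (b - a)"] \<open>0 < e\<close> \<open>a \<le> b\<close> by simp
  qed (use that in simp)
  then have "\<bar>d b - d a\<bar> \<le> 0"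
    by (rule field_le_epsilon)
  then show ?thesis by simp
qed

text \<open>Subtracting a primitive of the continuous \<open>k\<close> leaves a continuous function
  whose right derivative is zero, hence a constant. Continuity of \<open>u\<close> matters: a right
  derivative alone does not see jumps from the left.\<close>

lemma continuous_right_derivative_imp_DERIV:
  fixes u k :: "real \<Rightarrow> real"
  assumes J: "open J"
    and u: "continuous_on J u" and k: "continuous_on J k"
    and der: "\<And>t. t \<in> J \<Longrightarrow> ((\<lambda>h. (u (t + h) - u t) / h) \<longlongrightarrow> k t) (at_right 0)"
    and t: "t \<in> J"
  shows "DERIV u t :> k t"
proof -
  obtain e where e: "0 < e" "cball t e \<subseteq> J"
    using J t by (meson open_contains_cball)
  define a0 a b where "a0 = t - e" and "a = t - e / 2" and "b = t + e"
  have ab: "{a0..b} \<subseteq> J" "a0 < a" "a < t" "t < b"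
    using e by (auto simp: a0_def a_def b_def cball_eq_atLeastAtMost)
  have k': "continuous_on {a0..b} k" and u': "continuous_on {a0..b} u"
    using k u ab continuous_on_subset by blast+
  define F where "F r = integral {a0..r} k" for r
  have F': "DERIV F r :> k r" if "a0 < r" "r < b" for r
    using integral_has_vector_derivative[OF k', of r] that at_within_Icc_at[of a0 r b]
    by (simp add: F_def[abs_def] has_real_derivative_iff_has_vector_derivative)
  have eq: "u r - F r = u a - F a" if r: "a \<le> r" "r < b" for r
  proof (rule zero_right_derivative_imp_eq[where d = "\<lambda>r. u r - F r"])
    have "continuous_on {a..r} u"
      by (rule continuous_on_subset[OF u']) (use r ab in auto)
    moreover have "continuous_on {a..r} F"
      by (rule has_field_derivative_continuous_on[OF F']) (use ab r in auto)
    ultimately show "continuous_on {a..r} (\<lambda>r. u r - F r)"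
      by (intro continuous_intros)
  next
    fix v assume v: "a \<le> v" "v < r"
    have "((\<lambda>h. (F (v + h) - F v) / h) \<longlongrightarrow> k v) (at 0)"
      using F'[of v] v r ab by (simp add: DERIV_def)
    then have "((\<lambda>h. (F (v + h) - F v) / h) \<longlongrightarrow> k v) (at_right 0)"
      by (simp add: filterlim_at_split)
    moreover have "((\<lambda>h. (u (v + h) - u v) / h) \<longlongrightarrow> k v) (at_right 0)"
      by (intro der subsetD[OF ab(1)]) (use v r ab in auto)
    ultimately have "((\<lambda>h. (u (v + h) - u v) / h - (F (v + h) - F v) / h) \<longlongrightarrow> k v - k v) (at_right 0)"
      by (intro tendsto_diff)
    then show "((\<lambda>h. (u (v + h) - F (v + h) - (u v - F v)) / h) \<longlongrightarrow> 0) (at_right 0)"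
      by (simp add: diff_divide_distrib add_divide_distrib algebra_simps)
  qed (use r in auto)
  have "DERIV (\<lambda>r. F r + (u a - F a)) t :> k t"
    using F'[of t] ab by (auto intro!: derivative_eq_intros)
  moreover have "eventually (\<lambda>r. r \<in> {a<..<b}) (nhds t)"
    using ab by (intro eventually_nhds_in_open) auto
  then have "eventually (\<lambda>r. F r + (u a - F a) = u r) (nhds t)"
  proof eventually_elim
    case (elim r)
    then show ?case using eq[of r] by simp
  qed
  ultimately show ?thesis
    by (rule DERIV_transform_nhds)
qed

text \<open>Between the first and the last zero the net change is zero, so the mean value theorem is
  applied only on the two outer intervals, which contain no zero inside. Meant for
  \<open>H r z\<close> as a function of \<open>r\<close>, which is known to be differentiable while
  \<open>z\<close> is on the smooth side and is zero otherwise.\<close>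

lemma lipschitz_off_zeros:
  fixes k :: "real \<Rightarrow> real"
  assumes "\<alpha> \<le> \<beta>" "0 \<le> C" and cont: "continuous_on {\<alpha>..\<beta>} k"
    and der: "\<And>r. \<alpha> < r \<Longrightarrow> r < \<beta> \<Longrightarrow> k r \<noteq> 0 \<Longrightarrow> \<exists>D. DERIV k r :> D \<and> \<bar>D\<bar> \<le> C"
  shows "\<bar>k \<beta> - k \<alpha>\<bar> \<le> C * (\<beta> - \<alpha>)"
proof -
  have nz: "\<bar>k b - k a\<bar> \<le> C * (b - a)"
    if "\<alpha> \<le> a" "a \<le> b" "b \<le> \<beta>" and no: "\<And>r. a < r \<Longrightarrow> r < b \<Longrightarrow> k r \<noteq> 0" for a b
  proof (cases "a = b")
    case False
    with that have "a < b" by simp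
    moreover have "continuous_on {a..b} k"
      using cont that by (auto intro: continuous_on_subset)
    moreover have "k differentiable (at r)" if "a < r" "r < b" for r
      using der[of r] no[of r] that \<open>\<alpha> \<le> a\<close> \<open>b \<le> \<beta>\<close> real_differentiable_def by fastforce
    ultimately obtain l z where z: "a < z" "z < b" "DERIV k z :> l" "k b - k a = (b - a) * l"
      using MVT[of a b k] by blast
    then have "\<bar>l\<bar> \<le> C"
      using der[of z] no[of z] that DERIV_unique by fastforce
    then show ?thesis
      using z \<open>a < b\<close> by (simp add: abs_mult mult.commute mult_left_mono)
  qed simp
  define Z where "Z = {r \<in> {\<alpha>..\<beta>}. k r = 0}"
  show ?thesis
  proof (cases "Z = {}")
    case True
    then show ?thesis
      using \<open>\<alpha> \<le> \<beta>\<close> by (intro nz) (auto simp: Z_def)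
  next
    case False
    have "closed Z"
      unfolding Z_def using continuous_closed_preimage_constant[OF cont closed_atLeastAtMost] by simp
    moreover have bdd: "bdd_above Z" "bdd_below Z"
      by (auto simp: Z_def intro: bdd_aboveI[of _ \<beta>] bdd_belowI[of _ \<alpha>])
    ultimately have "Sup Z \<in> Z" "Inf Z \<in> Z"
      using False closed_contains_Sup[of Z] closed_contains_Inf[of Z] by blast+
    then have Z: "\<alpha> \<le> Sup Z" "Sup Z \<le> \<beta>" "k (Sup Z) = 0" "\<alpha> \<le> Inf Z" "Inf Z \<le> \<beta>" "k (Inf Z) = 0"
      by (auto simp: Z_def)
    have le: "Inf Z \<le> Sup Z"
      using \<open>Sup Z \<in> Z\<close> bdd cInf_lower by blast
    have "\<bar>k (Inf Z) - k \<alpha>\<bar> \<le> C * (Inf Z - \<alpha>)"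
    proof (rule nz)
      fix r assume r: "\<alpha> < r" "r < Inf Z"
      then show "k r \<noteq> 0"
        using cInf_lower[OF _ bdd(2), of r] Z by (auto simp: Z_def)
    qed (use Z in auto)
    moreover have "\<bar>k \<beta> - k (Sup Z)\<bar> \<le> C * (\<beta> - Sup Z)"
    proof (rule nz)
      fix r assume r: "Sup Z < r" "r < \<beta>"
      then show "k r \<noteq> 0"
        using cSup_upper[OF _ bdd(1), of r] Z by (auto simp: Z_def)
    qed (use Z in auto)
    ultimately have "\<bar>k \<beta> - k \<alpha>\<bar> \<le> C * (Inf Z - \<alpha>) + C * (\<beta> - Sup Z)"
      using Z by simp
    also have "\<dots> \<le> C * (\<beta> - \<alpha>)"
      using mult_left_mono[OF le \<open>0 \<le> C\<close>] by (simp add: algebra_simps)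
    finally show ?thesis .
  qed
qed

text \<open>L'Hopital's rule for the difference quotient: a limit of the derivatives is a one-sided
  derivative at the end point. This identifies the continuous extension of \<open>hy\<close> to the
  boundary with a derivative of \<open>H\<close>.\<close>

lemma DERIV_right_from_limit:
  fixes k k' :: "real \<Rightarrow> real"
  assumes "(k \<longlongrightarrow> k c) (at_right c)" "eventually (\<lambda>y. DERIV k y :> k' y) (at_right c)" "(k' \<longlongrightarrow> D) (at_right c)"
  shows "(k has_real_derivative D) (at_right c)"
  unfolding has_field_derivative_iff
proof (rule lhopital_right)
  show "((\<lambda>y. k y - k c) \<longlongrightarrow> 0) (at_right c)"
    by (rule iffD1[OF Lim_null assms(1)])
  show "((\<lambda>y. y - c) \<longlongrightarrow> 0) (at_right c)"
    by (rule iffD1[OF Lim_null tendsto_ident_at])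
  show "eventually (\<lambda>y. y - c \<noteq> 0) (at_right c)"
    by (rule eventually_at_rightI[of _ "c + 1"]) auto
  show "eventually (\<lambda>y. DERIV (\<lambda>y. k y - k c) y :> k' y) (at_right c)"
    using assms(2) by eventually_elim (auto intro!: derivative_eq_intros)
  show "eventually (\<lambda>y. DERIV (\<lambda>y. y - c) y :> 1) (at_right c)"
    by (intro always_eventually allI) (auto intro!: derivative_eq_intros)
qed (use assms(3) in auto)

lemma DERIV_left_from_limit:
  fixes k k' :: "real \<Rightarrow> real"
  assumes "(k \<longlongrightarrow> k c) (at_left c)" "eventually (\<lambda>y. DERIV k y :> k' y) (at_left c)" "(k' \<longlongrightarrow> D) (at_left c)"
  shows "(k has_real_derivative D) (at_left c)"
  unfolding has_field_derivative_iff
proof (rule lhopital_left)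
  show "((\<lambda>y. k y - k c) \<longlongrightarrow> 0) (at_left c)"
    by (rule iffD1[OF Lim_null assms(1)])
  show "((\<lambda>y. y - c) \<longlongrightarrow> 0) (at_left c)"
    by (rule iffD1[OF Lim_null tendsto_ident_at])
  show "eventually (\<lambda>y. y - c \<noteq> 0) (at_left c)"
    by (rule eventually_at_leftI[of "c - 1"]) auto
  show "eventually (\<lambda>y. DERIV (\<lambda>y. k y - k c) y :> k' y) (at_left c)"
    using assms(2) by eventually_elim (auto intro!: derivative_eq_intros)
  show "eventually (\<lambda>y. DERIV (\<lambda>y. y - c) y :> 1) (at_left c)"
    by (intro always_eventually allI) (auto intro!: derivative_eq_intros)
qed (use assms(3) in auto)

section \<open>Countable descriptions of events of continuous paths\<close>

lemma rational_dense_Icc: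
  fixes u h d :: real
  assumes "u \<in> {0..h}" "0 < d"
  shows "\<exists>r\<in>\<rat>. 0 \<le> r \<and> r \<le> h \<and> \<bar>r - u\<bar> < d"
proof (cases "h = 0")
  case True
  then show ?thesis using assms by (intro bexI[of _ 0]) auto
next
  case False
  then have "max 0 (u - d) < min h (u + d)"
    using assms by auto
  then obtain r where "r \<in> \<rat>" "max 0 (u - d) < r" "r < min h (u + d)"
    using Rats_dense_in_real by blast
  then show ?thesis by (intro bexI[of _ r]) auto
qed

text \<open>The uncountable union over \<open>u\<close> becomes countable, which is what
  measurability of hitting events requires. The backward direction is compactness: the absolute
  value of \<open>g\<close> attains its minimum, and a positive minimum would exceed some
  \<open>1 / real (Suc n)\<close>.\<close>

lemma zero_iff_rational_approx:
  fixes g :: "real \<Rightarrow> real"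
  assumes g: "continuous_on {0..h} g" and "0 \<le> h"
  shows "(\<exists>u\<in>{0..h}. g u = 0) \<longleftrightarrow> (\<forall>n::nat. \<exists>r\<in>\<rat> \<inter> {0..h}. \<bar>g r\<bar> < 1 / real (Suc n))"
proof
  assume "\<exists>u\<in>{0..h}. g u = 0"
  then obtain u where u: "u \<in> {0..h}" "g u = 0" by blast
  show "\<forall>n::nat. \<exists>r\<in>\<rat> \<inter> {0..h}. \<bar>g r\<bar> < 1 / real (Suc n)"
  proof
    fix n :: nat
    have "0 < 1 / real (Suc n)" by simp
    then obtain d where d: "0 < d" "\<And>r. r \<in> {0..h} \<Longrightarrow> dist r u < d \<Longrightarrow> dist (g r) (g u) < 1 / real (Suc n)"
      using g u(1) unfolding continuous_on_iff by meson
    obtain r where "r \<in> \<rat>" "0 \<le> r" "r \<le> h" "\<bar>r - u\<bar> < d"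
      using rational_dense_Icc[OF u(1) d(1)] by blast
    then show "\<exists>r\<in>\<rat> \<inter> {0..h}. \<bar>g r\<bar> < 1 / real (Suc n)"
      using d(2)[of r] u(2) by (intro bexI[of _ r]) (auto simp: dist_real_def)
  qed
next
  assume approx: "\<forall>n::nat. \<exists>r\<in>\<rat> \<inter> {0..h}. \<bar>g r\<bar> < 1 / real (Suc n)"
  have "continuous_on {0..h} (\<lambda>r. \<bar>g r\<bar>)"
    using g by (intro continuous_intros)
  then obtain u where u: "u \<in> {0..h}" "\<And>r. r \<in> {0..h} \<Longrightarrow> \<bar>g u\<bar> \<le> \<bar>g r\<bar>"
    using continuous_attains_inf[of "{0..h}" "\<lambda>r. \<bar>g r\<bar>"] \<open>0 \<le> h\<close> by fastforce
  have "g u = 0"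
  proof (rule ccontr)
    assume "g u \<noteq> 0"
    then obtain n where "1 / real (Suc n) < \<bar>g u\<bar>"
      using reals_Archimedean[of "\<bar>g u\<bar>"] by (auto simp: inverse_eq_divide)
    moreover obtain r where "r \<in> {0..h}" "\<bar>g r\<bar> < 1 / real (Suc n)"
      using approx by blast
    ultimately show False
      using u(2)[of r] by linarith
  qed
  with u show "\<exists>u\<in>{0..h}. g u = 0" by blast
qed

lemma bounded_on_rationals_imp:
  fixes g :: "real \<Rightarrow> real"
  assumes g: "continuous_on {0..h} g" and b: "\<And>r. r \<in> \<rat> \<Longrightarrow> 0 \<le> r \<Longrightarrow> r \<le> h \<Longrightarrow> \<bar>g r\<bar> \<le> d"
    and u: "u \<in> {0..h}"
  shows "\<bar>g u\<bar> \<le> d"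
proof (rule ccontr)
  assume "\<not> ?thesis"
  then have "0 < \<bar>g u\<bar> - d" by simp
  then obtain e where e: "0 < e" "\<And>r. r \<in> {0..h} \<Longrightarrow> dist r u < e \<Longrightarrow> dist (g r) (g u) < \<bar>g u\<bar> - d"
    using g u unfolding continuous_on_iff by meson
  obtain r where "r \<in> \<rat>" "0 \<le> r" "r \<le> h" "\<bar>r - u\<bar> < e"
    using rational_dense_Icc[OF u e(1)] by blast
  then show False
    using e(2)[of r] b[of r] by (auto simp: dist_real_def)
qed

section \<open>Compactly supported C^2 test functions\<close>

lemma bounded_if_compact_support:
  fixes f :: "real \<Rightarrow> real"
  assumes f: "continuous_on UNIV f" and supp: "\<And>z. z \<notin> {a..b} \<Longrightarrow> f z = 0"
  obtains C where "0 \<le> C" "\<And>z. \<bar>f z\<bar> \<le> C"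
proof -
  have "bounded (f ` {a..b})"
    using f by (intro compact_imp_bounded compact_continuous_image) (auto intro: continuous_on_subset)
  then obtain C where C: "\<forall>z\<in>{a..b}. \<bar>f z\<bar> \<le> C"
    by (auto simp: bounded_iff)
  show ?thesis
  proof (rule that[of "max 0 C"])
    show "\<bar>f z\<bar> \<le> max 0 C" for z
      using bspec[OF C, of z] supp[of z] by (cases "z \<in> {a..b}") auto
  qed simp
qed

text \<open>The two derivatives are parameters rather than existentially bound, so that the
  generator can be evaluated on their values. Support in the open interval makes
  \<open>\<psi>\<close> and \<open>\<psi>1\<close> vanish at \<open>a\<close> and \<open>b\<close>,
  which kills the end terms of Green's identity. For \<open>b \<le> a\<close> only the zero function
  qualifies.\<close>

definition C2_supp :: "real \<Rightarrow> real \<Rightarrow> (real \<Rightarrow> real) \<Rightarrow> (real \<Rightarrow> real) \<Rightarrow> (real \<Rightarrow> real) \<Rightarrow> bool" where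
  "C2_supp a b \<psi> \<psi>1 \<psi>2 \<longleftrightarrow>
     (\<forall>z. DERIV \<psi> z :> \<psi>1 z) \<and> (\<forall>z. DERIV \<psi>1 z :> \<psi>2 z) \<and> continuous_on UNIV \<psi>2 \<and>
     (\<forall>z. z \<notin> {a<..<b} \<longrightarrow> \<psi> z = 0 \<and> \<psi>1 z = 0 \<and> \<psi>2 z = 0)"

text \<open>Freezing the argument outside the unit interval glues constants to \<open>p\<close>; the
  one-sided difference quotients agree at 0 and 1 because \<open>p'\<close> vanishes there.\<close>

lemma DERIV_clamp:
  fixes p p' :: "real \<Rightarrow> real"
  assumes p: "\<And>x. DERIV p x :> p' x" and p': "p' 0 = 0" "p' 1 = 0"
  shows "DERIV (\<lambda>x. p (min 1 (max 0 x))) x :> p' (min 1 (max 0 x))"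
proof -
  let ?f = "\<lambda>x. p (min 1 (max 0 x))"
  have const: "DERIV ?f x :> 0" if "eventually (\<lambda>z. c = ?f z) (nhds x)" for x c
    by (rule DERIV_transform_nhds[OF DERIV_const that])
  have split: "DERIV ?f x :> D" if "((\<lambda>y. (?f y - ?f x) / (y - x)) \<longlongrightarrow> D) (at_left x)"
    "((\<lambda>y. (?f y - ?f x) / (y - x)) \<longlongrightarrow> D) (at_right x)" for x D
    unfolding has_field_derivative_iff using that by (simp add: filterlim_at_split)
  have pq: "((\<lambda>y. (p y - p x) / (y - x)) \<longlongrightarrow> p' x) (at_left x)"
    "((\<lambda>y. (p y - p x) / (y - x)) \<longlongrightarrow> p' x) (at_right x)" for x
    using p[of x] unfolding has_field_derivative_iff by (auto simp: filterlim_at_split)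
  consider "x < 0" | "x = 0" | "0 < x" "x < 1" | "x = 1" | "1 < x" by linarith
  then show ?thesis
  proof cases
    case 1
    have "eventually (\<lambda>z. z \<in> {..<0}) (nhds x)"
      using 1 by (intro eventually_nhds_in_open) auto
    then have "eventually (\<lambda>z. p 0 = ?f z) (nhds x)"
      by eventually_elim (auto simp: max_def)
    then show ?thesis using const 1 p' by (simp add: max_def)
  next
    case 2
    have "((\<lambda>y. (?f y - ?f 0) / (y - 0)) \<longlongrightarrow> 0) (at_left 0)"
      by (rule tendsto_eventually) (use eventually_at_left_real[of "-1" 0] in \<open>auto elim!: eventually_mono simp: max_def\<close>)
    moreover have "((\<lambda>y. (?f y - ?f 0) / (y - 0)) \<longlongrightarrow> 0) (at_right 0)"
      by (rule Lim_transform_eventually[OF pq(2)[of 0, unfolded p']])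
        (use eventually_at_right_real[of 0 1] in \<open>auto elim!: eventually_mono simp: max_def min_def\<close>)
    ultimately show ?thesis using split[of 0 0] 2 p' by simp
  next
    case 3
    have "eventually (\<lambda>z. z \<in> {0<..<1}) (nhds x)"
      using 3 by (intro eventually_nhds_in_open) auto
    then have "eventually (\<lambda>z. p z = ?f z) (nhds x)"
      by eventually_elim (auto simp: max_def min_def)
    then have "DERIV ?f x :> p' x"
      using p by (rule DERIV_transform_nhds[rotated])
    then show ?thesis using 3 by (simp add: max_def min_def)
  next
    case 4
    have "((\<lambda>y. (?f y - ?f 1) / (y - 1)) \<longlongrightarrow> 0) (at_right 1)"
      by (rule tendsto_eventually) (use eventually_at_right_real[of 1 2] in \<open>auto elim!: eventually_mono simp: max_def min_def\<close>)
    moreover have "((\<lambda>y. (?f y - ?f 1) / (y - 1)) \<longlongrightarrow> 0) (at_left 1)"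
      by (rule Lim_transform_eventually[OF pq(1)[of 1, unfolded p']])
        (use eventually_at_left_real[of 0 1] in \<open>auto elim!: eventually_mono simp: max_def min_def\<close>)
    ultimately show ?thesis using split[of 1 0] 4 p' by simp
  next
    case 5
    have "eventually (\<lambda>z. z \<in> {1<..}) (nhds x)"
      using 5 by (intro eventually_nhds_in_open) auto
    then have "eventually (\<lambda>z. p 1 = ?f z) (nhds x)"
      by eventually_elim (auto simp: max_def min_def)
    then show ?thesis using const 5 p' by (simp add: max_def min_def)
  qed
qed

text \<open>A product of a rising and a falling step. The vanishing of \<open>\<phi>1\<close> and
  \<open>\<phi>2\<close> on the plateau is recorded because it makes the generator of the bump zero
  there, which turns being away from a neighbourhood after time \<open>h\<close> into an
  \<open>o(h)\<close> event.\<close>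

lemma C2_supp_bump:
  assumes "a' < a" "a \<le> b" "b < b'"
  obtains \<phi> \<phi>1 \<phi>2 where "C2_supp a' b' \<phi> \<phi>1 \<phi>2" "\<And>z. 0 \<le> \<phi> z" "\<And>z. \<phi> z \<le> 1"
    "\<And>z. z \<in> {a..b} \<Longrightarrow> \<phi> z = 1 \<and> \<phi>1 z = 0 \<and> \<phi>2 z = 0"
proof -
  define c where "c x = min 1 (max 0 x)" for x :: real
  \<comment> \<open>The quintic step: its derivative \<open>30 * x^2 * (1 - x)^2\<close> has double
    zeros at 0 and 1, so clamping preserves two continuous derivatives.\<close>
  define S where "S x = 6 * c x ^ 5 - 15 * c x ^ 4 + 10 * c x ^ 3" for x
  define S1 where "S1 x = 30 * c x ^ 2 * (1 - c x) ^ 2" for x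
  define S2 where "S2 x = 60 * c x * (1 - c x) * (1 - 2 * c x)" for x
  have S: "DERIV S x :> S1 x" for x
    unfolding S_def S1_def c_def
    by (rule DERIV_clamp[where p = "\<lambda>x. 6 * x ^ 5 - 15 * x ^ 4 + 10 * x ^ 3"])
      (auto intro!: derivative_eq_intros simp: field_simps power2_eq_square power3_eq_cube power4_eq_xxxx)
  have S1: "DERIV S1 x :> S2 x" for x
    unfolding S1_def S2_def c_def
    by (rule DERIV_clamp[where p = "\<lambda>x. 30 * x ^ 2 * (1 - x) ^ 2"])
      (auto intro!: derivative_eq_intros simp: field_simps power2_eq_square power3_eq_cube)
  have cont_S2: "continuous_on UNIV S2"
    unfolding S2_def c_def by (intro continuous_intros)
  have zero: "S x = 0" "S1 x = 0" "S2 x = 0" if "x \<le> 0" for x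
    using that by (auto simp: S_def S1_def S2_def c_def max_def)
  have one: "S x = 1" "S1 x = 0" "S2 x = 0" if "1 \<le> x" for x
    using that by (auto simp: S_def S1_def S2_def c_def max_def min_def)
  have mono: "S x \<le> S y" if "x \<le> y" for x y
    using S that by (intro DERIV_nonneg_imp_nondecreasing[of x y S]) (auto simp: S1_def intro!: exI[of _ "S1 _"])
  have S01: "0 \<le> S x" "S x \<le> 1" for x
    using mono[of 0 x] mono[of x 1] zero(1)[of x] zero(1)[of 0] one(1)[of 1] one(1)[of x]
    by (cases "x \<le> 0"; cases "1 \<le> x"; simp)+
  define u where "u z = (z - a') / (a - a')" for z
  define v where "v z = (b' - z) / (b' - b)" for z
  define \<phi> where "\<phi> z = S (u z) * S (v z)" for z
  define \<phi>1 where "\<phi>1 z = S1 (u z) / (a - a') * S (v z) - S (u z) * S1 (v z) / (b' - b)" for z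
  define \<phi>2 where "\<phi>2 z = S2 (u z) / (a - a') / (a - a') * S (v z)
     - 2 * (S1 (u z) / (a - a') * S1 (v z) / (b' - b)) + S (u z) * S2 (v z) / (b' - b) / (b' - b)" for z
  have du: "DERIV u z :> 1 / (a - a')" and dv: "DERIV v z :> - 1 / (b' - b)" for z
    unfolding u_def v_def using assms by (auto intro!: derivative_eq_intros simp: divide_simps)
  have dSu: "DERIV (\<lambda>z. S (u z)) z :> S1 (u z) / (a - a')"
    "DERIV (\<lambda>z. S1 (u z)) z :> S2 (u z) / (a - a')"
    "DERIV (\<lambda>z. S (v z)) z :> - S1 (v z) / (b' - b)"
    "DERIV (\<lambda>z. S1 (v z)) z :> - S2 (v z) / (b' - b)" for z
    using DERIV_chain2[OF S du] DERIV_chain2[OF S1 du] DERIV_chain2[OF S dv] DERIV_chain2[OF S1 dv]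
    by simp_all
  have "DERIV \<phi> z :> \<phi>1 z" for z
    unfolding \<phi>_def \<phi>1_def by (rule DERIV_cong, rule DERIV_mult[OF dSu(1) dSu(3)]) simp
  moreover have "DERIV \<phi>1 z :> \<phi>2 z" for z
    unfolding \<phi>1_def \<phi>2_def
    by (rule DERIV_cong, rule DERIV_diff[OF DERIV_mult[OF DERIV_cdivide[OF dSu(2)] dSu(3)]
          DERIV_cdivide[OF DERIV_mult[OF dSu(1) dSu(4)]]])
      (simp add: divide_inverse algebra_simps)
  moreover have "continuous_on UNIV \<phi>2"
  proof -
    have uv: "continuous_on UNIV u" "continuous_on UNIV v"
      by (rule has_field_derivative_continuous_on[OF du] has_field_derivative_continuous_on[OF dv])+
    have S': "continuous_on UNIV S" "continuous_on UNIV S1"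
      by (rule has_field_derivative_continuous_on[OF S] has_field_derivative_continuous_on[OF S1])+
    note [continuous_intros] = continuous_on_compose2[OF S'(1) uv(1) subset_UNIV]
      continuous_on_compose2[OF S'(1) uv(2) subset_UNIV] continuous_on_compose2[OF S'(2) uv(1) subset_UNIV]
      continuous_on_compose2[OF S'(2) uv(2) subset_UNIV] continuous_on_compose2[OF cont_S2 uv(1) subset_UNIV]
      continuous_on_compose2[OF cont_S2 uv(2) subset_UNIV]
    show ?thesis
      unfolding \<phi>2_def by (intro continuous_intros) (use assms in auto)
  qed
  moreover have "\<phi> z = 0 \<and> \<phi>1 z = 0 \<and> \<phi>2 z = 0" if "z \<notin> {a'<..<b'}" for z
  proof -
    have "u z \<le> 0 \<or> v z \<le> 0"
      using that assms by (auto simp: u_def v_def divide_le_0_iff)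
    then show ?thesis
      using zero by (auto simp: \<phi>_def \<phi>1_def \<phi>2_def)
  qed
  moreover have "\<phi> z = 1 \<and> \<phi>1 z = 0 \<and> \<phi>2 z = 0" if "z \<in> {a..b}" for z
  proof -
    have "1 \<le> u z" "1 \<le> v z"
      using that assms by (auto simp: u_def v_def divide_simps)
    then show ?thesis
      using one by (auto simp: \<phi>_def \<phi>1_def \<phi>2_def)
  qed
  moreover have "0 \<le> \<phi> z" "\<phi> z \<le> 1" for z
    using S01 by (auto simp: \<phi>_def intro: mult_le_one)
  ultimately show ?thesis
    using that[of \<phi> \<phi>1 \<phi>2] unfolding C2_supp_def by blast
qed

text \<open>The factor \<open>k\<close> only has to be smooth near the support: off \<open>U\<close>
  the product is locally zero. In this way functions smooth on part of the line, such as
  \<open>q t x\<close> on \<open>J\<close> or \<open>H t\<close> on one side of the boundary, give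
  rise to test functions.\<close>

lemma C2_supp_mult:
  assumes \<phi>: "C2_supp a b \<phi> \<phi>1 \<phi>2" and U: "open U" "{a..b} \<subseteq> U"
    and k: "\<And>z. z \<in> U \<Longrightarrow> DERIV k z :> k1 z" "\<And>z. z \<in> U \<Longrightarrow> DERIV k1 z :> k2 z" "continuous_on U k2"
  shows "C2_supp a b (\<lambda>z. k z * \<phi> z) (\<lambda>z. k1 z * \<phi> z + k z * \<phi>1 z)
    (\<lambda>z. k2 z * \<phi> z + 2 * (k1 z * \<phi>1 z) + k z * \<phi>2 z)"
proof -
  have d: "DERIV \<phi> z :> \<phi>1 z" "DERIV \<phi>1 z :> \<phi>2 z" for z
    using \<phi> by (auto simp: C2_supp_def)
  have cont: "continuous_on X \<phi>" "continuous_on X \<phi>1" "continuous_on X \<phi>2" for X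
    using \<phi> by (auto simp: C2_supp_def intro: continuous_on_subset
        intro!: has_field_derivative_continuous_on[OF d(1)] has_field_derivative_continuous_on[OF d(2)])
  have cont_k: "continuous_on U k" "continuous_on U k1"
    by (intro has_field_derivative_continuous_on[OF k(1)] has_field_derivative_continuous_on[OF k(2)]; assumption)+
  have vanish: "\<phi> z = 0" "\<phi>1 z = 0" "\<phi>2 z = 0" if "z \<notin> {a<..<b}" for z
    using \<phi> that by (auto simp: C2_supp_def)
  have off: "eventually (\<lambda>z. z \<in> - {a..b}) (nhds z)" if "z \<notin> U" for z
    using that U by (intro eventually_nhds_in_open) auto
  have off': "(g has_real_derivative 0) (at z)"
    if "z \<notin> U" "\<And>z. z \<notin> {a<..<b} \<Longrightarrow> g z = 0" for g :: "real \<Rightarrow> real" and z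
  proof -
    have "eventually (\<lambda>z. 0 = g z) (nhds z)"
      using off[OF that(1)] by eventually_elim (use that(2) in auto)
    then show ?thesis
      by (rule DERIV_transform_nhds[OF DERIV_const])
  qed
  have U': "z \<notin> U \<Longrightarrow> z \<notin> {a<..<b}" for z
    using subsetD[OF U(2), of z] by auto
  have "DERIV (\<lambda>z. k z * \<phi> z) z :> k1 z * \<phi> z + k z * \<phi>1 z" for z
  proof (cases "z \<in> U")
    case True
    show ?thesis
      by (rule DERIV_cong, rule DERIV_mult[OF k(1)[OF True] d(1)]) simp
  next
    case False
    then show ?thesis using off'[OF False, of "\<lambda>z. k z * \<phi> z"] vanish U' by simp
  qed
  moreover have "DERIV (\<lambda>z. k1 z * \<phi> z + k z * \<phi>1 z) z :> k2 z * \<phi> z + 2 * (k1 z * \<phi>1 z) + k z * \<phi>2 z" for z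
  proof (cases "z \<in> U")
    case True
    show ?thesis
      by (rule DERIV_cong, rule DERIV_add[OF DERIV_mult[OF k(2)[OF True] d(1)] DERIV_mult[OF k(1)[OF True] d(2)]]) simp
  next
    case False
    then show ?thesis using off'[OF False, of "\<lambda>z. k1 z * \<phi> z + k z * \<phi>1 z"] vanish U' by simp
  qed
  moreover have "continuous_on (U \<union> - {a..b}) (\<lambda>z. k2 z * \<phi> z + 2 * (k1 z * \<phi>1 z) + k z * \<phi>2 z)"
  proof (rule continuous_on_open_Un)
    show "continuous_on U (\<lambda>z. k2 z * \<phi> z + 2 * (k1 z * \<phi>1 z) + k z * \<phi>2 z)"
      by (intro continuous_intros k cont cont_k)
    show "continuous_on (- {a..b}) (\<lambda>z. k2 z * \<phi> z + 2 * (k1 z * \<phi>1 z) + k z * \<phi>2 z)"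
      using vanish by (auto intro!: continuous_on_eq[OF continuous_on_const[of _ 0]])
  qed (use U in auto)
  moreover have "U \<union> - {a..b} = UNIV"
    using U by auto
  ultimately show ?thesis
    using vanish by (auto simp: C2_supp_def)
qed

lemma continuous_test: "C2_supp a b \<psi> \<psi>1 \<psi>2 \<Longrightarrow> continuous_on A \<psi>"
  by (auto simp: C2_supp_def intro: has_field_derivative_continuous_on)

lemma bounded_test:
  assumes "C2_supp a b \<psi> \<psi>1 \<psi>2"
  obtains C where "0 \<le> C" "\<And>z. \<bar>\<psi> z\<bar> \<le> C"
proof (rule bounded_if_compact_support[OF continuous_test[OF assms]])
  show "\<psi> z = 0" if "z \<notin> {a..b}" for z
    using assms that unfolding C2_supp_def by (meson greaterThanLessThan_subseteq_atLeastAtMost_iff order_refl subsetD)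
qed (rule that)

lemma isCont_test: "C2_supp a b \<psi> \<psi>1 \<psi>2 \<Longrightarrow> isCont \<psi> y"
  using continuous_test[of a b \<psi> \<psi>1 \<psi>2 UNIV] by (simp add: continuous_on_eq_continuous_at)

section \<open>Transition density and generator\<close>

context linear_diffusion
begin

text \<open>The interior of the state space; \<open>I\<close> differs from it at most by the end
  point \<open>l\<close>, a Lebesgue null set.\<close>

definition J :: "real set" where "J = {x. l < ereal x}"

text \<open>The operator \<open>d/dm d/ds\<close> with the outer derivative carried out. It acts on
  the values of the first and second derivative at \<open>z\<close>, so it can be applied to
  \<open>hy\<close> and \<open>hyy\<close> or to the parameters of \<open>C2_supp\<close>
  directly.\<close>

definition gen :: "real \<Rightarrow> real \<Rightarrow> real \<Rightarrow> real" where
  "gen z p1 p2 = (p2 / deriv s z - p1 * deriv (deriv s) z / (deriv s z)\<^sup>2) / \<rho> z"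

text \<open>The density of \<open>X t\<close> with respect to Lebesgue measure instead of the speed
  measure; dropping the point \<open>l\<close> changes no integral.\<close>

definition pdens :: "real \<Rightarrow> real \<Rightarrow> real \<Rightarrow> real" where
  "pdens t x y = indicator J y * (q t x y * \<rho> y)"

lemma open_J: "open J"
  unfolding J_def by (intro open_Collect_less continuous_intros)

lemma J_subset_I: "J \<subseteq> I"
  using state_space by (auto simp: J_def less_imp_le)

lemma JI: "x \<in> J \<Longrightarrow> x \<in> I"
  using J_subset_I by auto

lemma J_upward: "a \<in> J \<Longrightarrow> a \<le> b \<Longrightarrow> b \<in> J"
  by (auto simp: J_def intro: less_le_trans)

lemma J_Icc: "a \<in> J \<Longrightarrow> {a..b} \<subseteq> J"
  by (auto intro: J_upward)

lemma ball_J: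
  assumes "x \<in> J"
  obtains e where "0 < e" "x - e \<in> J"
proof -
  obtain e where e: "0 < e" "ball x e \<subseteq> J"
    using open_J assms by (meson open_contains_ball)
  then have "x - e / 2 \<in> J"
    by (auto simp: subset_eq dist_real_def)
  with e show ?thesis by (intro that[of "e / 2"]) auto
qed

lemma I_minus_J: "x \<in> I \<Longrightarrow> x \<notin> J \<Longrightarrow> ereal x = l"
  using state_space by (auto simp: J_def)

lemma sets_J [measurable]: "J \<in> sets borel"
  using open_J by simp

lemma sets_I [measurable]: "I \<in> sets borel"
proof -
  have "I = J \<or> I = J \<union> ((\<lambda>x. ereal x) -` {l} \<inter> space borel)"
    using state_space by (auto simp: J_def)
  moreover have "(\<lambda>x. ereal x) -` {l} \<inter> space borel \<in> sets borel"
    by (intro measurable_sets[of _ borel borel]) auto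
  ultimately show ?thesis by auto
qed

lemma AE_I_J: "AE y in lborel. y \<in> I \<longrightarrow> y \<in> J"
  using AE_lborel_singleton[of "real_of_ereal l"]
proof eventually_elim
  case (elim y)
  then show ?case
    using I_minus_J[of y] by (metis real_of_ereal.simps(1))
qed

lemma space_P: "x \<in> I \<Longrightarrow> space (P x) = space M"
  using sets_P by (rule sets_eq_imp_space_eq)

lemma X_measurable_P: "x \<in> I \<Longrightarrow> 0 \<le> t \<Longrightarrow> X t \<in> borel_measurable (P x)"
  using X_measurable measurable_cong_sets[OF sets_P refl] by blast

lemma scale_derivs:
  assumes "z \<in> J"
  shows "DERIV (deriv s) z :> deriv (deriv s) z" "0 < deriv s z"
proof -
  obtain D where "(deriv s has_vector_derivative D z) (at z)"
    using scale_C2(2) assms by (auto simp: C1_differentiable_on_def J_def)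
  then show "DERIV (deriv s) z :> deriv (deriv s) z"
    by (metis has_real_derivative_iff_has_vector_derivative DERIV_imp_deriv)
  show "0 < deriv s z"
    using scale_deriv_pos assms by (auto simp: J_def)
qed

lemma continuous_scale_derivs:
  "continuous_on J (deriv s)" "continuous_on J (deriv (deriv s))"
proof -
  show "continuous_on J (deriv s)"
    by (rule has_field_derivative_continuous_on[OF scale_derivs(1)])
  obtain D where D: "\<And>z. z \<in> J \<Longrightarrow> (deriv s has_vector_derivative D z) (at z)" "continuous_on J D"
    using scale_C2(2) by (auto simp: C1_differentiable_on_def J_def)
  then have "\<And>z. z \<in> J \<Longrightarrow> deriv (deriv s) z = D z"
    by (metis has_real_derivative_iff_has_vector_derivative DERIV_imp_deriv)
  then show "continuous_on J (deriv (deriv s))"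
    using D(2) by (simp cong: continuous_on_cong)
qed

lemma rho_pos: "z \<in> J \<Longrightarrow> 0 < \<rho> z"
  using speed_pos by (auto simp: J_def)

text \<open>Divergence form of the generator: the factor \<open>\<rho> z\<close> cancels the one in
  \<open>gen\<close>, leaving the quotient rule. This is what makes Green's identity exact with
  weight \<open>\<rho>\<close>.\<close>

lemma flux_deriv:
  assumes z: "z \<in> J" and k: "DERIV k1 z :> k2"
  shows "DERIV (\<lambda>w. k1 w / deriv s w) z :> \<rho> z * gen z (k1 z) k2"
proof -
  have "DERIV (\<lambda>w. k1 w / deriv s w) z :> (k2 * deriv s z - k1 z * deriv (deriv s) z) / (deriv s z * deriv s z)"
    using scale_derivs[OF z] by (intro DERIV_divide k) auto
  then show ?thesis
    by (rule DERIV_cong) (use scale_derivs(2)[OF z] rho_pos[OF z] in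
        \<open>simp add: gen_def field_simps power2_eq_square\<close>)
qed

section \<open>Regularity of the transition density and one-dimensional laws\<close>

lemma q_regular:
  obtains qt qx qxx where
    "continuous_on ({0<..} \<times> I \<times> I) (\<lambda>(t, x, y). qt t x y)"
    "continuous_on ({0<..} \<times> I \<times> I) (\<lambda>(t, x, y). qx t x y)"
    "continuous_on ({0<..} \<times> I \<times> I) (\<lambda>(t, x, y). qxx t x y)"
    "\<And>t x y. 0 < t \<Longrightarrow> x \<in> J \<Longrightarrow> y \<in> J \<Longrightarrow> DERIV (\<lambda>r. q r x y) t :> qt t x y"
    "\<And>t x y. 0 < t \<Longrightarrow> x \<in> J \<Longrightarrow> y \<in> J \<Longrightarrow> DERIV (\<lambda>z. q t z y) x :> qx t x y"
    "\<And>t x y. 0 < t \<Longrightarrow> x \<in> J \<Longrightarrow> y \<in> J \<Longrightarrow> DERIV (\<lambda>z. qx t z y) x :> qxx t x y"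
proof -
  have int: "(t, x, y) \<in> interior ({0<..} \<times> I \<times> I)" if "0 < t" "x \<in> J" "y \<in> J" for t x y :: real
    by (rule interiorI[where T = "{0<..} \<times> J \<times> J"], intro open_Times open_greaterThan open_J)
      (use that JI in auto)
  obtain qt qx qxx qy qyy where
    c: "continuous_on ({0<..} \<times> I \<times> I) (\<lambda>(t, x, y). qt t x y)"
    "continuous_on ({0<..} \<times> I \<times> I) (\<lambda>(t, x, y). qx t x y)"
    "continuous_on ({0<..} \<times> I \<times> I) (\<lambda>(t, x, y). qxx t x y)"
    and d: "\<forall>(t, x, y) \<in> interior ({0<..} \<times> I \<times> I).
           ((\<lambda>r. q r x y) has_real_derivative qt t x y) (at t) \<and>
           ((\<lambda>z. q t z y) has_real_derivative qx t x y) (at x) \<and>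
           ((\<lambda>z. qx t z y) has_real_derivative qxx t x y) (at x) \<and>
           ((\<lambda>z. q t x z) has_real_derivative qy t x y) (at y) \<and>
           ((\<lambda>z. qy t x z) has_real_derivative qyy t x y) (at y)"
    using density_C122 unfolding C122_on_def by blast
  show ?thesis
    by (rule that[OF c]; use bspec[OF d int] in fast)
qed

lemma continuous_q: "continuous_on ({0<..} \<times> I \<times> I) (\<lambda>(t, x, y). q t x y)"
  using density_C122 by (simp add: C122_on_def)

lemma continuous_on_q:
  fixes f :: "'b::topological_space \<Rightarrow> real"
  assumes "continuous_on A f" "continuous_on A g" "continuous_on A h"
    and "\<And>a. a \<in> A \<Longrightarrow> 0 < f a" "\<And>a. a \<in> A \<Longrightarrow> g a \<in> I" "\<And>a. a \<in> A \<Longrightarrow> h a \<in> I"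
  shows "continuous_on A (\<lambda>a. q (f a) (g a) (h a))"
  using continuous_on_compose2[OF continuous_q continuous_on_Pair[OF assms(1) continuous_on_Pair[OF assms(2,3)]]] assms(4-6)
  by (auto simp: image_subset_iff)

lemma borel_measurable_q_section:
  assumes "0 < t" "x \<in> I"
  shows "(\<lambda>y. indicator I y * q t x y) \<in> borel_measurable borel"
proof -
  have "continuous_on I (q t x)"
    by (rule continuous_on_q) (use assms in auto)
  then show ?thesis
    using borel_measurable_continuous_on_indicator[OF sets_I, of "q t x"] by simp
qed

lemma pdens_nonneg: "0 < t \<Longrightarrow> x \<in> I \<Longrightarrow> 0 \<le> pdens t x y"
  using density_nonneg[of t x y] rho_pos[of y] JI[of y]
  by (auto simp: pdens_def indicator_def less_imp_le)

lemma borel_measurable_pdens: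
  assumes "0 < t" "x \<in> I"
  shows "pdens t x \<in> borel_measurable borel"
proof -
  have "pdens t x = (\<lambda>y. indicator J y * ((indicator I y * q t x y) * \<rho> y))"
    by (auto simp: pdens_def indicator_def JI)
  then show ?thesis
    using borel_measurable_q_section[OF assms] speed_measurable by simp
qed

lemma distr_X:
  assumes t: "0 < t" and x: "x \<in> I"
  shows "distr (P x) borel (X t) = density lborel (\<lambda>y. ennreal (pdens t x y))"
proof (rule measure_eqI)
  fix A assume "A \<in> sets (distr (P x) borel (X t))"
  then have A [measurable]: "A \<in> sets borel" by simp
  note [measurable] = borel_measurable_q_section[OF t x] borel_measurable_pdens[OF t x] speed_measurable
  have eq: "(\<lambda>y. ennreal (q t x y) * indicator (A \<inter> I) y) = (\<lambda>y. ennreal (indicator I y * q t x y) * indicator A y)"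
    by (auto simp: indicator_def)
  have "emeasure (distr (P x) borel (X t)) A = emeasure (P x) {\<omega> \<in> space M. X t \<omega> \<in> A}"
    using X_measurable_P[OF x, of t] t by (subst emeasure_distr) (auto simp: space_P[OF x] Int_def vimage_def conj_commute)
  also have "\<dots> = (\<integral>\<^sup>+y\<in>A \<inter> I. ennreal (q t x y) \<partial>speed_measure I \<rho>)"
    by (rule density[OF t x A])
  also have "\<dots> = (\<integral>\<^sup>+y. ennreal (\<rho> y) * indicator I y * (ennreal (indicator I y * q t x y) * indicator A y) \<partial>lborel)"
    unfolding speed_measure_def eq by (subst nn_integral_density) auto
  also have "\<dots> = (\<integral>\<^sup>+y. ennreal (pdens t x y) * indicator A y \<partial>lborel)"
  proof (rule nn_integral_cong_AE)
    show "AE y in lborel. ennreal (\<rho> y) * indicator I y * (ennreal (indicator I y * q t x y) * indicator A y)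
        = ennreal (pdens t x y) * indicator A y"
      using AE_I_J
    proof eventually_elim
      case (elim y)
      show ?case
      proof (cases "y \<in> I")
        case True
        then have "y \<in> J" using elim by simp
        then show ?thesis
          using True density_nonneg[OF t x True] rho_pos[of y]
          by (simp add: pdens_def ennreal_mult mult_ac less_imp_le indicator_def)
      next
        case False
        then have "y \<notin> J" using JI by blast
        with False show ?thesis by (simp add: pdens_def)
      qed
    qed
  qed
  also have "\<dots> = emeasure (density lborel (\<lambda>y. ennreal (pdens t x y))) A"
    by (subst emeasure_density) auto
  finally show "emeasure (distr (P x) borel (X t)) A = emeasure (density lborel (\<lambda>y. ennreal (pdens t x y))) A" .
qed simp

lemma expectation_X:
  assumes t: "0 < t" and x: "x \<in> I" and \<phi>: "\<phi> \<in> borel_measurable borel"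
  shows "(LINT \<omega>|P x. \<phi> (X t \<omega>)) = (LINT y|lborel. pdens t x y * \<phi> y)"
    and "integrable (P x) (\<lambda>\<omega>. \<phi> (X t \<omega>)) \<longleftrightarrow> integrable lborel (\<lambda>y. pdens t x y * \<phi> y)"
proof -
  note m = X_measurable_P[OF x less_imp_le[OF t]]
  have nn: "AE y in lborel. 0 \<le> pdens t x y"
    using pdens_nonneg[OF t x] by simp
  have pm: "pdens t x \<in> borel_measurable lborel" "\<phi> \<in> borel_measurable lborel"
    using borel_measurable_pdens[OF t x] \<phi> by simp_all
  show "(LINT \<omega>|P x. \<phi> (X t \<omega>)) = (LINT y|lborel. pdens t x y * \<phi> y)"
    using integral_distr[OF m \<phi>] integral_density[OF pm(2) pm(1) nn] by (simp add: distr_X[OF t x])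
  show "integrable (P x) (\<lambda>\<omega>. \<phi> (X t \<omega>)) \<longleftrightarrow> integrable lborel (\<lambda>y. pdens t x y * \<phi> y)"
    using integrable_distr_eq[OF m \<phi>] integrable_density[OF pm(2) pm(1) nn] by (simp add: distr_X[OF t x])
qed

lemma AE_X_in_J:
  assumes t: "0 < t" and x: "x \<in> I"
  shows "AE \<omega> in P x. X t \<omega> \<in> J"
proof -
  have "AE y in density lborel (\<lambda>y. ennreal (pdens t x y)). y \<in> J"
    using borel_measurable_pdens[OF t x] by (subst AE_density) (simp, auto simp: pdens_def indicator_def)
  then have "AE y in distr (P x) borel (X t). y \<in> J"
    unfolding distr_X[OF t x] .
  then show ?thesis
    using X_measurable_P[OF x, of t] t by (subst (asm) AE_distr_iff) auto
qed

section \<open>Short-time limits and continuity of the speed density\<close>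

lemma X_tendsto_start:
  assumes "\<omega> \<in> space M"
  shows "((\<lambda>h. X h \<omega>) \<longlongrightarrow> X 0 \<omega>) (at_right 0)"
proof -
  have "((\<lambda>h. X h \<omega>) \<longlongrightarrow> X 0 \<omega>) (at 0 within {0..})"
    using X_continuous[OF assms] by (auto simp: continuous_on_def)
  then show ?thesis
    by (rule tendsto_within_subset) auto
qed

lemma AE_X_tendsto:
  assumes "y \<in> I"
  shows "AE \<omega> in P y. ((\<lambda>h. X h \<omega>) \<longlongrightarrow> y) (at_right 0)"
  using start[OF assms] AE_space
  by eventually_elim (use X_tendsto_start space_P[OF assms] in auto)

lemma expectation_tendsto_start:
  assumes y: "y \<in> I" and \<phi>: "\<phi> \<in> borel_measurable borel" "\<And>z. \<bar>\<phi> z\<bar> \<le> (C::real)" "isCont \<phi> y"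
  shows "((\<lambda>h. LINT \<omega>|P y. \<phi> (X h \<omega>)) \<longlongrightarrow> \<phi> y) (at_right 0)"
proof -
  interpret prob_space "P y" by (rule prob[OF y])
  have "((\<lambda>h. LINT \<omega>|P y. \<phi> (X h \<omega>)) \<longlongrightarrow> (LINT \<omega>|P y. \<phi> y)) (at_right 0)"
  proof (rule integral_dominated_convergence_at_right[of 1 _ _ _ "\<lambda>_. C"])
    show "AE \<omega> in P y. ((\<lambda>h. \<phi> (X h \<omega>)) \<longlongrightarrow> \<phi> y) (at_right 0)"
      using AE_X_tendsto[OF y] by eventually_elim (rule isCont_tendsto_compose[OF \<phi>(3)])
    show "(\<lambda>\<omega>. \<phi> (X h \<omega>)) \<in> borel_measurable (P y)" if "0 < h" for h
      using X_measurable_P[OF y, of h] that \<phi>(1) by simp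
  qed (use \<phi> in auto)
  then show ?thesis by (simp add: prob_space)
qed

text \<open>Turns the hypothesis on \<open>generator\<close>, phrased with \<open>deriv\<close>,
  into an identity for given derivatives. The first derivative must be known around
  \<open>z\<close>, because the flux is differentiated once more.\<close>

lemma kolmogorov_gen:
  assumes t: "0 < t" and z: "z \<in> J" and y: "y \<in> J"
    and qt: "DERIV (\<lambda>r. q r z y) t :> D"
    and qx: "\<And>w. w \<in> J \<Longrightarrow> DERIV (\<lambda>w. q t w y) w :> qx w"
    and qxx: "DERIV qx z :> qxx"
  shows "D = gen z (qx z) qxx"
proof -
  have "eventually (\<lambda>w. w \<in> J) (nhds z)"
    using open_J z by (rule eventually_nhds_in_open)
  then have "eventually (\<lambda>w. qx w / deriv s w = 1 / deriv s w * deriv (\<lambda>z. q t z y) w) (nhds z)"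
    by eventually_elim (use DERIV_imp_deriv[OF qx] in simp)
  then have "DERIV (\<lambda>w. 1 / deriv s w * deriv (\<lambda>z. q t z y) w) z :> \<rho> z * gen z (qx z) qxx"
    by (rule DERIV_transform_nhds[OF flux_deriv[OF z qxx]])
  then have "generator s \<rho> (\<lambda>z. q t z y) z = gen z (qx z) qxx"
    unfolding generator_def by (subst DERIV_imp_deriv) (use rho_pos[OF z] in auto)
  then show ?thesis
    using kolmogorov[OF t _ JI[OF y], of z] z DERIV_imp_deriv[OF qt] by (simp add: J_def)
qed

text \<open>Otherwise the law of \<open>X t\<close> under \<open>P x\<close> would be the same for
  all \<open>t > 0\<close>. Letting \<open>t\<close> tend to 0, it would be the point mass at
  \<open>x\<close>, against absolute continuity. A nonzero time derivative is wanted in order to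
  divide by it in the Kolmogorov equation.\<close>

lemma q_not_stationary:
  assumes x: "x \<in> J"
  shows "\<exists>t y D. 0 < t \<and> y \<in> J \<and> DERIV (\<lambda>r. q r x y) t :> D \<and> D \<noteq> 0"
proof (rule ccontr)
  assume neg: "\<not> ?thesis"
  have xI: "x \<in> I" using x by (rule JI)
  interpret prob_space "P x" by (rule prob[OF xI])
  obtain qt where qt': "\<And>t x y. 0 < t \<Longrightarrow> x \<in> J \<Longrightarrow> y \<in> J \<Longrightarrow> DERIV (\<lambda>r. q r x y) t :> qt t x y"
    by (rule q_regular) (rule that)
  note qt = qt'[OF _ x]
  have const: "q t x y = q 1 x y" if "0 < t" "y \<in> J" for t y
  proof -
    have "(\<lambda>r. q r x y) constant_on {0<..}"
    proof (rule has_field_derivative_0_imp_constant_on)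
      show "DERIV (\<lambda>r. q r x y) r :> 0" if "r \<in> {0<..}" for r
      proof (rule ccontr)
        assume "\<not> ?thesis"
        then have "qt r x y \<noteq> 0"
          using qt[of r y] that \<open>y \<in> J\<close> by auto
        with neg qt[of r y] that \<open>y \<in> J\<close> show False
          by (metis greaterThan_iff)
      qed
    qed (simp_all add: connected_Ioi)
    then obtain c where "\<forall>r\<in>{0<..}. q r x y = c"
      unfolding constant_on_def by blast
    then show ?thesis
      using \<open>0 < t\<close> by simp
  qed
  have p: "pdens t x = pdens 1 x" if "0 < t" for t
    using const[OF that] unfolding pdens_def indicator_def by fastforce
  \<comment> \<open>A bounded continuous function whose only zero is \<open>x\<close>; its
    expectation at time 1 tests whether \<open>X 1\<close> sits at \<open>x\<close>.\<close>
  define \<phi> where "\<phi> y = min 1 \<bar>y - x\<bar>" for y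
  have \<phi>: "\<phi> \<in> borel_measurable borel" "\<And>z. \<bar>\<phi> z\<bar> \<le> 1" "isCont \<phi> x" "\<phi> x = 0"
    by (auto simp: \<phi>_def[abs_def] intro!: continuous_intros)
  have "((\<lambda>h. LINT \<omega>|P x. \<phi> (X h \<omega>)) \<longlongrightarrow> 0) (at_right 0)"
    using expectation_tendsto_start[OF xI \<phi>(1-3)] \<phi>(4) by simp
  moreover have "eventually (\<lambda>h. (LINT \<omega>|P x. \<phi> (X h \<omega>)) = (LINT \<omega>|P x. \<phi> (X 1 \<omega>))) (at_right 0)"
    using eventually_at_right_0_real[OF zero_less_one]
  proof eventually_elim
    case (elim h)
    then show ?case
      using p[of h] by (simp add: expectation_X(1)[OF _ xI \<phi>(1)])
  qed
  ultimately have "((\<lambda>h::real. LINT \<omega>|P x. \<phi> (X 1 \<omega>)) \<longlongrightarrow> 0) (at_right 0)"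
    by (rule Lim_transform_eventually)
  then have "(LINT \<omega>|P x. \<phi> (X 1 \<omega>)) = 0"
    by (simp add: tendsto_const_iff)
  moreover have "integrable (P x) (\<lambda>\<omega>. \<phi> (X 1 \<omega>))"
    using \<phi> X_measurable_P[OF xI, of 1] by (intro integrable_const_bound[where B = 1]) auto
  ultimately have "AE \<omega> in P x. \<phi> (X 1 \<omega>) = 0"
    by (subst (asm) integral_nonneg_eq_0_iff_AE) (auto simp: \<phi>_def)
  then have "AE \<omega> in P x. X 1 \<omega> = x"
    by eventually_elim (auto simp: \<phi>_def min_def split: if_splits)
  moreover have "AE y in density lborel (\<lambda>y. ennreal (pdens 1 x y)). y \<noteq> x"
    using borel_measurable_pdens[OF _ xI, of 1] AE_lborel_singleton[of x] by (subst AE_density) auto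
  then have "AE y in distr (P x) borel (X 1). y \<noteq> x"
    by (subst distr_X[OF zero_less_one xI])
  then have "AE \<omega> in P x. X 1 \<omega> \<noteq> x"
    using X_measurable_P[OF xI, of 1] by (subst (asm) AE_distr_iff) auto
  ultimately have "AE \<omega> in P x. False"
    by eventually_elim auto
  then show False by simp
qed

text \<open>Near a point where the time derivative of \<open>q\<close> is nonzero, the Kolmogorov
  equation expresses \<open>\<rho>\<close> as a quotient of continuous functions.\<close>

lemma continuous_rho: "continuous_on J \<rho>"
  unfolding continuous_on_eq_continuous_at[OF open_J]
proof
  fix x assume x: "x \<in> J"
  obtain qt qx qxx where
    c: "continuous_on ({0<..} \<times> I \<times> I) (\<lambda>(t, x, y). qt t x y)"
    "continuous_on ({0<..} \<times> I \<times> I) (\<lambda>(t, x, y). qx t x y)"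
    "continuous_on ({0<..} \<times> I \<times> I) (\<lambda>(t, x, y). qxx t x y)"
    and d: "\<And>t x y. 0 < t \<Longrightarrow> x \<in> J \<Longrightarrow> y \<in> J \<Longrightarrow> DERIV (\<lambda>r. q r x y) t :> qt t x y"
    "\<And>t x y. 0 < t \<Longrightarrow> x \<in> J \<Longrightarrow> y \<in> J \<Longrightarrow> DERIV (\<lambda>z. q t z y) x :> qx t x y"
    "\<And>t x y. 0 < t \<Longrightarrow> x \<in> J \<Longrightarrow> y \<in> J \<Longrightarrow> DERIV (\<lambda>z. qx t z y) x :> qxx t x y"
    by (rule q_regular) (rule that)
  obtain t y where ty: "0 < t" "y \<in> J" "qt t x y \<noteq> 0"
    using q_not_stationary[OF x] d(1)[OF _ x] DERIV_unique by metis
  have sec: "continuous_on J (\<lambda>z. F t z y)"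
    if "continuous_on ({0<..} \<times> I \<times> I) (\<lambda>(t, x, y). F t x y)" for F :: "real \<Rightarrow> real \<Rightarrow> real \<Rightarrow> real"
    using continuous_on_compose2[OF that continuous_on_Pair[OF continuous_on_const[of J t]
        continuous_on_Pair[OF continuous_on_id continuous_on_const[of J y]]]] ty JI by auto
  have at: "isCont F x" if "continuous_on J F" for F :: "real \<Rightarrow> real"
    using that x by (simp add: continuous_on_eq_continuous_at[OF open_J])
  note cont = at[OF sec[OF c(1)]] at[OF sec[OF c(2)]] at[OF sec[OF c(3)]]
    at[OF continuous_scale_derivs(1)] at[OF continuous_scale_derivs(2)]
  have "eventually (\<lambda>z. qt t z y \<noteq> 0) (nhds x)"
    using cont(1) unfolding isCont_def tendsto_at_iff_tendsto_nhds[of "\<lambda>z. qt t z y"]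
    by (rule tendsto_imp_eventually_ne) (rule ty(3))
  moreover have "eventually (\<lambda>z. z \<in> J) (nhds x)"
    using open_J x by (rule eventually_nhds_in_open)
  ultimately have "eventually (\<lambda>z. (qxx t z y / deriv s z - qx t z y * deriv (deriv s) z / (deriv s z)\<^sup>2) / qt t z y = \<rho> z) (nhds x)"
  proof eventually_elim
    case (elim z)
    have "qt t z y = gen z (qx t z y) (qxx t z y)"
      by (rule kolmogorov_gen[OF ty(1) elim(2) ty(2) d(1)[OF ty(1) elim(2) ty(2)] d(2)[OF ty(1) _ ty(2)]
            d(3)[OF ty(1) elim(2) ty(2)]])
    then show ?case
      using elim rho_pos[OF elim(2)] by (auto simp: gen_def)
  qed
  moreover have "isCont (\<lambda>z. (qxx t z y / deriv s z - qx t z y * deriv (deriv s) z / (deriv s z)\<^sup>2) / qt t z y) x"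
    using ty(3) scale_derivs(2)[OF x] by (intro continuous_intros cont) auto
  ultimately show "isCont \<rho> x"
    by (rule isCont_cong[THEN iffD1])
qed

lemma pdens_jointly_measurable:
  assumes h: "0 < h"
  shows "(\<lambda>p. indicator J (fst p) * pdens h (fst p) (snd p)) \<in> borel_measurable (borel \<Otimes>\<^sub>M borel)"
proof -
  have JJ: "J \<times> J \<in> sets borel"
    by (intro borel_open open_Times open_J)
  have "continuous_on (J \<times> J) (\<lambda>p. q h (fst p) (snd p))"
    using h JI by (intro continuous_on_q continuous_intros) auto
  then have "(\<lambda>p. indicator (J \<times> J) p *\<^sub>R q h (fst p) (snd p)) \<in> borel_measurable borel"
    by (rule borel_measurable_continuous_on_indicator[OF JJ])
  then have [measurable]: "(\<lambda>p. indicator (J \<times> J) p * q h (fst p) (snd p)) \<in> borel_measurable (borel \<Otimes>\<^sub>M borel)"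
    by (simp add: borel_prod)
  note [measurable] = speed_measurable
  have eq: "(\<lambda>p. indicator J (fst p) * pdens h (fst p) (snd p)) =
      (\<lambda>p. (indicator (J \<times> J) p * q h (fst p) (snd p)) * \<rho> (snd p))"
    by (auto simp: pdens_def indicator_def fun_eq_iff)
  show ?thesis unfolding eq by measurable
qed

section \<open>The semigroup on test functions\<close>

lemma continuous_gen_test:
  assumes "C2_supp a b \<psi> \<psi>1 \<psi>2" "a \<in> J"
  shows "continuous_on UNIV (\<lambda>z. gen z (\<psi>1 z) (\<psi>2 z))"
proof -
  have d: "\<And>z. DERIV \<psi>1 z :> \<psi>2 z" "continuous_on UNIV \<psi>2"
    using assms by (auto simp: C2_supp_def)
  have c: "continuous_on J \<psi>1" "continuous_on J \<psi>2"
    using has_field_derivative_continuous_on[OF d(1)] continuous_on_subset[OF d(2)] by auto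
  have "continuous_on (J \<union> - {a..b}) (\<lambda>z. gen z (\<psi>1 z) (\<psi>2 z))"
  proof (rule continuous_on_open_Un)
    show "continuous_on J (\<lambda>z. gen z (\<psi>1 z) (\<psi>2 z))"
      unfolding gen_def using scale_derivs(2) rho_pos
      by (intro continuous_intros c continuous_scale_derivs continuous_rho) (metis less_irrefl power_eq_0_iff)+
    show "continuous_on (- {a..b}) (\<lambda>z. gen z (\<psi>1 z) (\<psi>2 z))"
      using assms by (intro continuous_on_eq[OF continuous_on_const[of _ 0]]) (auto simp: C2_supp_def gen_def)
  qed (auto simp: open_J)
  moreover have "J \<union> - {a..b} = UNIV"
    using J_Icc[OF assms(2)] by auto
  ultimately show ?thesis by simp
qed

lemma gen_test_off_support: "C2_supp a b \<psi> \<psi>1 \<psi>2 \<Longrightarrow> z \<notin> {a<..<b} \<Longrightarrow> gen z (\<psi>1 z) (\<psi>2 z) = 0"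
  by (auto simp: C2_supp_def gen_def)

lemma bounded_gen_test:
  assumes "C2_supp a b \<psi> \<psi>1 \<psi>2" "a \<in> J"
  obtains C where "0 \<le> C" "\<And>z. \<bar>gen z (\<psi>1 z) (\<psi>2 z)\<bar> \<le> C"
proof (rule bounded_if_compact_support[OF continuous_gen_test[OF assms]])
  show "gen z (\<psi>1 z) (\<psi>2 z) = 0" if "z \<notin> {a..b}" for z
    by (rule gen_test_off_support[OF assms(1)]) (use that in auto)
qed (rule that)

text \<open>Symmetry puts the integration variable into the first space variable of
  \<open>q\<close>, the one in which the Kolmogorov equation is stated.\<close>

lemma expectation_compact:
  assumes \<phi>: "continuous_on UNIV \<phi>" "\<And>z. z \<notin> {a..b} \<Longrightarrow> \<phi> z = 0"
    and a: "a \<in> J" and y: "y \<in> I" and h: "0 < h"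
  shows "(LINT \<omega>|P y. \<phi> (X h \<omega>)) = integral {a..b} (\<lambda>z. \<phi> z * \<rho> z * q h z y)"
proof -
  have ab: "{a..b} \<subseteq> J" by (rule J_Icc[OF a])
  have cont: "continuous_on {a..b} (\<lambda>z. \<phi> z * \<rho> z * q h z y)"
    using continuous_on_subset[OF \<phi>(1)] continuous_on_subset[OF continuous_rho ab] ab JI h y
    by (intro continuous_intros continuous_on_q) auto
  have "(LINT \<omega>|P y. \<phi> (X h \<omega>)) = (LINT z|lborel. pdens h y z * \<phi> z)"
    by (intro expectation_X h y borel_measurable_continuous_onI \<phi>)
  also have "\<dots> = (LINT z:{a..b}|lborel. \<phi> z * \<rho> z * q h z y)"
    unfolding set_lebesgue_integral_def
  proof (intro Bochner_Integration.integral_cong refl)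
    fix z
    show "pdens h y z * \<phi> z = indicator {a..b} z *\<^sub>R (\<phi> z * \<rho> z * q h z y)"
    proof (cases "z \<in> {a..b}")
      case True
      then have "z \<in> J" using ab by auto
      then show ?thesis
        using True density_symmetric[OF h y JI] by (simp add: pdens_def)
    qed (use \<phi> in simp)
  qed
  also have "\<dots> = integral {a..b} (\<lambda>z. \<phi> z * \<rho> z * q h z y)"
    by (intro set_borel_integral_eq_integral borel_integrable_atLeastAtMost' cont)
  finally show ?thesis .
qed

text \<open>Lagrange's identity: the flux bracket \<open>W\<close> has the integrand as its
  derivative. Derivatives are asked only in the open interval and continuity on the closed one, so
  that the identity applies to \<open>H\<close> up to the boundary, where it may have no two-sided
  derivative.\<close>

lemma green_identity:
  assumes "a \<le> b" and ab: "{a..b} \<subseteq> J"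
    and cont: "continuous_on {a..b} k" "continuous_on {a..b} k1" "continuous_on {a..b} m" "continuous_on {a..b} m1"
    and k: "\<And>z. a < z \<Longrightarrow> z < b \<Longrightarrow> DERIV k z :> k1 z" "\<And>z. a < z \<Longrightarrow> z < b \<Longrightarrow> DERIV k1 z :> k2 z"
    and m: "\<And>z. a < z \<Longrightarrow> z < b \<Longrightarrow> DERIV m z :> m1 z" "\<And>z. a < z \<Longrightarrow> z < b \<Longrightarrow> DERIV m1 z :> m2 z"
  shows "((\<lambda>z. \<rho> z * (k z * gen z (m1 z) (m2 z) - m z * gen z (k1 z) (k2 z))) has_integral
    ((k b * m1 b - m b * k1 b) / deriv s b - (k a * m1 a - m a * k1 a) / deriv s a)) {a..b}"
proof -
  define W where "W z = k z * (m1 z / deriv s z) - m z * (k1 z / deriv s z)" for z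
  have "((\<lambda>z. \<rho> z * (k z * gen z (m1 z) (m2 z) - m z * gen z (k1 z) (k2 z))) has_integral (W b - W a)) {a..b}"
  proof (rule fundamental_theorem_of_calculus_interior[OF \<open>a \<le> b\<close>])
    show "continuous_on {a..b} W"
      unfolding W_def using continuous_on_subset[OF continuous_scale_derivs(1) ab] scale_derivs(2) ab
      by (intro continuous_intros cont) (auto simp: less_imp_neq[symmetric] subset_eq)
  next
    fix z assume z: "z \<in> {a<..<b}"
    then have zJ: "z \<in> J" using ab by auto
    have "DERIV W z :> k1 z * (m1 z / deriv s z) + \<rho> z * gen z (m1 z) (m2 z) * k z -
        (m1 z * (k1 z / deriv s z) + \<rho> z * gen z (k1 z) (k2 z) * m z)"
      unfolding W_def using z
      by (intro DERIV_diff DERIV_mult flux_deriv zJ k m) auto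
    then show "(W has_vector_derivative \<rho> z * (k z * gen z (m1 z) (m2 z) - m z * gen z (k1 z) (k2 z))) (at z)"
      unfolding has_real_derivative_iff_has_vector_derivative[symmetric]
      by (rule DERIV_cong) (simp add: algebra_simps)
  qed
  then show ?thesis
    by (simp add: W_def diff_divide_distrib)
qed

text \<open>Dynkin's formula in differential form. The time derivative falls on \<open>q\<close>,
  the Kolmogorov equation turns it into the generator in \<open>z\<close>, and Green's identity
  shifts the generator to \<open>\<psi>\<close>, whose vanishing at the ends, together with that of
  \<open>\<psi>1\<close>, removes the boundary terms.\<close>

lemma DERIV_expectation_test:
  assumes \<psi>: "C2_supp a b \<psi> \<psi>1 \<psi>2" and a: "a \<in> J" and y: "y \<in> J" and h: "0 < h"
  shows "DERIV (\<lambda>h. LINT \<omega>|P y. \<psi> (X h \<omega>)) h :> (LINT \<omega>|P y. gen (X h \<omega>) (\<psi>1 (X h \<omega>)) (\<psi>2 (X h \<omega>)))"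
proof (cases "a \<le> b")
  case True
  have ab: "{a..b} \<subseteq> J" by (rule J_Icc[OF a])
  have yI: "y \<in> I" by (rule JI[OF y])
  have der: "\<And>z. DERIV \<psi> z :> \<psi>1 z" "\<And>z. DERIV \<psi>1 z :> \<psi>2 z"
    and off: "\<And>z. z \<notin> {a<..<b} \<Longrightarrow> \<psi> z = 0 \<and> \<psi>1 z = 0"
    using \<psi> by (auto simp: C2_supp_def)
  obtain qt qx qxx where
    c: "continuous_on ({0<..} \<times> I \<times> I) (\<lambda>(t, x, y). qt t x y)"
    "continuous_on ({0<..} \<times> I \<times> I) (\<lambda>(t, x, y). qx t x y)"
    "continuous_on ({0<..} \<times> I \<times> I) (\<lambda>(t, x, y). qxx t x y)"
    and d: "\<And>t x y. 0 < t \<Longrightarrow> x \<in> J \<Longrightarrow> y \<in> J \<Longrightarrow> DERIV (\<lambda>r. q r x y) t :> qt t x y"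
    "\<And>t x y. 0 < t \<Longrightarrow> x \<in> J \<Longrightarrow> y \<in> J \<Longrightarrow> DERIV (\<lambda>z. q t z y) x :> qx t x y"
    "\<And>t x y. 0 < t \<Longrightarrow> x \<in> J \<Longrightarrow> y \<in> J \<Longrightarrow> DERIV (\<lambda>z. qx t z y) x :> qxx t x y"
    by (rule q_regular) (rule that)
  have rho: "continuous_on {a..b} \<rho>"
    by (rule continuous_on_subset[OF continuous_rho ab])
  have psi: "continuous_on {a..b} \<psi>" "continuous_on {a..b} \<psi>1"
    using der by (auto intro: has_field_derivative_continuous_on)
  have cq: "continuous_on {a..b} (\<lambda>z. q r z y)" if "0 < r" for r
    using that ab JI yI by (intro continuous_on_q continuous_intros) auto
  have "DERIV (\<lambda>r. integral (cbox a b) (\<lambda>z. \<psi> z * \<rho> z * q r z y)) h :>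
      integral (cbox a b) (\<lambda>z. \<psi> z * \<rho> z * qt h z y)"
  proof -
    have "((\<lambda>r. integral (cbox a b) (\<lambda>z. \<psi> z * \<rho> z * q r z y)) has_field_derivative
      integral (cbox a b) (\<lambda>z. \<psi> z * \<rho> z * qt h z y)) (at h within {0<..})"
    proof (rule leibniz_rule_field_derivative)
      show "((\<lambda>r. \<psi> z * \<rho> z * q r z y) has_field_derivative \<psi> z * \<rho> z * qt r z y) (at r within {0<..})"
        if "r \<in> {0<..}" "z \<in> cbox a b" for r z
        using that ab y by (intro DERIV_cmult has_field_derivative_at_within[OF d(1)]) auto
      show "(\<lambda>z. \<psi> z * \<rho> z * q r z y) integrable_on cbox a b" if "r \<in> {0<..}" for r
        using that by (intro integrable_continuous continuous_intros) (simp_all add: psi rho cq)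
      have "continuous_on ({0<..} \<times> {a..b}) (\<lambda>(r, z). qt r z y)"
      proof -
        have "continuous_on ({0<..} \<times> {a..b}) (\<lambda>p. case (fst p, snd p, y) of (t, x, y) \<Rightarrow> qt t x y)"
          by (rule continuous_on_compose2[OF c(1)]) (use ab JI yI in \<open>auto intro!: continuous_intros\<close>)
        then show ?thesis by (simp add: case_prod_unfold)
      qed
      moreover have "continuous_on ({0<..} \<times> {a..b}) (\<lambda>p. f (snd p))"
        if "continuous_on {a..b} f" for f :: "real \<Rightarrow> real"
        by (rule continuous_on_compose2[OF that]) (auto intro!: continuous_intros)
      ultimately show "continuous_on ({0<..} \<times> cbox a b) (\<lambda>(r, z). \<psi> z * \<rho> z * qt r z y)"
        using psi rho by (auto simp: case_prod_unfold intro!: continuous_intros)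
    qed (use h in auto)
    then show ?thesis
      using h by (simp add: at_within_open[of h "{0<..}"])
  qed
  moreover have "eventually (\<lambda>r. integral (cbox a b) (\<lambda>z. \<psi> z * \<rho> z * q r z y) = (LINT \<omega>|P y. \<psi> (X r \<omega>))) (nhds h)"
  proof -
    have "eventually (\<lambda>r. r \<in> {0<..}) (nhds h)"
      using h by (intro eventually_nhds_in_open) auto
    then show ?thesis
    proof eventually_elim
      case (elim r)
      then show ?case
        using off by (subst expectation_compact[OF continuous_test[OF \<psi>] _ a yI]) auto
    qed
  qed
  ultimately have "DERIV (\<lambda>h. LINT \<omega>|P y. \<psi> (X h \<omega>)) h :> integral (cbox a b) (\<lambda>z. \<psi> z * \<rho> z * qt h z y)"
    by (rule DERIV_transform_nhds)
  moreover have "integral (cbox a b) (\<lambda>z. \<psi> z * \<rho> z * qt h z y) =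
      (LINT \<omega>|P y. gen (X h \<omega>) (\<psi>1 (X h \<omega>)) (\<psi>2 (X h \<omega>)))"
  proof -
    have qx: "continuous_on {a..b} (\<lambda>z. qx h z y)"
      by (rule has_field_derivative_continuous_on[OF d(3)[OF h _ y]]) (use ab in auto)
    have "((\<lambda>z. \<rho> z * (\<psi> z * gen z (qx h z y) (qxx h z y) - q h z y * gen z (\<psi>1 z) (\<psi>2 z))) has_integral
        ((\<psi> b * qx h b y - q h b y * \<psi>1 b) / deriv s b - (\<psi> a * qx h a y - q h a y * \<psi>1 a) / deriv s a)) {a..b}"
      using ab by (intro green_identity True psi cq h qx der d y) auto
    then have "integral {a..b} (\<lambda>z. \<rho> z * (\<psi> z * gen z (qx h z y) (qxx h z y) - q h z y * gen z (\<psi>1 z) (\<psi>2 z))) = 0"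
      using off[of a] off[of b] by (simp add: integral_unique)
    moreover have "\<rho> z * (\<psi> z * gen z (qx h z y) (qxx h z y) - q h z y * gen z (\<psi>1 z) (\<psi>2 z)) =
        \<psi> z * \<rho> z * qt h z y - gen z (\<psi>1 z) (\<psi>2 z) * \<rho> z * q h z y" if "z \<in> {a..b}" for z
    proof -
      have "z \<in> J" using that ab by auto
      then have "qt h z y = gen z (qx h z y) (qxx h z y)"
        by (intro kolmogorov_gen[OF h _ y d(1)[OF h _ y] d(2)[OF h _ y] d(3)[OF h _ y]])
      then show ?thesis by (simp add: algebra_simps)
    qed
    then have "integral {a..b} (\<lambda>z. \<rho> z * (\<psi> z * gen z (qx h z y) (qxx h z y) - q h z y * gen z (\<psi>1 z) (\<psi>2 z))) =
      integral {a..b} (\<lambda>z. \<psi> z * \<rho> z * qt h z y - gen z (\<psi>1 z) (\<psi>2 z) * \<rho> z * q h z y)"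
      by (rule Henstock_Kurzweil_Integration.integral_cong)
    ultimately have "integral {a..b} (\<lambda>z. \<psi> z * \<rho> z * qt h z y - gen z (\<psi>1 z) (\<psi>2 z) * \<rho> z * q h z y) = 0"
      by simp
    moreover have "(\<lambda>z. \<psi> z * \<rho> z * qt h z y) integrable_on {a..b}"
    proof -
      have "continuous_on {a..b} (\<lambda>z. case (h, z, y) of (t, x, y) \<Rightarrow> qt t x y)"
        by (rule continuous_on_compose2[OF c(1)]) (use ab JI yI h in \<open>auto intro!: continuous_intros\<close>)
      then show ?thesis
        by (intro integrable_continuous_real continuous_intros psi rho) simp
    qed
    moreover have "(\<lambda>z. gen z (\<psi>1 z) (\<psi>2 z) * \<rho> z * q h z y) integrable_on {a..b}"
      by (intro integrable_continuous_real continuous_intros psi rho cq h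
          continuous_on_subset[OF continuous_gen_test[OF \<psi> a]]) simp
    ultimately have "integral {a..b} (\<lambda>z. \<psi> z * \<rho> z * qt h z y) =
        integral {a..b} (\<lambda>z. gen z (\<psi>1 z) (\<psi>2 z) * \<rho> z * q h z y)"
      by (simp add: Henstock_Kurzweil_Integration.integral_diff)
    then show ?thesis
      using gen_test_off_support[OF \<psi>]
      by (subst expectation_compact[OF continuous_gen_test[OF \<psi> a] _ a yI h, of b]) auto
  qed
  ultimately show ?thesis by simp
next
  case False
  then have "\<psi> z = 0" "\<psi>1 z = 0" "\<psi>2 z = 0" for z
    using \<psi> by (auto simp: C2_supp_def)
  then show ?thesis by (simp add: gen_def)
qed

text \<open>The formula for the derivative is available for \<open>h > 0\<close> only, where
  \<open>q\<close> is smooth. L'Hopital's rule reaches \<open>h = 0\<close>, because the expectation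
  of the bounded continuous function \<open>gen z (\<psi>1 z) (\<psi>2 z)\<close> at
  \<open>X h\<close> tends to its value at \<open>y\<close>.\<close>

lemma expectation_test_limit:
  assumes \<psi>: "C2_supp a b \<psi> \<psi>1 \<psi>2" and a: "a \<in> J" and y: "y \<in> J"
  shows "((\<lambda>h. ((LINT \<omega>|P y. \<psi> (X h \<omega>)) - \<psi> y) / h) \<longlongrightarrow> gen y (\<psi>1 y) (\<psi>2 y)) (at_right 0)"
proof (rule lhopital_right)
  have yI: "y \<in> I" by (rule JI[OF y])
  obtain C where C: "0 \<le> C" "\<And>z. \<bar>\<psi> z\<bar> \<le> C"
    by (rule bounded_test[OF \<psi>]) (rule that)
  have "isCont \<psi> y"
    by (rule isCont_test[OF \<psi>])
  then have "((\<lambda>h. LINT \<omega>|P y. \<psi> (X h \<omega>)) \<longlongrightarrow> \<psi> y) (at_right 0)"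
    by (intro expectation_tendsto_start[OF yI _ C(2)] borel_measurable_continuous_onI continuous_test[OF \<psi>])
  then show "((\<lambda>h. (LINT \<omega>|P y. \<psi> (X h \<omega>)) - \<psi> y) \<longlongrightarrow> 0) (at_right 0)"
    by (subst (asm) Lim_null)
  show "eventually (\<lambda>h. DERIV (\<lambda>h. (LINT \<omega>|P y. \<psi> (X h \<omega>)) - \<psi> y) h :>
      (LINT \<omega>|P y. gen (X h \<omega>) (\<psi>1 (X h \<omega>)) (\<psi>2 (X h \<omega>)))) (at_right 0)"
    using eventually_at_right_0_real[OF zero_less_one]
  proof eventually_elim
    case (elim h)
    then show ?case
      using DERIV_diff[OF DERIV_expectation_test[OF \<psi> a y, of h] DERIV_const] by simp
  qed
  obtain C where C: "0 \<le> C" "\<And>z. \<bar>gen z (\<psi>1 z) (\<psi>2 z)\<bar> \<le> C"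
    by (rule bounded_gen_test[OF \<psi> a]) (rule that)
  have "isCont (\<lambda>z. gen z (\<psi>1 z) (\<psi>2 z)) y"
    using continuous_gen_test[OF \<psi> a] by (simp add: continuous_on_eq_continuous_at)
  then have "((\<lambda>h. LINT \<omega>|P y. gen (X h \<omega>) (\<psi>1 (X h \<omega>)) (\<psi>2 (X h \<omega>))) \<longlongrightarrow> gen y (\<psi>1 y) (\<psi>2 y)) (at_right 0)"
    by (intro expectation_tendsto_start[OF yI _ C(2)] borel_measurable_continuous_onI continuous_gen_test[OF \<psi> a])
  then show "((\<lambda>h. (LINT \<omega>|P y. gen (X h \<omega>) (\<psi>1 (X h \<omega>)) (\<psi>2 (X h \<omega>))) / 1) \<longlongrightarrow> gen y (\<psi>1 y) (\<psi>2 y)) (at_right 0)"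
    by simp
  show "eventually (\<lambda>h::real. DERIV (\<lambda>h. h) h :> 1) (at_right 0)"
    by (simp add: DERIV_ident)
  show "eventually (\<lambda>h::real. h \<noteq> 0) (at_right 0)"
    using eventually_at_right_0_real[OF zero_less_one] by eventually_elim simp
qed (auto intro: tendsto_ident_at)

text \<open>Uniform in the starting point, since the generator of a test function is bounded. This
  supplies dominating constants for the limits under the integral in \<open>y\<close>.\<close>

lemma expectation_test_bound:
  assumes \<psi>: "C2_supp a b \<psi> \<psi>1 \<psi>2" and a: "a \<in> J"
  obtains C where "0 \<le> C" "\<And>y h. y \<in> J \<Longrightarrow> 0 < h \<Longrightarrow> \<bar>(LINT \<omega>|P y. \<psi> (X h \<omega>)) - \<psi> y\<bar> \<le> C * h"
proof -
  obtain C where C: "0 \<le> C" "\<And>z. \<bar>gen z (\<psi>1 z) (\<psi>2 z)\<bar> \<le> C"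
    by (rule bounded_gen_test[OF \<psi> a]) (rule that)
  obtain C' where C': "0 \<le> C'" "\<And>z. \<bar>\<psi> z\<bar> \<le> C'"
    by (rule bounded_test[OF \<psi>]) (rule that)
  have "\<bar>(LINT \<omega>|P y. \<psi> (X h \<omega>)) - \<psi> y\<bar> \<le> C * h" if y: "y \<in> J" and h: "0 < h" for y h
  proof -
    have yI: "y \<in> I" by (rule JI[OF y])
    interpret prob_space "P y" by (rule prob[OF yI])
    define E where "E h = (LINT \<omega>|P y. \<psi> (X h \<omega>))" for h
    define G where "G h = (LINT \<omega>|P y. gen (X h \<omega>) (\<psi>1 (X h \<omega>)) (\<psi>2 (X h \<omega>)))" for h
    have E: "DERIV E r :> G r" if "0 < r" for r
      unfolding E_def G_def by (rule DERIV_expectation_test[OF \<psi> a y that])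
    have G: "\<bar>G r\<bar> \<le> C" if "0 < r" for r
    proof -
      note m = measurable_compose[OF X_measurable_P[OF yI less_imp_le[OF that]]
          borel_measurable_continuous_onI[OF continuous_gen_test[OF \<psi> a]]]
      show ?thesis
        unfolding G_def by (rule abs_expectation_le[OF m]) (use C(2) in simp)
    qed
    \<comment> \<open>\<open>E\<close> is differentiable for positive times only, so the mean value
      theorem starts at \<open>e\<close>, and \<open>e\<close> then tends to 0.\<close>
    have "\<bar>E h - E e\<bar> \<le> C * h" if e: "0 < e" "e < h" for e
    proof -
      obtain z where z: "e < z" "z < h" "E h - E e = (h - e) * G z"
        using MVT2[OF e(2), of E G] E e by auto
      have "\<bar>E h - E e\<bar> = (h - e) * \<bar>G z\<bar>"
        using z e by (simp add: abs_mult)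
      also have "\<dots> \<le> h * C"
        using z e G[of z] C by (intro mult_mono) auto
      finally show ?thesis by (simp add: mult.commute)
    qed
    then have "eventually (\<lambda>e. \<bar>E h - E e\<bar> \<le> C * h) (at_right 0)"
      using eventually_at_right_0_real[OF h] by (auto elim: eventually_mono)
    moreover have "isCont \<psi> y"
      by (rule isCont_test[OF \<psi>])
    then have "(E \<longlongrightarrow> \<psi> y) (at_right 0)"
      unfolding E_def by (intro expectation_tendsto_start[OF yI _ C'(2)] borel_measurable_continuous_onI continuous_test[OF \<psi>])
    then have "((\<lambda>e. \<bar>E h - E e\<bar>) \<longlongrightarrow> \<bar>E h - \<psi> y\<bar>) (at_right 0)"
      by (intro tendsto_intros)
    ultimately have "\<bar>E h - \<psi> y\<bar> \<le> C * h"
      by (intro tendsto_upperbound) auto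
    then show ?thesis by (simp add: E_def)
  qed
  with C(1) show ?thesis by (rule that)
qed

section \<open>Symmetry of the semigroup and escape from a compact interval\<close>

lemma expectation_measurable:
  fixes \<phi> :: "real \<Rightarrow> real"
  assumes h: "0 < h" and \<phi>: "\<phi> \<in> borel_measurable borel"
  shows "(\<lambda>y. indicator J y * (LINT \<omega>|P y. \<phi> (X h \<omega>))) \<in> borel_measurable borel"
proof -
  note [measurable] = pdens_jointly_measurable[OF h] \<phi>
  have "(\<lambda>p. (indicator J (fst p) * pdens h (fst p) (snd p)) * \<phi> (snd p)) \<in> borel_measurable (borel \<Otimes>\<^sub>M lborel)"
    by measurable
  then have "(\<lambda>y. LINT z|lborel. (indicator J y * pdens h y z) * \<phi> z) \<in> borel_measurable borel"
    using lborel.borel_measurable_lebesgue_integral[of "\<lambda>y z. (indicator J y * pdens h y z) * \<phi> z" borel]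
    by (simp add: case_prod_unfold)
  moreover have "(LINT z|lborel. (indicator J y * pdens h y z) * \<phi> z) = indicator J y * (LINT \<omega>|P y. \<phi> (X h \<omega>))" for y
    using expectation_X(1)[OF h JI \<phi>, of y] by (cases "y \<in> J") auto
  ultimately show ?thesis by simp
qed

text \<open>The semigroup is self-adjoint in the speed measure: Fubini's theorem and the symmetry of
  \<open>q\<close>. Bounded functions with compact support in \<open>J\<close> make the double
  integrand bounded on a compact rectangle, hence integrable.\<close>

lemma expectation_symmetric:
  assumes h: "0 < h" and a: "a \<in> J" "a' \<in> J"
    and f: "f \<in> borel_measurable borel" "\<And>y. \<bar>f y\<bar> \<le> C" "\<And>y. y \<notin> {a..b} \<Longrightarrow> f y = 0"
    and g: "g \<in> borel_measurable borel" "\<And>y. \<bar>g y\<bar> \<le> D" "\<And>y. y \<notin> {a'..b'} \<Longrightarrow> g y = 0"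
  shows "(LINT y|lborel. f y * \<rho> y * (LINT \<omega>|P y. g (X h \<omega>))) =
    (LINT z|lborel. g z * \<rho> z * (LINT \<omega>|P z. f (X h \<omega>)))"
proof -
  define F where "F y z = f y * \<rho> y * (indicator J y * pdens h y z) * g z" for y z
  have ab: "{a..b} \<subseteq> J" "{a'..b'} \<subseteq> J" using J_Icc a by auto
  note [measurable] = pdens_jointly_measurable[OF h] f(1) g(1) speed_measurable
  have meas: "case_prod F \<in> borel_measurable (borel \<Otimes>\<^sub>M borel)"
    unfolding F_def case_prod_unfold by measurable
  have int: "integrable (lborel \<Otimes>\<^sub>M lborel) (case_prod F)"
  proof -
    let ?R = "{a..b} \<times> {a'..b'}"
    have "compact ?R" by (intro compact_Times) auto
    have "continuous_on ?R (\<lambda>p. \<rho> (fst p) * q h (fst p) (snd p) * \<rho> (snd p))"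
    proof (intro continuous_intros continuous_on_q)
      show "continuous_on ?R (\<lambda>p. \<rho> (fst p))"
        by (rule continuous_on_compose2[OF continuous_rho continuous_on_fst[OF continuous_on_id]]) (use ab in auto)
      show "continuous_on ?R (\<lambda>p. \<rho> (snd p))"
        by (rule continuous_on_compose2[OF continuous_rho continuous_on_snd[OF continuous_on_id]]) (use ab in auto)
    qed (use h ab JI in auto)
    then have "bounded ((\<lambda>p. \<rho> (fst p) * q h (fst p) (snd p) * \<rho> (snd p)) ` ?R)"
      using \<open>compact ?R\<close> by (intro compact_imp_bounded compact_continuous_image)
    then obtain B where B: "\<forall>p\<in>?R. \<bar>\<rho> (fst p) * q h (fst p) (snd p) * \<rho> (snd p)\<bar> \<le> B"
      by (auto simp: bounded_iff)
    have bound: "norm (case_prod F p) \<le> C * B * D" if p: "p \<in> ?R" for p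
    proof -
      have "fst p \<in> J" "snd p \<in> J" using p ab by auto
      then have "norm (case_prod F p) = \<bar>f (fst p)\<bar> * \<bar>\<rho> (fst p) * q h (fst p) (snd p) * \<rho> (snd p)\<bar> * \<bar>g (snd p)\<bar>"
        by (simp add: F_def case_prod_unfold pdens_def abs_mult)
      also have "\<dots> \<le> C * B * D"
      proof -
        have "0 \<le> C" "0 \<le> D" using f(2)[of 0] g(2)[of 0] by linarith+
        moreover have "\<bar>\<rho> (fst p) * q h (fst p) (snd p) * \<rho> (snd p)\<bar> \<le> B" using B p by blast
        ultimately show ?thesis
          by (intro mult_mono f g mult_nonneg_nonneg) auto
      qed
      finally show ?thesis .
    qed
    have "emeasure (lborel \<Otimes>\<^sub>M lborel) ?R < \<infinity>"
      unfolding lborel_prod by (rule emeasure_compact_finite[OF \<open>compact ?R\<close>])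
    moreover have "?R \<in> sets (lborel \<Otimes>\<^sub>M lborel)" by simp
    ultimately have "integrable (lborel \<Otimes>\<^sub>M lborel) (\<lambda>p. indicator ?R p *\<^sub>R case_prod F p)"
      using meas bound by (intro integrableI_bounded_set_indicator[where B = "C * B * D"]) auto
    moreover have "(\<lambda>p. indicator ?R p *\<^sub>R case_prod F p) = case_prod F"
    proof
      fix p
      show "indicator ?R p *\<^sub>R case_prod F p = case_prod F p"
        using f(3)[of "fst p"] g(3)[of "snd p"] by (cases "p \<in> ?R") (auto simp: F_def case_prod_unfold mem_Times_iff)
    qed
    ultimately show ?thesis by (simp only:)
  qed
  have "(LINT y|lborel. f y * \<rho> y * (LINT \<omega>|P y. g (X h \<omega>))) = (LINT y|lborel. LINT z|lborel. F y z)"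
  proof (rule Bochner_Integration.integral_cong[OF refl])
    fix y
    show "f y * \<rho> y * (LINT \<omega>|P y. g (X h \<omega>)) = (LINT z|lborel. F y z)"
    proof (cases "y \<in> {a..b}")
      case True
      then have "y \<in> J" using ab by auto
      then show ?thesis
        by (simp add: F_def expectation_X(1)[OF h JI g(1)] mult.assoc)
    qed (simp add: F_def f(3))
  qed
  also have "\<dots> = (LINT z|lborel. LINT y|lborel. F y z)"
    using int by (rule lborel_pair.Fubini_integral[symmetric])
  also have "\<dots> = (LINT z|lborel. g z * \<rho> z * (LINT \<omega>|P z. f (X h \<omega>)))"
  proof (rule Bochner_Integration.integral_cong[OF refl])
    fix z
    show "(LINT y|lborel. F y z) = g z * \<rho> z * (LINT \<omega>|P z. f (X h \<omega>))"
    proof (cases "z \<in> {a'..b'}")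
      case True
      then have z: "z \<in> J" using ab by auto
      have "F y z = g z * \<rho> z * (pdens h z y * f y)" for y
        using z density_symmetric[OF h JI[OF z], of y] JI[of y] by (auto simp: F_def pdens_def indicator_def)
      then show ?thesis
        by (simp add: expectation_X(1)[OF h JI[OF z] f(1)])
    qed (simp add: F_def g(3))
  qed
  finally show ?thesis .
qed

text \<open>A bump equal to 1 on \<open>{a..b}\<close> and supported in \<open>{a'..b'}\<close>
  bounds the probability by one minus its expectation; its generator vanishes on
  \<open>{a..b}\<close>, so this is \<open>o(h)\<close> pointwise and \<open>O(h)\<close> uniformly.
  Only the position at time \<open>h\<close> is concerned, not the path in between.\<close>

lemma exit_small:
  assumes a: "a' \<in> J" "a' < a" "a \<le> b" "b < b'"
  obtains C where "0 \<le> C"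
    "\<And>y h. y \<in> {a..b} \<Longrightarrow> 0 < h \<Longrightarrow> (LINT \<omega>|P y. indicator (- {a'..b'}) (X h \<omega>)) \<le> C * h"
    "\<And>y. y \<in> {a..b} \<Longrightarrow> ((\<lambda>h. (LINT \<omega>|P y. indicator (- {a'..b'}) (X h \<omega>)) / h) \<longlongrightarrow> 0) (at_right 0)"
proof -
  obtain \<psi> \<psi>1 \<psi>2 where \<psi>: "C2_supp a' b' \<psi> \<psi>1 \<psi>2" "\<And>w. 0 \<le> \<psi> w" "\<And>w. \<psi> w \<le> 1"
    "\<And>w. w \<in> {a..b} \<Longrightarrow> \<psi> w = 1 \<and> \<psi>1 w = 0 \<and> \<psi>2 w = 0"
    by (rule C2_supp_bump[OF a(2-4)]) (rule that)
  obtain C where C: "0 \<le> C" "\<And>y h. y \<in> J \<Longrightarrow> 0 < h \<Longrightarrow> \<bar>(LINT \<omega>|P y. \<psi> (X h \<omega>)) - \<psi> y\<bar> \<le> C * h"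
    by (rule expectation_test_bound[OF \<psi>(1) a(1)]) (rule that)
  have J: "y \<in> J" if "y \<in> {a..b}" for y
    using J_upward[OF a(1)] a that by auto
  have le: "(LINT \<omega>|P y. indicator (- {a'..b'}) (X h \<omega>)) \<le> 1 - (LINT \<omega>|P y. \<psi> (X h \<omega>))"
    if y: "y \<in> {a..b}" and h: "0 < h" for y h
  proof -
    have yI: "y \<in> I" by (rule JI[OF J[OF y]])
    interpret prob_space "P y" by (rule prob[OF yI])
    have X: "X h \<in> borel_measurable (P y)" using X_measurable_P[OF yI] h by simp
    have int: "integrable (P y) (\<lambda>\<omega>. \<psi> (X h \<omega>))"
      using \<psi>(2,3) measurable_compose[OF X borel_measurable_continuous_onI[OF continuous_test[OF \<psi>(1)]]]
      by (intro integrable_if_bounded[where C = 1]) auto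
    have "(LINT \<omega>|P y. indicator (- {a'..b'}) (X h \<omega>)) \<le> (LINT \<omega>|P y. 1 - \<psi> (X h \<omega>))"
    proof (rule integral_mono)
      show "integrable (P y) (\<lambda>\<omega>. indicat_real (- {a'..b'}) (X h \<omega>))"
        using X by (intro integrable_if_bounded[where C = 1]) (auto simp: indicator_def)
      show "indicator (- {a'..b'}) (X h \<omega>) \<le> 1 - \<psi> (X h \<omega>)" for \<omega>
        using \<psi>(1,3) by (auto simp: indicator_def C2_supp_def)
    qed (use int in simp)
    then show ?thesis using int by (simp add: prob_space)
  qed
  show ?thesis
  proof (rule that[OF C(1)])
    show "(LINT \<omega>|P y. indicator (- {a'..b'}) (X h \<omega>)) \<le> C * h" if "y \<in> {a..b}" "0 < h" for y h
      using le[OF that] C(2)[OF J[OF that(1)] that(2)] \<psi>(4)[OF that(1)] by simp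
    show "((\<lambda>h. (LINT \<omega>|P y. indicator (- {a'..b'}) (X h \<omega>)) / h) \<longlongrightarrow> 0) (at_right 0)" if y: "y \<in> {a..b}" for y
    proof (rule tendsto_sandwich[OF _ _ tendsto_const])
      have "((\<lambda>h. - (((LINT \<omega>|P y. \<psi> (X h \<omega>)) - \<psi> y) / h)) \<longlongrightarrow> - gen y (\<psi>1 y) (\<psi>2 y)) (at_right 0)"
        by (intro tendsto_intros expectation_test_limit[OF \<psi>(1) a(1) J[OF y]])
      then show "((\<lambda>h. (1 - (LINT \<omega>|P y. \<psi> (X h \<omega>))) / h) \<longlongrightarrow> 0) (at_right 0)"
        using \<psi>(4)[OF y] by (simp add: gen_def diff_divide_distrib)
      show "eventually (\<lambda>h. 0 \<le> (LINT \<omega>|P y. indicator (- {a'..b'}) (X h \<omega>)) / h) (at_right 0)"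
        using eventually_at_right_0_real[OF zero_less_one] by eventually_elim simp
      show "eventually (\<lambda>h. (LINT \<omega>|P y. indicator (- {a'..b'}) (X h \<omega>)) / h \<le> (1 - (LINT \<omega>|P y. \<psi> (X h \<omega>))) / h) (at_right 0)"
        using eventually_at_right_0_real[OF zero_less_one]
        by eventually_elim (use le[OF y] in \<open>auto intro: divide_right_mono\<close>)
    qed
  qed
qed

text \<open>The regularity class grants derivatives in the interior of the domain, hence for
  \<open>x\<close> in \<open>J\<close>. The integrated identity is continuous in \<open>x\<close>,
  survives the passage to \<open>x = l\<close>, and gives the derivative back by the fundamental
  theorem of calculus.\<close>

lemma DERIV_up_to_I:
  assumes A: "continuous_on (J \<times> I) (\<lambda>(z, x). A z x)" and B: "continuous_on (J \<times> I) (\<lambda>(z, x). B z x)"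
    and d: "\<And>z x. z \<in> J \<Longrightarrow> x \<in> J \<Longrightarrow> DERIV (\<lambda>z. A z x) z :> B z x"
    and x: "x \<in> I" and z: "z \<in> J"
  shows "DERIV (\<lambda>z. A z x) z :> B z x"
proof -
  obtain e where e: "0 < e" "z - e \<in> J" by (rule ball_J[OF z])
  define a where "a = z - e"
  have a: "a \<in> J" "a < z" using e by (auto simp: a_def)
  \<comment> \<open>Approximation from the right stays in \<open>J\<close> even when
    \<open>x = l\<close>.\<close>
  have I_limit: "\<exists>S. (\<forall>n::nat. S n \<in> J) \<and> S \<longlonglongrightarrow> x"
  proof (intro exI[of _ "\<lambda>n. x + 1 / real (Suc n)"] conjI allI)
    have "l \<le> ereal x" using x state_space by auto
    also have "ereal x < ereal (x + 1 / real (Suc n))" for n by simp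
    finally show "x + 1 / real (Suc n) \<in> J" for n by (simp add: J_def)
    have "(\<lambda>n. x + 1 / real (Suc n)) \<longlonglongrightarrow> x + 0"
      by (intro tendsto_intros LIMSEQ_Suc[OF lim_inverse_n'])
    then show "(\<lambda>n. x + 1 / real (Suc n)) \<longlonglongrightarrow> x" by simp
  qed
  have sec: "continuous_on I (\<lambda>x. A w x)" if "w \<in> J" for w
    using continuous_on_compose2[OF A continuous_on_Pair[OF continuous_on_const[of I w] continuous_on_id]] that by auto
  have secB: "continuous_on J (\<lambda>w. B w x)" if "x \<in> I" for x
    using continuous_on_compose2[OF B continuous_on_Pair[OF continuous_on_id continuous_on_const[of J x]]] that by auto
  have repr: "A w x - A a x = integral {a..w} (\<lambda>v. B v x)" if w: "a \<le> w" for w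
  proof -
    have wJ: "w \<in> J" and aw: "{a..w} \<subseteq> J" using J_upward[OF a(1)] w by auto
    define F where "F x = A w x - A a x - integral {a..w} (\<lambda>v. B v x)" for x
    have "continuous_on I (\<lambda>x. integral (cbox a w) (\<lambda>v. B v x))"
    proof (rule integral_continuous_on_param)
      show "continuous_on (I \<times> cbox a w) (\<lambda>(x, v). B v x)"
      proof -
        have "(\<lambda>p. (snd p, fst p)) ` (I \<times> {a..w}) \<subseteq> J \<times> I" using aw by auto
        from continuous_on_compose2[OF B continuous_on_Pair[OF continuous_on_snd[OF continuous_on_id]
            continuous_on_fst[OF continuous_on_id]] this]
        show ?thesis by (simp add: case_prod_unfold)
      qed
    qed
    then have cont_F: "continuous_on I F"
      unfolding F_def by (intro continuous_intros sec wJ a) simp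
    have F_zero: "F x = 0" if "x \<in> J" for x
    proof -
      have "((\<lambda>v. B v x) has_integral (A w x - A a x)) {a..w}"
      proof (rule fundamental_theorem_of_calculus[OF w])
        fix v assume "v \<in> {a..w}"
        then have "v \<in> J" using aw by auto
        then show "((\<lambda>v. A v x) has_vector_derivative B v x) (at v within {a..w})"
          unfolding has_real_derivative_iff_has_vector_derivative[symmetric]
          by (intro has_field_derivative_at_within[OF d] that)
      qed
      then show ?thesis by (simp add: F_def integral_unique)
    qed
    obtain S where S: "\<And>n::nat. S n \<in> J" "S \<longlonglongrightarrow> x" using I_limit by blast
    have "(\<lambda>n. F (S n)) \<longlonglongrightarrow> F x"
      by (rule continuous_on_tendsto_compose[OF cont_F S(2) x]) (use JI[OF S(1)] in simp)
    moreover have "F (S n) = 0" for n by (rule F_zero[OF S(1)])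
    ultimately have "F x = 0" using LIMSEQ_unique[of "\<lambda>n. F (S n)" "F x" 0] by simp
    then show ?thesis by (simp add: F_def)
  qed
  have az: "{a..z + 1} \<subseteq> J" using J_Icc[OF a(1)] .
  have "continuous_on {a..z + 1} (\<lambda>v. B v x)"
    by (rule continuous_on_subset[OF secB[OF x] az])
  then have "((\<lambda>w. integral {a..w} (\<lambda>v. B v x)) has_real_derivative B z x) (at z within {a..z + 1})"
    using a by (intro integral_has_real_derivative) auto
  then have "DERIV (\<lambda>w. integral {a..w} (\<lambda>v. B v x)) z :> B z x"
    using a at_within_Icc_at[of a z "z + 1"] by simp
  then have "DERIV (\<lambda>w. A a x + integral {a..w} (\<lambda>v. B v x)) z :> B z x"
    by (auto intro!: derivative_eq_intros)
  moreover have "eventually (\<lambda>w. w \<in> {a<..}) (nhds z)"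
    using a by (intro eventually_nhds_in_open) auto
  then have "eventually (\<lambda>w. A a x + integral {a..w} (\<lambda>v. B v x) = A w x) (nhds z)"
    by eventually_elim (simp add: repr[symmetric])
  ultimately show ?thesis by (rule DERIV_transform_nhds)
qed

text \<open>The starting point may be the end point \<open>l\<close> when \<open>l\<close> belongs
  to \<open>I\<close>; this is what \<open>DERIV_up_to_I\<close> is for. Symmetry transfers the
  derivatives from the first space variable to the second.\<close>

lemma q_section_C2:
  assumes t: "0 < t" and x: "x \<in> I"
  obtains q1 q2 where "\<And>z. z \<in> J \<Longrightarrow> DERIV (q t x) z :> q1 z" "\<And>z. z \<in> J \<Longrightarrow> DERIV q1 z :> q2 z"
    "continuous_on J q2"
proof -
  obtain qt qx qxx where
    c: "continuous_on ({0<..} \<times> I \<times> I) (\<lambda>(t, x, y). qt t x y)"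
    "continuous_on ({0<..} \<times> I \<times> I) (\<lambda>(t, x, y). qx t x y)"
    "continuous_on ({0<..} \<times> I \<times> I) (\<lambda>(t, x, y). qxx t x y)"
    and d: "\<And>t x y. 0 < t \<Longrightarrow> x \<in> J \<Longrightarrow> y \<in> J \<Longrightarrow> DERIV (\<lambda>r. q r x y) t :> qt t x y"
    "\<And>t x y. 0 < t \<Longrightarrow> x \<in> J \<Longrightarrow> y \<in> J \<Longrightarrow> DERIV (\<lambda>z. q t z y) x :> qx t x y"
    "\<And>t x y. 0 < t \<Longrightarrow> x \<in> J \<Longrightarrow> y \<in> J \<Longrightarrow> DERIV (\<lambda>z. qx t z y) x :> qxx t x y"
    by (rule q_regular) (rule that)
  have sec: "continuous_on (J \<times> I) (\<lambda>(z, y). F t z y)"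
    if "continuous_on ({0<..} \<times> I \<times> I) (\<lambda>(t, x, y). F t x y)" for F :: "real \<Rightarrow> real \<Rightarrow> real \<Rightarrow> real"
    using continuous_on_compose2[OF that continuous_on_Pair[OF continuous_on_const[of "J \<times> I" t] continuous_on_id]] t JI
    by (auto simp: case_prod_unfold)
  have secx: "continuous_on J (\<lambda>z. qxx t z x)"
    using continuous_on_compose2[OF sec[OF c(3)] continuous_on_Pair[OF continuous_on_id continuous_on_const[of J x]]] x by auto
  have "DERIV (\<lambda>z. q t z x) z :> qx t z x" if "z \<in> J" for z
    by (rule DERIV_up_to_I[OF sec[OF continuous_q] sec[OF c(2)] d(2)[OF t] x that])
  moreover have "eventually (\<lambda>w. q t w x = q t x w) (nhds z)" if "z \<in> J" for z
    using eventually_nhds_in_open[OF open_J that]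
    by eventually_elim (use density_symmetric[OF t _ x] JI in auto)
  ultimately have "DERIV (q t x) z :> qx t z x" if "z \<in> J" for z
    using DERIV_transform_nhds that by blast
  moreover have "DERIV (\<lambda>z. qx t z x) z :> qxx t z x" if "z \<in> J" for z
    by (rule DERIV_up_to_I[OF sec[OF c(2)] sec[OF c(3)] d(3)[OF t] x that])
  ultimately show ?thesis
    using secx by (rule that)
qed

section \<open>Hitting probabilities\<close>

abbreviation paths :: "(real \<Rightarrow> real) measure" where
  "paths \<equiv> (\<Pi>\<^sub>M u\<in>{0..}. borel)"

section \<open>The filtration and the simple Markov property\<close>

lemma sets_past:
  "sets (past M X t) = sigma_sets (space M) {X u -` B \<inter> space M | u B. 0 \<le> u \<and> u \<le> t \<and> B \<in> sets borel}"
  unfolding past_def by (rule sets_measure_of) auto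

lemma space_past: "space (past M X t) = space M"
  unfolding past_def by (rule space_measure_of) auto

lemma filtration_past: "filtration (space M) (past M X)"
proof
  show "sets (past M X i) \<subseteq> sets (past M X j)" if "i \<le> j" for i j
    unfolding sets_past by (rule sigma_sets_mono') (use that in force)
qed (rule space_past)

lemma X_measurable_past: "0 \<le> u \<Longrightarrow> u \<le> t \<Longrightarrow> X u \<in> borel_measurable (past M X t)"
  by (rule measurableI) (auto simp: space_past sets_past intro!: sigma_sets.Basic)

lemma path_from_space: "path_from X r \<omega> \<in> space paths"
  by (auto simp: path_from_def space_PiM PiE_def)

lemma markov:
  assumes x: "x \<in> I" and t: "0 \<le> t" and B: "B \<in> sets paths"
  shows "measure (P x) {\<omega> \<in> space M. path_from X t \<omega> \<in> B} =
    (LINT \<omega>|P x. measure (P (X t \<omega>)) {\<omega>' \<in> space M. path_from X 0 \<omega>' \<in> B})"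
proof -
  interpret filtration "space M" "past M X" by (rule filtration_past)
  have "space M \<in> sets (pre_sigma (\<lambda>_. t))"
    using sets.top[of "pre_sigma (\<lambda>_. t)"] by (simp add: space_pre_sigma)
  then have "measure (P x) {\<omega> \<in> space M. path_from X t \<omega> \<in> B} =
      (LINT \<omega>:space M|P x. measure (P (X t \<omega>)) {\<omega>' \<in> space M. path_from X 0 \<omega>' \<in> B})"
    using strong_markov[OF x stopping_time_const[of "past M X" t] _ _ B] t by simp
  also have "\<dots> = (LINT \<omega>|P x. measure (P (X t \<omega>)) {\<omega>' \<in> space M. path_from X 0 \<omega>' \<in> B})"
    unfolding set_lebesgue_integral_def
    by (rule Bochner_Integration.integral_cong) (auto simp: space_P[OF x])
  finally show ?thesis .
qed

lemma path_from_event_measurable: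
  assumes "x \<in> I" "0 \<le> t" "B \<in> sets paths"
  shows "{\<omega> \<in> space M. path_from X t \<omega> \<in> B} \<in> sets (P x)"
proof -
  have "path_from X t \<in> measurable (P x) paths"
    unfolding path_from_def[abs_def]
    by (rule measurable_restrict) (use X_measurable_P[OF assms(1)] assms(2) in auto)
  then show ?thesis
    using measurable_sets[OF _ assms(3), of "path_from X t" "P x"]
    by (simp add: vimage_def Int_def conj_commute space_P[OF assms(1)])
qed

section \<open>Hitting a fixed level within a short time\<close>

definition hit :: "real \<Rightarrow> real \<Rightarrow> 'w set" where
  "hit z h = {\<omega> \<in> space M. \<exists>u\<in>{0..h}. X u \<omega> = z}"

text \<open>Rational times suffice for continuous paths and keep the set in the product
  sigma-algebra, as the strong Markov property demands.\<close>

definition stay :: "real \<Rightarrow> real \<Rightarrow> real \<Rightarrow> (real \<Rightarrow> real) set" where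
  "stay z d h = {p \<in> space paths. \<forall>r\<in>\<rat> \<inter> {0..h}. \<bar>p r - z\<bar> \<le> d}"

lemma X_continuous_Icc: "\<omega> \<in> space M \<Longrightarrow> 0 \<le> a \<Longrightarrow> continuous_on {a..b} (\<lambda>u. X u \<omega>)"
  by (rule continuous_on_subset[OF X_continuous]) auto

text \<open>Stated for an arbitrary \<open>N\<close> so as to serve twice: for the laws
  \<open>P y\<close>, and for \<open>past M X t\<close>, where it turns the hitting time into a
  stopping time.\<close>

lemma hit_measurable:
  assumes N: "space N = space M" "\<And>u. 0 \<le> u \<Longrightarrow> u \<le> h \<Longrightarrow> X u \<in> borel_measurable N" and "0 \<le> h"
  shows "hit z h \<in> sets N"
proof -
  have "hit z h = {\<omega> \<in> space N. \<forall>n::nat. \<exists>r\<in>\<rat> \<inter> {0..h}. \<bar>X r \<omega> - z\<bar> < 1 / real (Suc n)}"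
    unfolding hit_def N(1)
  proof (intro Collect_cong conj_cong refl)
    fix \<omega> assume "\<omega> \<in> space M"
    then have "continuous_on {0..h} (\<lambda>u. X u \<omega> - z)"
      by (intro continuous_intros X_continuous_Icc) auto
    from zero_iff_rational_approx[OF this \<open>0 \<le> h\<close>]
    show "(\<exists>u\<in>{0..h}. X u \<omega> = z) \<longleftrightarrow> (\<forall>n::nat. \<exists>r\<in>\<rat> \<inter> {0..h}. \<bar>X r \<omega> - z\<bar> < 1 / real (Suc n))"
      by simp
  qed
  also have "\<dots> \<in> sets N"
  proof (intro sets.sets_Collect_countable_All sets.sets_Collect_countable_Ex')
    fix n r assume "r \<in> \<rat> \<inter> {0..h}"
    then have "X r \<in> borel_measurable N" using N(2) by auto
    then show "{\<omega> \<in> space N. \<bar>X r \<omega> - z\<bar> < 1 / real (Suc n)} \<in> sets N"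
      by measurable
  qed (auto intro: countable_Int1 countable_rat)
  finally show ?thesis .
qed

lemma hit_measurable_P: "y \<in> I \<Longrightarrow> 0 \<le> h \<Longrightarrow> hit z h \<in> sets (P y)"
  by (rule hit_measurable) (auto simp: space_P X_measurable_P)

lemma sets_stay: "stay z d h \<in> sets paths"
  unfolding stay_def
proof (intro sets.sets_Collect_countable_All')
  fix r assume "r \<in> \<rat> \<inter> {0..h}"
  then have "(\<lambda>p. p r) \<in> borel_measurable paths"
    by (intro measurable_component_singleton) auto
  then show "{p \<in> space paths. \<bar>p r - z\<bar> \<le> d} \<in> sets paths"
    by measurable
qed (auto intro: countable_Int1 countable_rat)

lemma path_from_stay:
  assumes "\<omega> \<in> space M" "0 \<le> a" and "path_from X a \<omega> \<in> stay z d h" and "u \<in> {0..h}"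
  shows "\<bar>X (a + u) \<omega> - z\<bar> \<le> d"
proof (rule bounded_on_rationals_imp[where g = "\<lambda>u. X (a + u) \<omega> - z", OF _ _ \<open>u \<in> {0..h}\<close>])
  show "continuous_on {0..h} (\<lambda>u. X (a + u) \<omega> - z)"
    using assms(2) by (intro continuous_intros continuous_on_compose2[OF X_continuous[OF assms(1)]]) auto
  show "\<bar>X (a + r) \<omega> - z\<bar> \<le> d" if "r \<in> \<rat>" "0 \<le> r" "r \<le> h" for r
    using assms(3) that by (auto simp: stay_def path_from_def)
qed

text \<open>Continuity at time 0: as the horizon shrinks, these events increase to an almost sure
  one. The bound 1/2 stands for any constant below 1.\<close>

lemma stay_likely:
  assumes z: "z \<in> I" and d: "0 < d"
  obtains h where "0 < h" "1 / 2 \<le> measure (P z) {\<omega> \<in> space M. path_from X 0 \<omega> \<in> stay z d h}"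
proof -
  interpret prob_space "P z" by (rule prob[OF z])
  define E where "E n = {\<omega> \<in> space M. path_from X 0 \<omega> \<in> stay z d (1 / real (Suc n))}" for n
  have E_meas: "E n \<in> events" for n
    unfolding E_def by (intro path_from_event_measurable z sets_stay) simp
  have "incseq E"
  proof (rule incseq_SucI)
    fix n
    have "1 / real (Suc (Suc n)) \<le> 1 / real (Suc n)" by (simp add: field_simps)
    then show "E n \<subseteq> E (Suc n)"
      by (auto simp: E_def stay_def intro: order_trans)
  qed
  then have "(\<lambda>n. prob (E n)) \<longlonglongrightarrow> prob (\<Union>n. E n)"
    using E_meas by (intro finite_Lim_measure_incseq) auto
  moreover have "AE \<omega> in P z. \<omega> \<in> (\<Union>n. E n)"
    using AE_X_tendsto[OF z] AE_space
  proof eventually_elim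
    case (elim \<omega>)
    then have w: "\<omega> \<in> space M" by (simp add: space_P[OF z])
    have "X 0 \<omega> = z"
      using tendsto_unique[OF _ X_tendsto_start[OF w] elim(1)] by simp
    moreover have "continuous_on {0..} (\<lambda>u. X u \<omega>)" by (rule X_continuous[OF w])
    ultimately obtain e where e: "0 < e" "\<And>r. 0 \<le> r \<Longrightarrow> dist r 0 < e \<Longrightarrow> dist (X r \<omega>) z < d"
      using d unfolding continuous_on_iff by (metis atLeast_iff order_refl)
    obtain n where n: "1 / real (Suc n) < e"
      using reals_Archimedean[OF e(1)] by (auto simp: inverse_eq_divide)
    have "path_from X 0 \<omega> \<in> stay z d (1 / real (Suc n))"
      using e(2) n path_from_space[of 0 \<omega>] by (fastforce simp: stay_def path_from_def dist_real_def)
    then show ?case using w by (auto simp: E_def)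
  qed
  then have "prob (\<Union>n. E n) = 1"
    using E_meas by (intro prob_eq_1[THEN iffD2]) auto
  ultimately have "eventually (\<lambda>n. 1 / 2 < prob (E n)) sequentially"
    by (intro order_tendstoD) auto
  then obtain n where "1 / 2 < prob (E n)"
    by (auto simp: eventually_sequentially)
  then show ?thesis
    by (intro that[of "1 / real (Suc n)"]) (auto simp: E_def)
qed

text \<open>Strong Markov at the hitting time: a path that hits \<open>z\<close> before \<open>h\<close> is still near \<open>z\<close> at time
  \<open>h\<close> with a probability bounded below.\<close>

lemma hit_prob_le:
  assumes z: "z \<in> I" and y: "y \<in> I" and h: "0 < h" "h \<le> h0"
  shows "measure (P y) (hit z h) * measure (P z) {\<omega> \<in> space M. path_from X 0 \<omega> \<in> stay z d h0}
    \<le> measure (P y) {\<omega> \<in> space M. \<bar>X h \<omega> - z\<bar> \<le> d}"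
proof -
  interpret prob_space "P y" by (rule prob[OF y])
  interpret filtration "space M" "past M X" by (rule filtration_past)
  \<comment> \<open>The first hit, extended by the value \<open>h + 1\<close> to paths without a hit
    by time \<open>h\<close>, so that \<open>\<tau>\<close> is a finite stopping time and the dummy
    value cannot be confused with a hit.\<close>
  define \<tau> where "\<tau> \<omega> = (if \<omega> \<in> hit z h then Inf {u \<in> {0..h}. X u \<omega> = z} else h + 1)" for \<omega>
  have attained: "\<tau> \<omega> \<in> {0..h} \<and> X (\<tau> \<omega>) \<omega> = z" and least: "\<And>u. u \<in> {0..h} \<Longrightarrow> X u \<omega> = z \<Longrightarrow> \<tau> \<omega> \<le> u"
    if w: "\<omega> \<in> hit z h" for \<omega>
  proof -
    let ?S = "{u \<in> {0..h}. X u \<omega> = z}"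
    have "closed ?S"
      using w by (intro continuous_closed_preimage_constant X_continuous_Icc) (auto simp: hit_def)
    moreover have bdd: "bdd_below ?S" by (rule bdd_belowI[of _ 0]) auto
    moreover have "?S \<noteq> {}" using w by (auto simp: hit_def)
    ultimately have "Inf ?S \<in> ?S" by (intro closed_contains_Inf)
    then show "\<tau> \<omega> \<in> {0..h} \<and> X (\<tau> \<omega>) \<omega> = z"
      using w by (simp add: \<tau>_def)
    show "\<tau> \<omega> \<le> u" if "u \<in> {0..h}" "X u \<omega> = z" for u
      using w that bdd by (auto simp: \<tau>_def intro: cInf_lower)
  qed
  \<comment> \<open>Reduces a hit by time \<open>t\<close> to an event on the path up to
    \<open>min t h\<close>, which is already known to belong to the past.\<close>
  have le_iff: "\<omega> \<in> hit z h \<and> \<tau> \<omega> \<le> t \<longleftrightarrow> \<omega> \<in> hit z (min t h)" for t \<omega>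
    using attained[of \<omega>] least[of \<omega>] by (force simp: hit_def)
  have hit_past: "{\<omega> \<in> hit z h. \<tau> \<omega> \<le> t} \<in> sets (past M X t)" for t
  proof -
    have "{\<omega> \<in> hit z h. \<tau> \<omega> \<le> t} = hit z (min t h)"
      using le_iff by blast
    also have "\<dots> \<in> sets (past M X t)"
    proof (cases "0 \<le> t")
      case True
      then show ?thesis
        using h by (intro hit_measurable space_past X_measurable_past) auto
    next
      case False
      then have "hit z (min t h) = {}" by (auto simp: hit_def)
      then show ?thesis by simp
    qed
    finally show ?thesis .
  qed
  have stop: "stopping_time (past M X) \<tau>"
  proof
    fix t
    have "{\<omega> \<in> space M. \<tau> \<omega> \<le> t} = {\<omega> \<in> hit z h. \<tau> \<omega> \<le> t} \<union> (if h + 1 \<le> t then space M else {})"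
    proof (rule set_eqI)
      fix \<omega>
      show "\<omega> \<in> {\<omega> \<in> space M. \<tau> \<omega> \<le> t} \<longleftrightarrow> \<omega> \<in> {\<omega> \<in> hit z h. \<tau> \<omega> \<le> t} \<union> (if h + 1 \<le> t then space M else {})"
      proof (cases "\<omega> \<in> hit z h")
        case True
        then have "\<omega> \<in> space M" "\<tau> \<omega> \<le> h"
          using attained by (auto simp: hit_def)
        with True show ?thesis by auto
      next
        case False
        then have "\<tau> \<omega> = h + 1" by (simp add: \<tau>_def)
        with False show ?thesis by auto
      qed
    qed
    also have "\<dots> \<in> sets (past M X t)"
      using hit_past[of t] sets.top[of "past M X t"] by (auto simp: space_past)
    finally show "Measurable.pred (past M X t) (\<lambda>\<omega>. \<tau> \<omega> \<le> t)"
      by (simp add: pred_def space_past)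
  qed
  have pos: "0 \<le> \<tau> \<omega>" for \<omega>
    using attained[of \<omega>] h by (cases "\<omega> \<in> hit z h") (auto simp: \<tau>_def)
  have A: "hit z h \<in> sets (pre_sigma \<tau>)"
    by (rule sets_pre_sigmaI[OF stop hit_past])
  have "measure (P y) {\<omega> \<in> hit z h. path_from X (\<tau> \<omega>) \<omega> \<in> stay z d h0} =
      (LINT \<omega>:hit z h|P y. measure (P (X (\<tau> \<omega>) \<omega>)) {\<omega>' \<in> space M. path_from X 0 \<omega>' \<in> stay z d h0})"
    by (rule strong_markov[OF y stop pos A sets_stay])
  also have "\<dots> = (LINT \<omega>|P y. indicator (hit z h) \<omega> * measure (P z) {\<omega>' \<in> space M. path_from X 0 \<omega>' \<in> stay z d h0})"
    unfolding set_lebesgue_integral_def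
    by (rule Bochner_Integration.integral_cong) (use attained in \<open>auto simp: indicator_def\<close>)
  also have "\<dots> = measure (P y) (hit z h) * measure (P z) {\<omega>' \<in> space M. path_from X 0 \<omega>' \<in> stay z d h0}"
    using hit_measurable_P[OF y less_imp_le[OF h(1)]] by (simp add: Int_absorb1 sets.sets_into_space)
  finally have eq: "measure (P y) {\<omega> \<in> hit z h. path_from X (\<tau> \<omega>) \<omega> \<in> stay z d h0} =
      measure (P y) (hit z h) * measure (P z) {\<omega>' \<in> space M. path_from X 0 \<omega>' \<in> stay z d h0}" .
  \<comment> \<open>The time \<open>h - \<tau> \<omega>\<close> left after the hit is at most
    \<open>h0\<close>, the horizon of \<open>stay\<close>.\<close>
  have "{\<omega> \<in> hit z h. path_from X (\<tau> \<omega>) \<omega> \<in> stay z d h0} \<subseteq> {\<omega> \<in> space M. \<bar>X h \<omega> - z\<bar> \<le> d}"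
  proof safe
    fix \<omega> assume w: "\<omega> \<in> hit z h" "path_from X (\<tau> \<omega>) \<omega> \<in> stay z d h0"
    then show "\<omega> \<in> space M" by (simp add: hit_def)
    then show "\<bar>X h \<omega> - z\<bar> \<le> d"
      using path_from_stay[OF _ pos w(2), of "h - \<tau> \<omega>"] attained[OF w(1)] pos[of \<omega>] h by auto
  qed
  then have "measure (P y) {\<omega> \<in> hit z h. path_from X (\<tau> \<omega>) \<omega> \<in> stay z d h0} \<le>
      measure (P y) {\<omega> \<in> space M. \<bar>X h \<omega> - z\<bar> \<le> d}"
  proof (rule finite_measure_mono)
    have "X h \<in> borel_measurable (P y)" using X_measurable_P[OF y] h by simp
    then have "{\<omega> \<in> space (P y). \<bar>X h \<omega> - z\<bar> \<le> d} \<in> events" by measurable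
    then show "{\<omega> \<in> space M. \<bar>X h \<omega> - z\<bar> \<le> d} \<in> events" by (simp add: space_P[OF y])
  qed
  with eq show ?thesis by simp
qed

text \<open>By \<open>hit_prob_le\<close> a hit is at most twice as likely as being near
  \<open>z\<close> at time \<open>h\<close>, the 2 coming from the bound 1/2 for staying near
  \<open>z\<close>. Being near \<open>z\<close> is dominated by the expectation of a bump, and the
  bump and its generator vanish at distance \<open>d\<close> and beyond.\<close>

lemma hit_prob_small:
  assumes d: "0 < d" and z: "z - d \<in> J"
  obtains C h0 where "0 < h0" "0 \<le> C"
    "\<And>y h. y \<in> J \<Longrightarrow> d \<le> \<bar>y - z\<bar> \<Longrightarrow> 0 < h \<Longrightarrow> h < h0 \<Longrightarrow> measure (P y) (hit z h) \<le> C * h"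
    "\<And>y. y \<in> J \<Longrightarrow> d \<le> \<bar>y - z\<bar> \<Longrightarrow> ((\<lambda>h. measure (P y) (hit z h) / h) \<longlongrightarrow> 0) (at_right 0)"
proof -
  have zJ: "z \<in> J" using J_upward[OF z] d by simp
  obtain \<psi> \<psi>1 \<psi>2 where \<psi>: "C2_supp (z - d) (z + d) \<psi> \<psi>1 \<psi>2" "\<And>w. 0 \<le> \<psi> w" "\<And>w. \<psi> w \<le> 1"
    "\<And>w. w \<in> {z - d / 2..z + d / 2} \<Longrightarrow> \<psi> w = 1 \<and> \<psi>1 w = 0 \<and> \<psi>2 w = 0"
    by (rule C2_supp_bump[of "z - d" "z - d / 2" "z + d / 2" "z + d"]) (use d in auto)
  obtain h0 where h0: "0 < h0" "1 / 2 \<le> measure (P z) {\<omega> \<in> space M. path_from X 0 \<omega> \<in> stay z (d / 2) h0}"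
    by (rule stay_likely[OF JI[OF zJ], of "d / 2"]) (use d in auto)
  obtain C where C: "0 \<le> C" "\<And>y h. y \<in> J \<Longrightarrow> 0 < h \<Longrightarrow> \<bar>(LINT \<omega>|P y. \<psi> (X h \<omega>)) - \<psi> y\<bar> \<le> C * h"
    by (rule expectation_test_bound[OF \<psi>(1) z]) (rule that)
  have le: "measure (P y) (hit z h) \<le> 2 * (LINT \<omega>|P y. \<psi> (X h \<omega>))"
    if y: "y \<in> J" and h: "0 < h" "h < h0" for y h
  proof -
    have yI: "y \<in> I" by (rule JI[OF y])
    interpret prob_space "P y" by (rule prob[OF yI])
    have X: "X h \<in> borel_measurable (P y)" using X_measurable_P[OF yI] h by simp
    then have "{\<omega> \<in> space (P y). \<bar>X h \<omega> - z\<bar> \<le> d / 2} \<in> events" by measurable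
    then have ev: "{\<omega> \<in> space M. \<bar>X h \<omega> - z\<bar> \<le> d / 2} \<in> events" by (simp add: space_P[OF yI])
    have "measure (P y) (hit z h) * (1 / 2) \<le> measure (P y) (hit z h) * measure (P z) {\<omega> \<in> space M. path_from X 0 \<omega> \<in> stay z (d / 2) h0}"
      using h0(2) by (intro mult_left_mono) auto
    also have "\<dots> \<le> measure (P y) {\<omega> \<in> space M. \<bar>X h \<omega> - z\<bar> \<le> d / 2}"
      using h by (intro hit_prob_le JI[OF zJ] yI) auto
    also have "\<dots> = (LINT \<omega>|P y. indicator {\<omega> \<in> space M. \<bar>X h \<omega> - z\<bar> \<le> d / 2} \<omega>)"
      using ev by (simp add: Int_absorb1 sets.sets_into_space)
    also have "\<dots> \<le> (LINT \<omega>|P y. \<psi> (X h \<omega>))"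
    proof (rule integral_mono)
      show "integrable (P y) (\<lambda>\<omega>. \<psi> (X h \<omega>))"
        using \<psi>(2,3) measurable_compose[OF X borel_measurable_continuous_onI[OF continuous_test[OF \<psi>(1)]]]
        by (intro integrable_if_bounded[where C = 1]) auto
      show "indicator {\<omega> \<in> space M. \<bar>X h \<omega> - z\<bar> \<le> d / 2} \<omega> \<le> \<psi> (X h \<omega>)" for \<omega>
      proof (cases "\<bar>X h \<omega> - z\<bar> \<le> d / 2")
        case True
        then have "X h \<omega> \<in> {z - d / 2..z + d / 2}"
          unfolding atLeastAtMost_iff by linarith
        then show ?thesis using \<psi>(4) by (simp add: indicator_def)
      qed (use \<psi>(2) in simp)
    qed (intro integrable_real_indicator ev, simp add: emeasure_eq_measure)
    finally show ?thesis by simp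
  qed
  have off: "\<psi> y = 0" "gen y (\<psi>1 y) (\<psi>2 y) = 0" if "d \<le> \<bar>y - z\<bar>" for y
    using \<psi>(1) gen_test_off_support[OF \<psi>(1), of y] that unfolding C2_supp_def
    by (auto simp: abs_if split: if_splits)
  show ?thesis
  proof (rule that[OF h0(1), of "2 * C"])
    show "measure (P y) (hit z h) \<le> 2 * C * h" if "y \<in> J" "d \<le> \<bar>y - z\<bar>" "0 < h" "h < h0" for y h
      using le[OF that(1,3,4)] C(2)[OF that(1,3)] off[OF that(2)] by simp
    show "((\<lambda>h. measure (P y) (hit z h) / h) \<longlongrightarrow> 0) (at_right 0)" if y: "y \<in> J" "d \<le> \<bar>y - z\<bar>" for y
    proof (rule tendsto_sandwich[OF _ _ tendsto_const])
      have "((\<lambda>h. 2 * (((LINT \<omega>|P y. \<psi> (X h \<omega>)) - \<psi> y) / h)) \<longlongrightarrow> 2 * gen y (\<psi>1 y) (\<psi>2 y)) (at_right 0)"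
        by (intro tendsto_intros expectation_test_limit[OF \<psi>(1) z y(1)])
      then show "((\<lambda>h. 2 * ((LINT \<omega>|P y. \<psi> (X h \<omega>)) / h)) \<longlongrightarrow> 0) (at_right 0)"
        using off[OF y(2)] by simp
      show "eventually (\<lambda>h. 0 \<le> measure (P y) (hit z h) / h) (at_right 0)"
        using eventually_at_right_0_real[OF h0(1)] by eventually_elim simp
      show "eventually (\<lambda>h. measure (P y) (hit z h) / h \<le> 2 * ((LINT \<omega>|P y. \<psi> (X h \<omega>)) / h)) (at_right 0)"
        using eventually_at_right_0_real[OF h0(1)]
      proof eventually_elim
        case (elim h)
        then show ?case using le[OF y(1), of h] by (simp add: field_simps)
      qed
    qed
  qed (use C in auto)
qed

end

section \<open>Moving boundaries\<close>

text \<open>\<open>\<sigma> = 1\<close> for a lower and \<open>\<sigma> = - 1\<close> for an upper boundary.\<close>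

locale moving_boundary = linear_diffusion l I M P X s \<rho> q
  for l :: ereal and I :: "real set" and M :: "'w measure" and P :: "real \<Rightarrow> 'w measure"
    and X :: "real \<Rightarrow> 'w \<Rightarrow> real" and s \<rho> :: "real \<Rightarrow> real" and q :: "real \<Rightarrow> real \<Rightarrow> real \<Rightarrow> real" +
  fixes \<zeta> :: ereal and c :: "real \<Rightarrow> real" and \<sigma> :: real
  assumes sigma: "\<sigma> = 1 \<or> \<sigma> = - 1"
    and zeta_pos: "0 < \<zeta>"
    and c_continuous: "continuous_on {t. 0 \<le> t \<and> ereal t < \<zeta>} c"
    and c_above_l: "\<And>t. 0 \<le> t \<Longrightarrow> ereal t < \<zeta> \<Longrightarrow> l < ereal (c t)"
    and eventually_on_side: "\<And>x. x \<in> I \<Longrightarrow> AE \<omega> in P x.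
      \<exists>T. ereal T < \<zeta> \<and> (\<forall>u. T \<le> u \<and> ereal u < \<zeta> \<longrightarrow> 0 < \<sigma> * (X u \<omega> - c u))"
begin

text \<open>Two clocks: the path is read from time \<open>a\<close> on, the boundary from time
  \<open>t\<close> on. With \<open>a = 0\<close> this is no passage of the shifted boundary, with
  \<open>a = t\<close> no passage from time \<open>t\<close> on; the Markov property at time
  \<open>t\<close> relates the two.\<close>

definition nocross :: "real \<Rightarrow> real \<Rightarrow> 'w set" where
  "nocross a t = {\<omega> \<in> space M. \<forall>u\<ge>0. ereal (t + u) < \<zeta> \<longrightarrow> X (a + u) \<omega> \<noteq> c (t + u)}"

text \<open>The same event for paths, in countable terms. On each compact time interval ending at a
  rational \<open>v\<close> before \<open>\<zeta>\<close> the gap has a positive lower bound; the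
  bound may depend on \<open>v\<close>, since the gap may shrink to 0 as \<open>\<zeta>\<close> is
  approached.\<close>

definition avoiding :: "real \<Rightarrow> (real \<Rightarrow> real) set" where
  "avoiding t = {p \<in> space paths. \<forall>v\<in>\<rat> \<inter> {v. 0 \<le> v \<and> ereal (t + v) < \<zeta>}.
     \<exists>n::nat. \<forall>r\<in>\<rat> \<inter> {0..v}. \<not> \<bar>p r - c (t + r)\<bar> < 1 / real (Suc n)}"

definition H :: "real \<Rightarrow> real \<Rightarrow> real" where
  "H t y = measure (P y) (nocross 0 t)"

text \<open>Started at \<open>y\<close> at time \<open>t\<close>, the last passage occurs before time \<open>t + h\<close>.\<close>

definition W :: "real \<Rightarrow> real \<Rightarrow> real \<Rightarrow> real" where
  "W t h y = measure (P y) (nocross h (t + h)) - H t y"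

lemma c_in_J: "0 \<le> t \<Longrightarrow> ereal t < \<zeta> \<Longrightarrow> c t \<in> J"
  using c_above_l by (simp add: J_def)

lemma less_zeta_mono: "ereal t < \<zeta> \<Longrightarrow> u \<le> t \<Longrightarrow> ereal u < \<zeta>"
  by (meson ereal_less_eq(3) le_less_trans)

lemma zeta_room:
  assumes "ereal t < \<zeta>"
  obtains e where "0 < e" "ereal (t + e) < \<zeta>"
proof -
  obtain z where "ereal t < ereal z" "ereal z < \<zeta>"
    using ereal_dense2[OF assms] by blast
  then show ?thesis by (intro that[of "z - t"]) auto
qed

lemma c_continuous_Icc: "0 \<le> a \<Longrightarrow> ereal b < \<zeta> \<Longrightarrow> continuous_on {a..b} c"
  by (rule continuous_on_subset[OF c_continuous]) (auto intro: less_zeta_mono)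

lemma gap_continuous:
  assumes "\<omega> \<in> space M" "0 \<le> a" "0 \<le> t" "ereal (t + v) < \<zeta>"
  shows "continuous_on {0..v} (\<lambda>u. X (a + u) \<omega> - c (t + u))"
proof (intro continuous_intros)
  show "continuous_on {0..v} (\<lambda>u. X (a + u) \<omega>)"
    using assms by (intro continuous_on_compose2[OF X_continuous[OF assms(1)]] continuous_intros) auto
  show "continuous_on {0..v} (\<lambda>u. c (t + u))"
    using assms(3) by (intro continuous_on_compose2[OF c_continuous_Icc[OF assms(3,4)]] continuous_intros) auto
qed

lemma sets_avoiding: "avoiding t \<in> sets paths"
  unfolding avoiding_def
proof (intro sets.sets_Collect_countable_All' sets.sets_Collect_countable_Ex)
  fix n :: nat and v r :: real assume "r \<in> \<rat> \<inter> {0..v}"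
  then have "(\<lambda>p. p r) \<in> borel_measurable paths"
    by (intro measurable_component_singleton) auto
  then show "{p \<in> space paths. \<not> \<bar>p r - c (t + r)\<bar> < 1 / real (Suc n)} \<in> sets paths"
    by measurable
qed (auto intro: countable_Int1 countable_rat)

text \<open>Before \<open>\<zeta>\<close> the gap is continuous on compact time intervals, so
  \<open>zero_iff_rational_approx\<close> applies to each of them.\<close>

lemma nocross_eq:
  assumes "0 \<le> a" "0 \<le> t"
  shows "nocross a t = {\<omega> \<in> space M. path_from X a \<omega> \<in> avoiding t}"
  unfolding nocross_def
proof (intro Collect_cong conj_cong refl)
  fix \<omega> assume w: "\<omega> \<in> space M"
  have iff: "(\<exists>u\<in>{0..v}. X (a + u) \<omega> - c (t + u) = 0) \<longleftrightarrow>
      (\<forall>n::nat. \<exists>r\<in>\<rat> \<inter> {0..v}. \<bar>X (a + r) \<omega> - c (t + r)\<bar> < 1 / real (Suc n))"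
    if "0 \<le> v" "ereal (t + v) < \<zeta>" for v
    by (rule zero_iff_rational_approx[OF gap_continuous[OF w assms that(2)] that(1)])
  have path: "path_from X a \<omega> \<in> avoiding t \<longleftrightarrow> (\<forall>v\<in>\<rat> \<inter> {v. 0 \<le> v \<and> ereal (t + v) < \<zeta>}.
     \<exists>n::nat. \<forall>r\<in>\<rat> \<inter> {0..v}. \<not> \<bar>X (a + r) \<omega> - c (t + r)\<bar> < 1 / real (Suc n))"
    using path_from_space[of a \<omega>] by (simp add: avoiding_def path_from_def)
  show "(\<forall>u\<ge>0. ereal (t + u) < \<zeta> \<longrightarrow> X (a + u) \<omega> \<noteq> c (t + u)) \<longleftrightarrow> path_from X a \<omega> \<in> avoiding t"
    unfolding path
  proof safe
    fix v assume *: "\<forall>u\<ge>0. ereal (t + u) < \<zeta> \<longrightarrow> X (a + u) \<omega> \<noteq> c (t + u)" "0 \<le> v" "ereal (t + v) < \<zeta>"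
    then have "\<not> (\<exists>u\<in>{0..v}. X (a + u) \<omega> - c (t + u) = 0)"
      using less_zeta_mono[OF *(3)] by auto
    then show "\<exists>n::nat. \<forall>r\<in>\<rat> \<inter> {0..v}. \<not> \<bar>X (a + r) \<omega> - c (t + r)\<bar> < 1 / real (Suc n)"
      unfolding iff[OF *(2,3)] by blast
  next
    fix u assume *: "\<forall>v\<in>\<rat> \<inter> {v. 0 \<le> v \<and> ereal (t + v) < \<zeta>}.
      \<exists>n::nat. \<forall>r\<in>\<rat> \<inter> {0..v}. \<not> \<bar>X (a + r) \<omega> - c (t + r)\<bar> < 1 / real (Suc n)"
      and u: "0 \<le> u" "ereal (t + u) < \<zeta>" "X (a + u) \<omega> = c (t + u)"
    \<comment> \<open>The meeting time \<open>u\<close> may be irrational; a rational horizon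
      \<open>v\<close> slightly beyond it and still before \<open>\<zeta>\<close> detects
      it.\<close>
    obtain e where e: "0 < e" "ereal (t + u + e) < \<zeta>" by (rule zeta_room[OF u(2)])
    obtain v where v: "v \<in> \<rat>" "u < v" "v < u + e"
      using Rats_dense_in_real[of u "u + e"] e by auto
    then have v': "0 \<le> v" "ereal (t + v) < \<zeta>"
      using u less_zeta_mono[OF e(2), of "t + v"] by auto
    have "\<exists>u\<in>{0..v}. X (a + u) \<omega> - c (t + u) = 0"
      using u v by (intro bexI[of _ u]) auto
    then show False
      using * v(1) v' unfolding iff[OF v'] by blast
  qed
qed

lemma nocross_measurable: "x \<in> I \<Longrightarrow> 0 \<le> a \<Longrightarrow> 0 \<le> t \<Longrightarrow> nocross a t \<in> sets (P x)"
  unfolding nocross_eq by (rule path_from_event_measurable[OF _ _ sets_avoiding])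

lemma nocross_shift_mono: "0 \<le> h \<Longrightarrow> nocross a t \<subseteq> nocross (a + h) (t + h)"
  by (auto simp: nocross_def add.assoc)

lemma H_bounds:
  assumes "y \<in> I" shows "0 \<le> H t y" "H t y \<le> 1"
  using prob_space.prob_le_1[OF prob[OF assms]] by (auto simp: H_def)

lemma kernel_compose_measurable:
  assumes "B \<in> sets paths" "x \<in> I" "0 \<le> a"
  shows "(\<lambda>\<omega>. measure (P (X a \<omega>)) {\<omega>' \<in> space M. path_from X 0 \<omega>' \<in> B}) \<in> borel_measurable (P x)"
proof -
  have "X a \<in> measurable (P x) (restrict_space borel I)"
    using X_measurable_P[OF assms(2,3)] conservative[OF assms(3)]
    by (intro measurable_restrict_space2) (auto simp: space_P[OF assms(2)])
  then show ?thesis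
    by (rule measurable_compose[OF _ kernel[OF assms(1)]])
qed

lemma kernel_indicator_measurable:
  assumes "B \<in> sets paths"
  shows "(\<lambda>y. indicator I y * measure (P y) {\<omega>' \<in> space M. path_from X 0 \<omega>' \<in> B}) \<in> borel_measurable borel"
  using kernel[OF assms] sets_I by (simp add: borel_measurable_restrict_space_iff mult.commute)

lemma H_eq: "0 \<le> t \<Longrightarrow> H t y = measure (P y) {\<omega>' \<in> space M. path_from X 0 \<omega>' \<in> avoiding t}"
  by (simp add: H_def nocross_eq)

lemma H_compose_measurable: "x \<in> I \<Longrightarrow> 0 \<le> a \<Longrightarrow> 0 \<le> t \<Longrightarrow> (\<lambda>\<omega>. H t (X a \<omega>)) \<in> borel_measurable (P x)"
  unfolding H_eq by (rule kernel_compose_measurable[OF sets_avoiding])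

lemma H_measurable: "0 \<le> t \<Longrightarrow> (\<lambda>y. indicator I y * H t y) \<in> borel_measurable borel"
  unfolding H_eq by (rule kernel_indicator_measurable[OF sets_avoiding])

lemma markov_nocross:
  assumes "x \<in> I" "0 \<le> a" "0 \<le> t"
  shows "measure (P x) (nocross a t) = (LINT \<omega>|P x. H t (X a \<omega>))"
  using markov[OF assms(1,2) sets_avoiding[of t]] assms by (simp add: nocross_eq H_eq)

lemma AE_start: "y \<in> I \<Longrightarrow> AE \<omega> in P y. \<omega> \<in> space M \<and> X 0 \<omega> = y"
  using start[of y] AE_space[of "P y"] by (auto simp: space_P elim!: eventually_rev_mp)

section \<open>Short-time passages away from the boundary\<close>

lemma W_nonneg: "y \<in> I \<Longrightarrow> 0 \<le> t \<Longrightarrow> 0 \<le> h \<Longrightarrow> 0 \<le> W t h y"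
  using finite_measure.finite_measure_mono[OF prob_space.finite_measure[OF prob]
      nocross_shift_mono[of h 0 t] nocross_measurable]
  by (simp add: W_def H_def)

text \<open>A path counted by \<open>W\<close> meets the boundary before time \<open>h\<close> and
  not afterwards. If the level \<open>z\<close> separates \<open>y\<close> from the boundary
  throughout, the path crosses \<open>z\<close> on the way, by the intermediate value
  theorem.\<close>

lemma W_le_hit:
  assumes y: "y \<in> I" and t: "0 \<le> t" and h: "0 < h" "ereal (t + h) < \<zeta>"
    and z: "(\<forall>r\<in>{t..t + h}. c r < z) \<and> z < y \<or> (\<forall>r\<in>{t..t + h}. z < c r) \<and> y < z"
  shows "W t h y \<le> measure (P y) (hit z h)"
proof -
  interpret prob_space "P y" by (rule prob[OF y])
  have "W t h y = prob (nocross h (t + h) - nocross 0 t)"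
    unfolding W_def H_def using nocross_shift_mono[of h 0 t] h t y
    by (subst finite_measure_Diff) (auto intro: nocross_measurable)
  also have "\<dots> \<le> prob (hit z h)"
  proof (rule finite_measure_mono_AE)
    show "AE \<omega> in P y. \<omega> \<in> nocross h (t + h) - nocross 0 t \<longrightarrow> \<omega> \<in> hit z h"
      using AE_start[OF y]
    proof eventually_elim
      case (elim \<omega>)
      show ?case
      proof
        assume *: "\<omega> \<in> nocross h (t + h) - nocross 0 t"
        then obtain u where u: "0 \<le> u" "ereal (t + u) < \<zeta>" "X u \<omega> = c (t + u)"
          using elim by (auto simp: nocross_def)
        have "u < h"
        proof (rule ccontr)
          assume "\<not> u < h"
          then have "X (h + (u - h)) \<omega> \<noteq> c (t + h + (u - h))"
            using * u(2) by (auto simp: nocross_def dest!: spec[of _ "u - h"])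
          with u(3) show False by simp
        qed
        then have "t + u \<in> {t..t + h}" using u by simp
        then have "X u \<omega> < z \<and> z < X 0 \<omega> \<or> z < X u \<omega> \<and> X 0 \<omega> < z"
          using z u(3) elim by auto
        then have "\<exists>v\<ge>0. v \<le> u \<and> X v \<omega> = z"
          using IVT'[of "\<lambda>v. X v \<omega>" 0 z u] IVT2'[of "\<lambda>v. X v \<omega>" u z 0]
            X_continuous_Icc[of \<omega> 0 u] elim u(1) by (auto intro: less_imp_le)
        then show "\<omega> \<in> hit z h"
          using elim \<open>u < h\<close> by (auto simp: hit_def)
      qed
    qed
    show "hit z h \<in> events"
      using h by (intro hit_measurable_P y) auto
  qed
  finally show ?thesis .
qed

lemma c_near:
  assumes t: "0 \<le> t" "ereal t < \<zeta>" and e: "0 < e"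
  obtains d where "0 < d" "ereal (t + d) < \<zeta>" "\<And>r. r \<in> {t..t + d} \<Longrightarrow> \<bar>c r - c t\<bar> < e"
proof -
  obtain e1 where e1: "0 < e1" "ereal (t + e1) < \<zeta>" by (rule zeta_room[OF t(2)])
  have "continuous_on {t..t + e1} c" by (rule c_continuous_Icc[OF t(1) e1(2)])
  then obtain d where d: "0 < d" "\<And>r. r \<in> {t..t + e1} \<Longrightarrow> dist r t < d \<Longrightarrow> dist (c r) (c t) < e"
    using e e1(1) unfolding continuous_on_iff by (metis atLeastAtMost_iff le_add_same_cancel1 less_imp_le order_refl)
  show ?thesis
  proof (rule that[of "min e1 (d / 2)"])
    show "ereal (t + min e1 (d / 2)) < \<zeta>" by (rule less_zeta_mono[OF e1(2)]) simp
    show "\<bar>c r - c t\<bar> < e" if "r \<in> {t..t + min e1 (d / 2)}" for r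
      using d(2)[of r] that d(1) by (auto simp: dist_real_def)
  qed (use d e1 in auto)
qed

text \<open>For a short time the boundary stays within \<open>e / 2\<close> of \<open>c t\<close>,
  so a path from distance at least \<open>e\<close> must first hit one of the levels
  \<open>z1\<close>, \<open>z2\<close> halfway. Fixing these two levels makes the estimate uniform
  in \<open>y\<close>.\<close>

lemma W_small:
  assumes t: "0 \<le> t" "ereal t < \<zeta>" and e: "0 < e" "c t - e \<in> J"
  obtains C h0 where "0 < h0" "0 \<le> C"
    "\<And>y h. y \<in> J \<Longrightarrow> e \<le> \<bar>y - c t\<bar> \<Longrightarrow> 0 < h \<Longrightarrow> h < h0 \<Longrightarrow> W t h y \<le> C * h"
    "\<And>y. y \<in> J \<Longrightarrow> e \<le> \<bar>y - c t\<bar> \<Longrightarrow> ((\<lambda>h. W t h y / h) \<longlongrightarrow> 0) (at_right 0)"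
proof -
  define z1 z2 where "z1 = c t + e / 2" and "z2 = c t - e / 2"
  obtain d where d: "0 < d" "ereal (t + d) < \<zeta>" "\<And>r. r \<in> {t..t + d} \<Longrightarrow> \<bar>c r - c t\<bar> < e / 2"
    by (rule c_near[OF t, of "e / 2"]) (use e in auto)
  have "z1 - e / 4 \<in> J" "z2 - e / 4 \<in> J"
    using J_upward[OF e(2)] e(1) by (auto simp: z1_def z2_def)
  note J = this
  obtain C1 h1 where 1: "0 < h1" "0 \<le> C1"
    "\<And>y h. y \<in> J \<Longrightarrow> e / 4 \<le> \<bar>y - z1\<bar> \<Longrightarrow> 0 < h \<Longrightarrow> h < h1 \<Longrightarrow> measure (P y) (hit z1 h) \<le> C1 * h"
    "\<And>y. y \<in> J \<Longrightarrow> e / 4 \<le> \<bar>y - z1\<bar> \<Longrightarrow> ((\<lambda>h. measure (P y) (hit z1 h) / h) \<longlongrightarrow> 0) (at_right 0)"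
    by (rule hit_prob_small[OF _ J(1)]) (use e in simp, rule that)
  obtain C2 h2 where 2: "0 < h2" "0 \<le> C2"
    "\<And>y h. y \<in> J \<Longrightarrow> e / 4 \<le> \<bar>y - z2\<bar> \<Longrightarrow> 0 < h \<Longrightarrow> h < h2 \<Longrightarrow> measure (P y) (hit z2 h) \<le> C2 * h"
    "\<And>y. y \<in> J \<Longrightarrow> e / 4 \<le> \<bar>y - z2\<bar> \<Longrightarrow> ((\<lambda>h. measure (P y) (hit z2 h) / h) \<longlongrightarrow> 0) (at_right 0)"
    by (rule hit_prob_small[OF _ J(2)]) (use e in simp, rule that)
  have le: "\<exists>z\<in>{z1, z2}. e / 4 \<le> \<bar>y - z\<bar> \<and> (\<forall>h. 0 < h \<and> h < d \<longrightarrow> W t h y \<le> measure (P y) (hit z h))"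
    if y: "y \<in> J" "e \<le> \<bar>y - c t\<bar>" for y
  proof (cases "c t \<le> y")
    case True
    have "W t h y \<le> measure (P y) (hit z1 h)" if h: "0 < h" "h < d" for h
    proof (rule W_le_hit[OF JI[OF y(1)] t(1) h(1)])
      have "c r < z1" if "r \<in> {t..t + h}" for r
        using abs_less_iff[THEN iffD1, OF d(3)[of r]] that h by (simp add: z1_def)
      then show "(\<forall>r\<in>{t..t + h}. c r < z1) \<and> z1 < y \<or> (\<forall>r\<in>{t..t + h}. z1 < c r) \<and> y < z1"
        using True y e by (auto simp: z1_def)
      show "ereal (t + h) < \<zeta>" by (rule less_zeta_mono[OF d(2)]) (use h in simp)
    qed
    then show ?thesis using True y e by (intro bexI[of _ z1]) (auto simp: z1_def)
  next
    case False
    have "W t h y \<le> measure (P y) (hit z2 h)" if h: "0 < h" "h < d" for h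
    proof (rule W_le_hit[OF JI[OF y(1)] t(1) h(1)])
      have "z2 < c r" if "r \<in> {t..t + h}" for r
        using abs_less_iff[THEN iffD1, OF d(3)[of r]] that h by (simp add: z2_def)
      then show "(\<forall>r\<in>{t..t + h}. c r < z2) \<and> z2 < y \<or> (\<forall>r\<in>{t..t + h}. z2 < c r) \<and> y < z2"
        using False y e by (auto simp: z2_def)
      show "ereal (t + h) < \<zeta>" by (rule less_zeta_mono[OF d(2)]) (use h in simp)
    qed
    then show ?thesis using False y e by (intro bexI[of _ z2]) (auto simp: z2_def)
  qed
  show ?thesis
  proof (rule that[of "min d (min h1 h2)" "C1 + C2"])
    show "W t h y \<le> (C1 + C2) * h"
      if y: "y \<in> J" "e \<le> \<bar>y - c t\<bar>" and h: "0 < h" "h < min d (min h1 h2)" for y h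
    proof -
      obtain z where z: "z \<in> {z1, z2}" "e / 4 \<le> \<bar>y - z\<bar>" "W t h y \<le> measure (P y) (hit z h)"
        using le[OF y] h by auto
      have "measure (P y) (hit z h) \<le> C1 * h \<or> measure (P y) (hit z h) \<le> C2 * h"
        using z 1(3)[OF y(1) _ h(1)] 2(3)[OF y(1) _ h(1)] h(2) by auto
      moreover have "0 \<le> C1 * h" "0 \<le> C2 * h" using 1 2 h by auto
      ultimately show ?thesis using z(3) by (auto simp: distrib_right)
    qed
    show "((\<lambda>h. W t h y / h) \<longlongrightarrow> 0) (at_right 0)" if y: "y \<in> J" "e \<le> \<bar>y - c t\<bar>" for y
    proof -
      obtain z where z: "z \<in> {z1, z2}" "e / 4 \<le> \<bar>y - z\<bar>"
        "\<And>h. 0 < h \<Longrightarrow> h < d \<Longrightarrow> W t h y \<le> measure (P y) (hit z h)"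
        using le[OF y] by auto
      have lim: "((\<lambda>h. measure (P y) (hit z h) / h) \<longlongrightarrow> 0) (at_right 0)"
        using z(1,2) 1(4)[OF y(1)] 2(4)[OF y(1)] by auto
      show ?thesis
      proof (rule tendsto_sandwich[OF _ _ tendsto_const lim])
        show "eventually (\<lambda>h. 0 \<le> W t h y / h) (at_right 0)"
          using eventually_at_right_0_real[OF d(1)]
          by eventually_elim (use W_nonneg[OF JI[OF y(1)] t(1)] in auto)
        show "eventually (\<lambda>h. W t h y / h \<le> measure (P y) (hit z h) / h) (at_right 0)"
          using eventually_at_right_0_real[OF d(1)]
          by eventually_elim (use z(3) in \<open>auto intro: divide_right_mono\<close>)
      qed
    qed
  qed (use d 1 2 in auto)
qed

text \<open>\<open>B\<close> is the event of starting on the wrong side and never meeting the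
  boundary. Under any \<open>P x\<close> the path from time \<open>t\<close> on is almost surely not
  in \<open>B\<close>, as it must end on the right side. Hence the integral of
  \<open>pdens t x z * K z\<close> in \<open>z\<close> is zero for every \<open>x\<close> in
  \<open>I\<close>; integrated over \<open>x\<close> against the speed measure, it becomes the
  integral of \<open>\<rho> z * K z\<close>.\<close>

lemma H_wrong_side_AE:
  assumes t: "0 < t" "ereal t < \<zeta>"
    and B: "B = avoiding t \<inter> {p \<in> space paths. \<sigma> * (p 0 - c t) < 0}"
  shows "AE z in lborel. z \<in> J \<longrightarrow> measure (P z) {\<omega> \<in> space M. path_from X 0 \<omega> \<in> B} = 0"
proof -
  define K where "K z = indicator I z * measure (P z) {\<omega> \<in> space M. path_from X 0 \<omega> \<in> B}" for z
  have "(\<lambda>p. p 0) \<in> borel_measurable paths"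
    by (rule measurable_component_singleton) simp
  then have "{p \<in> space paths. \<sigma> * (p 0 - c t) < 0} \<in> sets paths"
    by measurable
  then have sets_B: "B \<in> sets paths"
    unfolding B by (intro sets.Int sets_avoiding)
  have K [measurable]: "K \<in> borel_measurable borel"
    unfolding K_def by (rule kernel_indicator_measurable[OF sets_B])
  have K_nonneg: "0 \<le> K z" for z by (simp add: K_def)
  have zero: "(\<integral>\<^sup>+z. ennreal (pdens t x z * K z) \<partial>lborel) = 0" if x: "x \<in> I" for x
  proof -
    interpret prob_space "P x" by (rule prob[OF x])
    have "AE \<omega> in P x. \<omega> \<notin> {\<omega> \<in> space M. path_from X t \<omega> \<in> B}"
      using eventually_on_side[OF x]
    proof eventually_elim
      case (elim \<omega>)
      show ?case
      proof
        assume "\<omega> \<in> {\<omega> \<in> space M. path_from X t \<omega> \<in> B}"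
        then have w: "\<omega> \<in> space M" "\<omega> \<in> nocross t t" "\<sigma> * (X t \<omega> - c t) < 0"
          using t by (auto simp: B nocross_eq path_from_def)
        obtain T where T: "ereal T < \<zeta>" "\<And>u. T \<le> u \<Longrightarrow> ereal u < \<zeta> \<Longrightarrow> 0 < \<sigma> * (X u \<omega> - c u)"
          using elim by blast
        define v where "v = max T t - t"
        have v: "0 \<le> v" "ereal (t + v) < \<zeta>" "0 < \<sigma> * (X (t + v) \<omega> - c (t + v))"
          using T t by (auto simp: v_def max_def)
        have "continuous_on {0..v} (\<lambda>u. \<sigma> * (X (t + u) \<omega> - c (t + u)))"
          using gap_continuous[OF w(1) _ _ v(2), of t] t by (intro continuous_on_mult_left) auto
        then obtain u where "0 \<le> u" "u \<le> v" "\<sigma> * (X (t + u) \<omega> - c (t + u)) = 0"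
          using IVT'[of "\<lambda>u. \<sigma> * (X (t + u) \<omega> - c (t + u))" 0 0 v] w(3) v(1,3) by auto
        then show False
          using w(2) sigma less_zeta_mono[OF v(2), of "t + u"] by (auto simp: nocross_def)
      qed
    qed
    then have "prob {\<omega> \<in> space M. path_from X t \<omega> \<in> B} = 0"
      using path_from_event_measurable[OF x _ sets_B, of t] t by (intro prob_eq_0[THEN iffD2]) auto
    then have "(LINT \<omega>|P x. K (X t \<omega>)) = 0"
    proof -
      have "(LINT \<omega>|P x. K (X t \<omega>)) = (LINT \<omega>|P x. measure (P (X t \<omega>)) {\<omega> \<in> space M. path_from X 0 \<omega> \<in> B})"
        using conservative t by (intro Bochner_Integration.integral_cong) (auto simp: K_def space_P[OF x])
      then show ?thesis
        using markov[OF x less_imp_le[OF t(1)] sets_B] \<open>prob _ = 0\<close> by simp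
    qed
    then have int0: "(LINT z|lborel. pdens t x z * K z) = 0"
      by (simp add: expectation_X[OF t(1) x K])
    have "K z \<le> 1" for z
      using prob_space.prob_le_1[OF prob, of z] by (auto simp: K_def indicator_def)
    then have "integrable (P x) (\<lambda>\<omega>. K (X t \<omega>))"
      using measurable_compose[OF X_measurable_P[OF x less_imp_le[OF t(1)]] K] K_nonneg
      by (intro integrable_if_bounded[where C = 1]) auto
    then have int: "integrable lborel (\<lambda>z. pdens t x z * K z)"
      by (simp add: expectation_X[OF t(1) x K])
    then show ?thesis
      using int0 pdens_nonneg[OF t(1) x] K_nonneg
      by (subst nn_integral_eq_integral) auto
  qed
  \<comment> \<open>The weight \<open>\<rho> x\<close> averages the starting point over the speed
    measure, with respect to which the semigroup is symmetric.\<close>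
  define g where "g x z = ennreal (indicator J x * \<rho> x * (pdens t x z * K z))" for x z
  have "case_prod g \<in> borel_measurable (lborel \<Otimes>\<^sub>M lborel)"
  proof -
    note [measurable] = pdens_jointly_measurable[OF t(1)] speed_measurable
    have eq: "case_prod g = (\<lambda>p. ennreal (\<rho> (fst p) * ((indicator J (fst p) * pdens t (fst p) (snd p)) * K (snd p))))"
      by (auto simp: g_def fun_eq_iff mult_ac)
    show ?thesis unfolding eq by measurable
  qed
  then have "(\<integral>\<^sup>+z. (\<integral>\<^sup>+x. g x z \<partial>lborel) \<partial>lborel) = (\<integral>\<^sup>+x. (\<integral>\<^sup>+z. g x z \<partial>lborel) \<partial>lborel)"
    by (rule lborel_pair.Fubini')
  also have "\<dots> = (\<integral>\<^sup>+x. 0 \<partial>(lborel :: real measure))"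
  proof (rule nn_integral_cong)
    fix x :: real
    show "(\<integral>\<^sup>+z. g x z \<partial>lborel) = 0"
    proof (cases "x \<in> J")
      case True
      have [measurable]: "(\<lambda>z. pdens t x z) \<in> borel_measurable borel"
        by (rule borel_measurable_pdens[OF t(1) JI[OF True]])
      have "(\<integral>\<^sup>+z. g x z \<partial>lborel) = (\<integral>\<^sup>+z. ennreal (\<rho> x) * ennreal (pdens t x z * K z) \<partial>lborel)"
        using True rho_pos[OF True] pdens_nonneg[OF t(1) JI[OF True]] K_nonneg
        by (simp add: g_def ennreal_mult less_imp_le)
      also have "\<dots> = 0"
        by (subst nn_integral_cmult) (simp_all add: zero[OF JI[OF True]])
      finally show ?thesis .
    qed (simp add: g_def)
  qed
  finally have zero2: "(\<integral>\<^sup>+z. (\<integral>\<^sup>+x. g x z \<partial>lborel) \<partial>lborel) = 0" by simp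
  \<comment> \<open>By symmetry the integration over \<open>x\<close> yields the total mass of the
    law of \<open>X t\<close> under \<open>P z\<close>, which is 1.\<close>
  have inner: "(\<integral>\<^sup>+x. g x z \<partial>lborel) = ennreal (indicator J z * \<rho> z * K z)" for z
  proof (cases "z \<in> J")
    case True
    have zI: "z \<in> I" by (rule JI[OF True])
    interpret prob_space "P z" by (rule prob[OF zI])
    have [measurable]: "(\<lambda>x. pdens t z x) \<in> borel_measurable borel"
      by (rule borel_measurable_pdens[OF t(1) zI])
    have "g x z = ennreal (\<rho> z * K z) * ennreal (pdens t z x)" for x
    proof (cases "x \<in> J")
      case xJ: True
      show ?thesis
        using density_symmetric[OF t(1) JI[OF xJ] zI] True xJ rho_pos[OF True] K_nonneg[of z] pdens_nonneg[OF t(1) zI, of x]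
        by (simp add: g_def pdens_def mult_ac flip: ennreal_mult)
    qed (simp add: g_def pdens_def)
    then have "(\<integral>\<^sup>+x. g x z \<partial>lborel) = ennreal (\<rho> z * K z) * (\<integral>\<^sup>+x. ennreal (pdens t z x) \<partial>lborel)"
      by (simp add: nn_integral_cmult)
    also have "(\<integral>\<^sup>+x. ennreal (pdens t z x) \<partial>lborel) = emeasure (distr (P z) borel (X t)) UNIV"
      unfolding distr_X[OF t(1) zI] by (subst emeasure_density) auto
    also have "\<dots> = 1"
      using X_measurable_P[OF zI less_imp_le[OF t(1)]] emeasure_space_1 by (simp add: emeasure_distr)
    finally show ?thesis using True by simp
  qed (simp add: g_def pdens_def)
  note [measurable] = speed_measurable
  have "AE z in lborel. ennreal (indicator J z * \<rho> z * K z) = 0"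
    using zero2 unfolding inner by (subst (asm) nn_integral_0_iff_AE) auto
  then show ?thesis
  proof eventually_elim
    case (elim z)
    show ?case
    proof
      assume z: "z \<in> J"
      then have "\<rho> z * K z \<le> 0" using elim by (simp add: ennreal_eq_0_iff)
      then have "K z \<le> 0" using rho_pos[OF z] by (simp add: mult_le_0_iff)
      then show "measure (P z) {\<omega> \<in> space M. path_from X 0 \<omega> \<in> B} = 0"
        using JI[OF z] by (simp add: K_def measure_le_0_iff)
    qed
  qed
qed

text \<open>A path that avoids the boundary from the wrong side is still on the wrong side at time
  \<open>h\<close>. The law at that time has a density, so the exceptional null set of
  \<open>H_wrong_side_AE\<close> is harmless. The shift by \<open>h > 0\<close> also covers
  \<open>t = 0\<close>, which that lemma excludes.\<close>

lemma H_wrong_side: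
  assumes y: "y \<in> I" and t: "0 \<le> t" "ereal t < \<zeta>" and side: "\<sigma> * (y - c t) \<le> 0"
  shows "H t y = 0"
proof -
  interpret prob_space "P y" by (rule prob[OF y])
  have meas: "nocross 0 t \<in> events" by (rule nocross_measurable[OF y _ t(1)]) simp
  show ?thesis
  proof (cases "y = c t")
    case True
    have "AE \<omega> in P y. \<omega> \<notin> nocross 0 t"
      using AE_start[OF y] by eventually_elim (use True t in \<open>auto simp: nocross_def intro!: exI[of _ 0]\<close>)
    then show ?thesis
      unfolding H_def using meas by (intro prob_eq_0[THEN iffD2])
  next
    case False
    with side sigma have neg: "\<sigma> * (y - c t) < 0" by auto
    obtain h where h: "0 < h" "ereal (t + h) < \<zeta>" by (rule zeta_room[OF t(2)])
    define B where "B = avoiding (t + h) \<inter> {p \<in> space paths. \<sigma> * (p 0 - c (t + h)) < 0}"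
    have "(\<lambda>p. p 0) \<in> borel_measurable paths"
      by (rule measurable_component_singleton) simp
    then have "{p \<in> space paths. \<sigma> * (p 0 - c (t + h)) < 0} \<in> sets paths"
      by measurable
    then have sets_B: "B \<in> sets paths"
      unfolding B_def by (intro sets.Int sets_avoiding)
    define K where "K z = indicator I z * measure (P z) {\<omega> \<in> space M. path_from X 0 \<omega> \<in> B}" for z
    have K: "K \<in> borel_measurable borel"
      unfolding K_def by (rule kernel_indicator_measurable[OF sets_B])
    have "AE z in lborel. z \<in> J \<longrightarrow> K z = 0"
      using H_wrong_side_AE[OF _ h(2) B_def] t h by (auto simp: K_def elim!: eventually_mono)
    then have "AE z in lborel. pdens h y z * K z = 0"
      by eventually_elim (auto simp: pdens_def indicator_def)
    then have "(LINT z|lborel. pdens h y z * K z) = 0"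
      by (rule integral_eq_zero_AE)
    then have "(LINT \<omega>|P y. K (X h \<omega>)) = 0"
      by (simp add: expectation_X[OF h(1) y K])
    moreover have "(LINT \<omega>|P y. K (X h \<omega>)) = (LINT \<omega>|P y. measure (P (X h \<omega>)) {\<omega> \<in> space M. path_from X 0 \<omega> \<in> B})"
      using conservative h by (intro Bochner_Integration.integral_cong) (auto simp: K_def space_P[OF y])
    ultimately have "prob {\<omega> \<in> space M. path_from X h \<omega> \<in> B} = 0"
      using markov[OF y less_imp_le[OF h(1)] sets_B] by simp
    moreover have "prob (nocross 0 t) \<le> prob {\<omega> \<in> space M. path_from X h \<omega> \<in> B}"
    proof (rule finite_measure_mono_AE)
      show "AE \<omega> in P y. \<omega> \<in> nocross 0 t \<longrightarrow> \<omega> \<in> {\<omega> \<in> space M. path_from X h \<omega> \<in> B}"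
        using AE_start[OF y]
      proof eventually_elim
        case (elim \<omega>)
        show ?case
        proof
          assume nc: "\<omega> \<in> nocross 0 t"
          have no_zero: "\<sigma> * (X u \<omega> - c (t + u)) \<noteq> 0" if "0 \<le> u" "u \<le> h" for u
            using nc that less_zeta_mono[OF h(2), of "t + u"] sigma by (auto simp: nocross_def)
          have "\<sigma> * (X h \<omega> - c (t + h)) < 0"
          proof (rule ccontr)
            assume "\<not> ?thesis"
            moreover have "continuous_on {0..h} (\<lambda>u. \<sigma> * (X u \<omega> - c (t + u)))"
              using gap_continuous[of \<omega> 0, OF _ _ t(1) h(2)] elim by (intro continuous_on_mult_left) auto
            ultimately obtain u where "0 \<le> u" "u \<le> h" "\<sigma> * (X u \<omega> - c (t + u)) = 0"
              using IVT'[of "\<lambda>u. \<sigma> * (X u \<omega> - c (t + u))" 0 0 h] neg elim h(1) by auto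
            then show False using no_zero by blast
          qed
          moreover have "\<omega> \<in> nocross h (t + h)"
            using nc nocross_shift_mono[of h 0 t] h by auto
          ultimately show "\<omega> \<in> {\<omega> \<in> space M. path_from X h \<omega> \<in> B}"
            using t h elim path_from_space[of h \<omega>] by (auto simp: B_def nocross_eq path_from_def)
        qed
      qed
      show "{\<omega> \<in> space M. path_from X h \<omega> \<in> B} \<in> events"
        using h by (intro path_from_event_measurable y sets_B) simp
    qed
    ultimately show ?thesis
      by (simp add: H_def measure_le_0_iff)
  qed
qed

section \<open>Smooth boundaries and the law of the last passage time\<close>

text \<open>The region on which \<open>H\<close> is assumed smooth; it contains the boundary itself,
  where the one-sided derivative is taken. Beyond the boundary \<open>H\<close> is zero by
  \<open>H_wrong_side\<close>.\<close>

definition side :: "(real \<times> real) set" where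
  "side = {(t, y). 0 < t \<and> ereal t < \<zeta> \<and> l < ereal y \<and> 0 \<le> \<sigma> * (y - c t)}"

definition open_side :: "(real \<times> real) set" where
  "open_side = {(t, y). 0 < t \<and> ereal t < \<zeta> \<and> l < ereal y \<and> 0 < \<sigma> * (y - c t)}"

lemma open_side_subset: "open_side \<subseteq> side"
  by (auto simp: side_def open_side_def)

lemma open_open_side: "open open_side"
proof -
  define U where "U = {t. 0 < t \<and> ereal t < \<zeta>} \<times> J"
  have "open {t. 0 < t \<and> ereal t < \<zeta>}"
    by (intro open_Collect_conj open_Collect_less continuous_intros)
  then have "open U"
    unfolding U_def by (intro open_Times open_J)
  moreover have "continuous_on U (\<lambda>p. \<sigma> * (snd p - c (fst p)))"
    by (intro continuous_intros continuous_on_compose2[OF c_continuous continuous_on_fst[OF continuous_on_id]])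
      (auto simp: U_def)
  ultimately have "open (U \<inter> (\<lambda>p. \<sigma> * (snd p - c (fst p))) -` {0<..})"
    by (intro continuous_open_preimage) auto
  also have "U \<inter> (\<lambda>p. \<sigma> * (snd p - c (fst p))) -` {0<..} = open_side"
    by (auto simp: U_def open_side_def J_def)
  finally show ?thesis .
qed

lemma H_in_open_side:
  assumes "0 < t" "ereal t < \<zeta>" "z \<in> J" "H t z \<noteq> 0"
  shows "(t, z) \<in> open_side"
  using H_wrong_side[OF JI[OF assms(3)], of t] assms by (auto simp: open_side_def J_def not_le[symmetric])

lemma sets_avoiding_delayed: "0 \<le> h \<Longrightarrow> {p \<in> space paths. (\<lambda>u\<in>{0..}. p (h + u)) \<in> avoiding t} \<in> sets paths"
proof -
  assume h: "0 \<le> h"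
  have "(\<lambda>p. \<lambda>u\<in>{0..}. p (h + u)) \<in> measurable paths paths"
    by (rule measurable_restrict) (use h in \<open>auto intro!: measurable_component_singleton\<close>)
  from measurable_sets[OF this sets_avoiding, of t] show ?thesis
    by (simp add: vimage_def Int_def conj_commute)
qed

lemma path_from_delayed:
  assumes "0 \<le> h"
  shows "path_from X a \<omega> \<in> {p \<in> space paths. (\<lambda>u\<in>{0..}. p (h + u)) \<in> avoiding t} \<longleftrightarrow> path_from X (a + h) \<omega> \<in> avoiding t"
proof -
  have "(\<lambda>u\<in>{0..}. path_from X a \<omega> (h + u)) = path_from X (a + h) \<omega>"
    using assms by (auto simp: path_from_def fun_eq_iff add.assoc)
  then show ?thesis using path_from_space[of a \<omega>] by simp
qed

lemma nocross_eq_delayed: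
  assumes "0 \<le> h" "0 \<le> t"
  shows "nocross h t = {\<omega> \<in> space M. path_from X 0 \<omega> \<in> {p \<in> space paths. (\<lambda>u\<in>{0..}. p (h + u)) \<in> avoiding t}}"
  unfolding path_from_delayed[OF assms(1)] nocross_eq[OF assms] by simp

lemma W_measurable:
  assumes "0 \<le> h" "0 \<le> t"
  shows "(\<lambda>y. indicator I y * W t h y) \<in> borel_measurable borel"
  using borel_measurable_diff[OF kernel_indicator_measurable[OF sets_avoiding_delayed[OF assms(1), of "t + h"]] H_measurable[OF assms(2)]] assms
  by (simp add: W_def right_diff_distrib nocross_eq_delayed)

lemma W_compose_measurable:
  assumes "x \<in> I" "0 \<le> a" "0 \<le> h" "0 \<le> t"
  shows "(\<lambda>\<omega>. W t h (X a \<omega>)) \<in> borel_measurable (P x)"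
  unfolding W_def nocross_eq_delayed[OF assms(3) add_nonneg_nonneg[OF assms(4,3)]]
  by (intro borel_measurable_diff kernel_compose_measurable sets_avoiding_delayed H_compose_measurable assms)

lemma W_le_1: "y \<in> I \<Longrightarrow> W t h y \<le> 1"
  using H_bounds(1)[of y t] prob_space.prob_le_1[OF prob, of y "nocross h (t + h)"] by (auto simp: W_def)

lemma W_eq: "y \<in> I \<Longrightarrow> 0 \<le> h \<Longrightarrow> 0 \<le> t \<Longrightarrow> W t h y = (LINT \<omega>|P y. H (t + h) (X h \<omega>)) - H t y"
  by (simp add: W_def markov_nocross)

text \<open>Both events are seen from time \<open>t\<close>: the first through the path delayed by
  another \<open>h\<close>, the second directly. The Markov property then turns the increment into
  the mean of \<open>W\<close>.\<close>

lemma nocross_increment: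
  assumes x: "x \<in> I" and t: "0 \<le> t" and h: "0 \<le> h"
  shows "measure (P x) (nocross (t + h) (t + h)) - measure (P x) (nocross t t) = (LINT \<omega>|P x. W t h (X t \<omega>))"
proof -
  interpret prob_space "P x" by (rule prob[OF x])
  let ?B = "{p \<in> space paths. (\<lambda>u\<in>{0..}. p (h + u)) \<in> avoiding (t + h)}"
  have th: "0 \<le> t + h" using t h by simp
  have "measure (P x) (nocross (t + h) (t + h)) = measure (P x) {\<omega> \<in> space M. path_from X t \<omega> \<in> ?B}"
    unfolding path_from_delayed[OF h] nocross_eq[OF th th] ..
  also have "\<dots> = (LINT \<omega>|P x. measure (P (X t \<omega>)) {\<omega> \<in> space M. path_from X 0 \<omega> \<in> ?B})"
    by (rule markov[OF x t sets_avoiding_delayed[OF h]])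
  also have "\<dots> = (LINT \<omega>|P x. measure (P (X t \<omega>)) (nocross h (t + h)))"
    unfolding nocross_eq_delayed[OF h th] ..
  finally have 1: "measure (P x) (nocross (t + h) (t + h)) = (LINT \<omega>|P x. measure (P (X t \<omega>)) (nocross h (t + h)))" .
  have XI: "X t \<omega> \<in> I" if "\<omega> \<in> space (P x)" for \<omega>
    using conservative[OF t] that by (simp add: space_P[OF x])
  have "integrable (P x) (\<lambda>\<omega>. measure (P (X t \<omega>)) (nocross h (t + h)))"
    unfolding nocross_eq_delayed[OF h th]
    by (rule integrable_if_bounded[OF kernel_compose_measurable[OF sets_avoiding_delayed[OF h] x t]])
      (use prob_space.prob_le_1[OF prob[OF XI]] in \<open>auto intro!: AE_I2\<close>)
  moreover have "integrable (P x) (\<lambda>\<omega>. H t (X t \<omega>))"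
    by (rule integrable_if_bounded[OF H_compose_measurable[OF x t t]])
      (use H_bounds[OF XI] in \<open>auto intro!: AE_I2\<close>)
  ultimately show ?thesis
    unfolding 1 markov_nocross[OF x t t] W_def by simp
qed

text \<open>Within distance \<open>e\<close> of \<open>c t\<close> the factor
  \<open>1 - \<phi>\<close> vanishes; beyond it, \<open>W_small\<close> gives both the pointwise
  \<open>o(h)\<close> and the bound \<open>C * h\<close> that dominated convergence asks
  for.\<close>

lemma far_increment_small:
  assumes x: "x \<in> I" and t: "0 < t" "ereal t < \<zeta>" and e: "0 < e" "c t - e \<in> J"
    and \<phi>: "\<phi> \<in> borel_measurable borel" "\<And>y. 0 \<le> \<phi> y" "\<And>y. \<phi> y \<le> 1" "\<And>y. \<bar>y - c t\<bar> \<le> e \<Longrightarrow> \<phi> y = 1"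
  shows "((\<lambda>h. (LINT \<omega>|P x. (1 - \<phi> (X t \<omega>)) * W t h (X t \<omega>)) / h) \<longlongrightarrow> 0) (at_right 0)"
proof -
  interpret prob_space "P x" by (rule prob[OF x])
  obtain C h0 where C: "0 < h0" "0 \<le> C"
    "\<And>y h. y \<in> J \<Longrightarrow> e \<le> \<bar>y - c t\<bar> \<Longrightarrow> 0 < h \<Longrightarrow> h < h0 \<Longrightarrow> W t h y \<le> C * h"
    "\<And>y. y \<in> J \<Longrightarrow> e \<le> \<bar>y - c t\<bar> \<Longrightarrow> ((\<lambda>h. W t h y / h) \<longlongrightarrow> 0) (at_right 0)"
    by (rule W_small[OF less_imp_le[OF t(1)] t(2) e]) (rule that)
  have "((\<lambda>h. LINT \<omega>|P x. (1 - \<phi> (X t \<omega>)) * (W t h (X t \<omega>) / h)) \<longlongrightarrow> (LINT \<omega>|P x. 0)) (at_right 0)"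
  proof (rule integral_dominated_convergence_at_right[OF C(1), where w = "\<lambda>_. C"])
    show "(\<lambda>\<omega>. (1 - \<phi> (X t \<omega>)) * (W t h (X t \<omega>) / h)) \<in> borel_measurable (P x)" if "0 < h" "h < h0" for h
      using W_compose_measurable[OF x, of t h t] measurable_compose[OF X_measurable_P[OF x, of t] \<phi>(1)] t that
      by (intro borel_measurable_times borel_measurable_diff borel_measurable_divide) auto
    show "AE \<omega> in P x. ((\<lambda>h. (1 - \<phi> (X t \<omega>)) * (W t h (X t \<omega>) / h)) \<longlongrightarrow> 0) (at_right 0)"
      using AE_X_in_J[OF t(1) x]
    proof eventually_elim
      case (elim \<omega>)
      show ?case
      proof (cases "\<bar>X t \<omega> - c t\<bar> \<le> e")
        case True
        then show ?thesis using \<phi>(4) by simp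
      next
        case False
        then show ?thesis
          by (intro tendsto_mult_right_zero C(4) elim) simp
      qed
    qed
    show "AE \<omega> in P x. \<bar>(1 - \<phi> (X t \<omega>)) * (W t h (X t \<omega>) / h)\<bar> \<le> C" if h: "0 < h" "h < h0" for h
      using AE_X_in_J[OF t(1) x]
    proof eventually_elim
      case (elim \<omega>)
      show ?case
      proof (cases "\<bar>X t \<omega> - c t\<bar> \<le> e")
        case True
        then show ?thesis using \<phi>(4) C(2) by simp
      next
        case False
        then have "W t h (X t \<omega>) \<le> C * h"
          by (intro C(3) elim h) simp
        then have "0 \<le> W t h (X t \<omega>) / h" "W t h (X t \<omega>) / h \<le> C"
          using W_nonneg[OF JI[OF elim], of t h] t h by (auto simp: field_simps)
        then have "\<bar>1 - \<phi> (X t \<omega>)\<bar> * \<bar>W t h (X t \<omega>) / h\<bar> \<le> 1 * C"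
          using \<phi>(2,3)[of "X t \<omega>"] by (intro mult_mono) auto
        then show ?thesis by (simp add: abs_mult)
      qed
    qed
  qed auto
  moreover have "(LINT \<omega>|P x. (1 - \<phi> (X t \<omega>)) * (W t h (X t \<omega>) / h)) = (LINT \<omega>|P x. (1 - \<phi> (X t \<omega>)) * W t h (X t \<omega>)) / h" for h
    by simp
  ultimately show ?thesis by simp
qed

section \<open>The distribution function of the last passage time\<close>

lemma nocross_diag: "nocross t t = {\<omega> \<in> space M. \<forall>v\<ge>t. ereal v < \<zeta> \<longrightarrow> X v \<omega> \<noteq> c v}"
proof -
  have "(\<forall>u\<ge>0. ereal (t + u) < \<zeta> \<longrightarrow> X (t + u) \<omega> \<noteq> c (t + u)) \<longleftrightarrow> (\<forall>v\<ge>t. ereal v < \<zeta> \<longrightarrow> X v \<omega> \<noteq> c v)" for \<omega>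
    by (metis add.commute diff_add_cancel diff_ge_0_iff_ge le_add_same_cancel1)
  then show ?thesis by (simp add: nocross_def)
qed

lemma nocross_prob_mono:
  assumes "x \<in> I" "0 \<le> t" "t \<le> r"
  shows "measure (P x) (nocross t t) \<le> measure (P x) (nocross r r)"
  using nocross_measurable[OF assms(1), of r r] assms
  by (intro finite_measure.finite_measure_mono prob_space.finite_measure[OF prob]) (auto simp: nocross_diag)

text \<open>A path off the boundary at time \<open>t\<close> is off it on a neighbourhood, so
  avoiding it from \<open>t\<close> on amounts to avoiding it from slightly earlier on. Right
  continuity will come from the right derivative.\<close>

lemma nocross_prob_left_continuous:
  assumes x: "x \<in> I" and t: "0 < t" "ereal t < \<zeta>"
  shows "((\<lambda>r. measure (P x) (nocross r r)) \<longlongrightarrow> measure (P x) (nocross t t)) (at_left t)"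
proof (rule tendsto_at_left_sequentially[OF t(1)])
  interpret prob_space "P x" by (rule prob[OF x])
  fix S :: "nat \<Rightarrow> real"
  assume S: "\<And>n. S n < t" "\<And>n. 0 < S n" "S \<longlonglongrightarrow> t"
  show "(\<lambda>n. prob (nocross (S n) (S n))) \<longlonglongrightarrow> prob (nocross t t)"
  proof (rule prob_tendsto)
    show "nocross (S n) (S n) \<in> events" for n
      using S(2)[of n] by (intro nocross_measurable x) auto
    show "nocross t t \<in> events"
      using t by (intro nocross_measurable x) auto
    show "AE \<omega> in P x. eventually (\<lambda>n. \<omega> \<in> nocross (S n) (S n) \<longleftrightarrow> \<omega> \<in> nocross t t) sequentially"
    proof (rule AE_I2)
      fix \<omega> assume "\<omega> \<in> space (P x)"
      then have w: "\<omega> \<in> space M" by (simp add: space_P[OF x])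
      show "eventually (\<lambda>n. \<omega> \<in> nocross (S n) (S n) \<longleftrightarrow> \<omega> \<in> nocross t t) sequentially"
      proof (cases "\<omega> \<in> nocross t t")
        case True
        then have ne: "X t \<omega> - c t \<noteq> 0" using t by (auto simp: nocross_diag)
        have "continuous_on {0..t} (\<lambda>u. X u \<omega> - c u)"
          using gap_continuous[OF w, of 0 0 t] t by simp
        then obtain d where d: "0 < d" "\<And>r. r \<in> {0..t} \<Longrightarrow> dist r t < d \<Longrightarrow> dist (X r \<omega> - c r) (X t \<omega> - c t) < \<bar>X t \<omega> - c t\<bar>"
          using ne t(1) unfolding continuous_on_iff by (metis atLeastAtMost_iff less_imp_le order_refl zero_less_abs_iff)
        have "eventually (\<lambda>n. dist (S n) t < d) sequentially"
          by (rule tendstoD[OF S(3) d(1)])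
        then show ?thesis
        proof eventually_elim
          case (elim n)
          have "X v \<omega> \<noteq> c v" if v: "S n \<le> v" "ereal v < \<zeta>" for v
          proof (cases "t \<le> v")
            case True
            then show ?thesis using \<open>\<omega> \<in> nocross t t\<close> v by (auto simp: nocross_diag)
          next
            case False
            then have "dist (X v \<omega> - c v) (X t \<omega> - c t) < \<bar>X t \<omega> - c t\<bar>"
              using v elim S(2)[of n] by (intro d(2)) (auto simp: dist_real_def)
            then show ?thesis by (auto simp: dist_real_def)
          qed
          then have "\<omega> \<in> nocross (S n) (S n)" using w by (auto simp: nocross_diag)
          with True show ?case by simp
        qed
      next
        case False
        then obtain v where "t \<le> v" "ereal v < \<zeta>" "X v \<omega> = c v"
          using w by (auto simp: nocross_diag)
        then have "\<omega> \<notin> nocross (S n) (S n)" for n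
          using S(1)[of n] by (auto simp: nocross_diag intro!: exI[of _ v])
        with False show ?thesis by simp
      qed
    qed
  qed
qed

lemma real_of_ereal_before_zeta:
  assumes "0 < e" "e < \<zeta>"
  shows "0 < real_of_ereal e" "ereal (real_of_ereal e) = e"
  using assms by (cases e; auto)+

text \<open>A path from the wrong side has to change sides, by the intermediate value theorem at a
  strictly positive time, so a passage still lies ahead of all small times. Composition with
  \<open>real_of_ereal\<close> is the form in which the fundamental theorem with extended end points
  takes its boundary values.\<close>

lemma nocross_prob_at_zero:
  assumes x: "x \<in> I" and side: "\<sigma> * (x - c 0) < 0"
  shows "(((\<lambda>r. measure (P x) (nocross r r)) \<circ> real_of_ereal) \<longlongrightarrow> 0) (at_right 0)"
proof (rule tendsto_at_right_sequentially[OF zeta_pos])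
  interpret prob_space "P x" by (rule prob[OF x])
  fix S :: "nat \<Rightarrow> ereal"
  assume S: "\<And>n. 0 < S n" "\<And>n. S n < \<zeta>" "S \<longlonglongrightarrow> 0"
  note R = real_of_ereal_before_zeta[OF S(1,2)]
  have lim: "(\<lambda>n. real_of_ereal (S n)) \<longlonglongrightarrow> 0"
    using lim_real_of_ereal[of S 0 sequentially] S(3) by (simp add: zero_ereal_def)
  have "(\<lambda>n. prob (nocross (real_of_ereal (S n)) (real_of_ereal (S n)))) \<longlonglongrightarrow> prob {}"
  proof (rule prob_tendsto)
    show "nocross (real_of_ereal (S n)) (real_of_ereal (S n)) \<in> events" for n
      using R(1)[of n] by (intro nocross_measurable x) auto
    show "AE \<omega> in P x. eventually (\<lambda>n. \<omega> \<in> nocross (real_of_ereal (S n)) (real_of_ereal (S n)) \<longleftrightarrow> \<omega> \<in> {}) sequentially"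
      using AE_start[OF x] eventually_on_side[OF x]
    proof eventually_elim
      case (elim \<omega>)
      then have w: "\<omega> \<in> space M" "X 0 \<omega> = x" by auto
      obtain T where T: "ereal T < \<zeta>" "\<And>u. T \<le> u \<Longrightarrow> ereal u < \<zeta> \<Longrightarrow> 0 < \<sigma> * (X u \<omega> - c u)"
        using elim by blast
      define T' where "T' = max T 0"
      have T': "0 \<le> T'" "ereal T' < \<zeta>" "0 < \<sigma> * (X T' \<omega> - c T')"
        using T zeta_pos by (auto simp: T'_def max_def zero_ereal_def)
      have "continuous_on {0..T'} (\<lambda>u. \<sigma> * (X u \<omega> - c u))"
        using gap_continuous[OF w(1), of 0 0 T'] T' by (intro continuous_on_mult_left) auto
      then obtain v where v: "0 \<le> v" "v \<le> T'" "\<sigma> * (X v \<omega> - c v) = 0"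
        using IVT'[of "\<lambda>u. \<sigma> * (X u \<omega> - c u)" 0 0 T'] T' side w(2) by auto
      then have "v \<noteq> 0" using side w(2) by auto
      then have "eventually (\<lambda>n. real_of_ereal (S n) < v) sequentially"
        using v(1) by (intro order_tendstoD(2)[OF lim]) auto
      then show ?case
      proof eventually_elim
        case (elim n)
        have "X v \<omega> = c v" using v(3) sigma by auto
        moreover have "ereal v < \<zeta>" by (rule less_zeta_mono[OF T'(2) v(2)])
        ultimately show ?case using elim by (auto simp: nocross_diag intro!: exI[of _ v])
      qed
    qed
  qed simp
  then show "(\<lambda>n. ((\<lambda>r. prob (nocross r r)) \<circ> real_of_ereal) (S n)) \<longlonglongrightarrow> 0"
    by simp
qed

text \<open>Almost every path has its passages bounded away from \<open>\<zeta>\<close>, by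
  \<open>eventually_on_side\<close>.\<close>

lemma nocross_prob_at_zeta:
  assumes x: "x \<in> I"
  shows "(((\<lambda>r. measure (P x) (nocross r r)) \<circ> real_of_ereal) \<longlongrightarrow> 1) (at_left \<zeta>)"
proof (rule tendsto_at_left_sequentially[OF zeta_pos])
  interpret prob_space "P x" by (rule prob[OF x])
  fix S :: "nat \<Rightarrow> ereal"
  assume S: "\<And>n. S n < \<zeta>" "\<And>n. 0 < S n" "S \<longlonglongrightarrow> \<zeta>"
  note R = real_of_ereal_before_zeta[OF S(2,1)]
  have "(\<lambda>n. prob (nocross (real_of_ereal (S n)) (real_of_ereal (S n)))) \<longlonglongrightarrow> prob (space (P x))"
  proof (rule prob_tendsto)
    show "nocross (real_of_ereal (S n)) (real_of_ereal (S n)) \<in> events" for n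
      using R(1)[of n] by (intro nocross_measurable x) auto
    show "AE \<omega> in P x. eventually (\<lambda>n. \<omega> \<in> nocross (real_of_ereal (S n)) (real_of_ereal (S n)) \<longleftrightarrow> \<omega> \<in> space (P x)) sequentially"
      using AE_start[OF x] eventually_on_side[OF x]
    proof eventually_elim
      case (elim \<omega>)
      then have w: "\<omega> \<in> space M" by auto
      obtain T where T: "ereal T < \<zeta>" "\<And>u. T \<le> u \<Longrightarrow> ereal u < \<zeta> \<Longrightarrow> 0 < \<sigma> * (X u \<omega> - c u)"
        using elim by blast
      have "eventually (\<lambda>n. ereal T < S n) sequentially"
        by (rule order_tendstoD(1)[OF S(3) T(1)])
      then show ?case
      proof eventually_elim
        case (elim n)
        then have "T < real_of_ereal (S n)" using R(2)[of n] by (metis less_ereal.simps(1))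
        then have "X v \<omega> \<noteq> c v" if "real_of_ereal (S n) \<le> v" "ereal v < \<zeta>" for v
          using T(2)[of v] that by auto
        then have "\<omega> \<in> nocross (real_of_ereal (S n)) (real_of_ereal (S n))"
          using w by (simp add: nocross_diag)
        then show ?case using w by (simp add: space_P[OF x])
      qed
    qed
  qed simp
  then show "(\<lambda>n. ((\<lambda>r. prob (nocross r r)) \<circ> real_of_ereal) (S n)) \<longlonglongrightarrow> 1"
    by (simp add: prob_space)
qed

end

text \<open>The derivatives are named functions, and their values on the boundary are those of the
  continuous extensions; \<open>hy t (c t)\<close> is later recognised as the one-sided
  derivative.\<close>

locale smooth_boundary = moving_boundary l I M P X s \<rho> q \<zeta> c \<sigma>
  for l :: ereal and I :: "real set" and M :: "'w measure" and P :: "real \<Rightarrow> 'w measure"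
    and X :: "real \<Rightarrow> 'w \<Rightarrow> real" and s \<rho> :: "real \<Rightarrow> real" and q :: "real \<Rightarrow> real \<Rightarrow> real \<Rightarrow> real"
    and \<zeta> :: ereal and c :: "real \<Rightarrow> real" and \<sigma> :: real +
  fixes ht hy hyy :: "real \<Rightarrow> real \<Rightarrow> real"
  assumes H_cont: "continuous_on side (\<lambda>(t, y). H t y)"
    and ht_cont: "continuous_on side (\<lambda>(t, y). ht t y)"
    and hy_cont: "continuous_on side (\<lambda>(t, y). hy t y)"
    and hyy_cont: "continuous_on side (\<lambda>(t, y). hyy t y)"
    and ht: "\<And>t y. (t, y) \<in> open_side \<Longrightarrow> DERIV (\<lambda>r. H r y) t :> ht t y"
    and hy: "\<And>t y. (t, y) \<in> open_side \<Longrightarrow> DERIV (\<lambda>z. H t z) y :> hy t y"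
    and hyy: "\<And>t y. (t, y) \<in> open_side \<Longrightarrow> DERIV (\<lambda>z. hy t z) y :> hyy t y"
begin

lemma side_section_continuous:
  assumes F: "continuous_on side (\<lambda>(t, y). F t y)" and "0 < t" "ereal t < \<zeta>"
  shows "continuous_on {z. l < ereal z \<and> 0 \<le> \<sigma> * (z - c t)} (\<lambda>z. F t z)"
proof -
  let ?S = "{z. l < ereal z \<and> 0 \<le> \<sigma> * (z - c t)}"
  have "Pair t ` ?S \<subseteq> side" using assms(2,3) by (auto simp: side_def)
  from continuous_on_compose2[OF F continuous_on_Pair[OF continuous_on_const[of ?S t] continuous_on_id] this]
  show ?thesis by simp
qed

text \<open>The backward equation: \<open>H\<close> is space-time harmonic up to the passage time, and a passage within
  a short time \<open>h\<close> has probability \<open>o(h)\<close> away from the boundary.\<close>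

lemma backward_equation:
  assumes ty: "(t, y) \<in> open_side"
  shows "ht t y + gen y (hy t y) (hyy t y) = 0"
proof -
  have t: "0 < t" "0 \<le> t" "ereal t < \<zeta>" and y: "y \<in> J" and away: "0 < \<sigma> * (y - c t)"
    using ty by (auto simp: open_side_def J_def)
  have yI: "y \<in> I" by (rule JI[OF y])
  interpret prob_space "P y" by (rule prob[OF yI])
  obtain r0 where r0: "0 < r0" "ball (t, y) r0 \<subseteq> open_side"
    using open_open_side ty by (meson open_contains_ball)
  \<comment> \<open>The box of half-widths \<open>e\<close> in time and \<open>2 * e\<close> in
    space lies in the ball, as \<open>e + 2 * e < r0\<close>.\<close>
  define e where "e = r0 / 4"
  have e: "0 < e" using r0 by (simp add: e_def)
  have box: "(r, z) \<in> open_side" if "\<bar>r - t\<bar> \<le> e" "\<bar>z - y\<bar> \<le> 2 * e" for r z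
  proof -
    have "dist (t, y) (r, z) \<le> \<bar>r - t\<bar> + \<bar>z - y\<bar>"
      by (simp add: dist_Pair_Pair dist_real_def abs_minus_commute sqrt_sum_squares_le_sum_abs[of "t - r" "y - z", simplified] order_trans[OF sqrt_sum_squares_le_sum_abs])
    also have "\<dots> < r0" using that r0 by (simp add: e_def)
    finally show ?thesis using r0(2) by auto
  qed
  have yJ: "y - 2 * e \<in> J" using box[of t "y - 2 * e"] e by (auto simp: open_side_def J_def)
  obtain \<eta> \<eta>1 \<eta>2 where \<eta>: "C2_supp (y - 2 * e) (y + 2 * e) \<eta> \<eta>1 \<eta>2" "\<And>w. 0 \<le> \<eta> w" "\<And>w. \<eta> w \<le> 1"
    "\<And>w. w \<in> {y - e..y + e} \<Longrightarrow> \<eta> w = 1 \<and> \<eta>1 w = 0 \<and> \<eta>2 w = 0"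
    by (rule C2_supp_bump[of "y - 2 * e" "y - e" "y + e" "y + 2 * e"]) (use e in auto)
  have \<eta>y: "\<eta> y = 1" "\<eta>1 y = 0" "\<eta>2 y = 0" using \<eta>(4)[of y] e by auto
  have \<eta>_supp: "\<bar>w - y\<bar> \<le> 2 * e" if "\<eta> w \<noteq> 0" for w
  proof -
    have "w \<in> {y - 2 * e<..<y + 2 * e}" using that \<eta>(1) unfolding C2_supp_def by blast
    then show ?thesis by (simp add: abs_le_iff)
  qed
  have \<eta>_meas: "\<eta> \<in> borel_measurable borel"
    by (intro borel_measurable_continuous_onI continuous_test[OF \<eta>(1)])
  define U where "U = {z. (t, z) \<in> open_side}"
  have "open U"
    unfolding U_def using open_open_side continuous_open_vimage[of open_side "\<lambda>z. (t, z)"]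
    by (auto simp: vimage_def intro: continuous_intros)
  moreover have "{y - 2 * e..y + 2 * e} \<subseteq> U"
    using box e by (auto simp: U_def abs_le_iff)
  moreover have "continuous_on U (hyy t)"
    by (rule continuous_on_subset[OF side_section_continuous[OF hyy_cont t(1,3)]]) (auto simp: U_def open_side_def)
  ultimately have v: "C2_supp (y - 2 * e) (y + 2 * e) (\<lambda>z. H t z * \<eta> z) (\<lambda>z. hy t z * \<eta> z + H t z * \<eta>1 z)
    (\<lambda>z. hyy t z * \<eta> z + 2 * (hy t z * \<eta>1 z) + H t z * \<eta>2 z)"
    by (intro C2_supp_mult[OF \<eta>(1)] hy hyy) (auto simp: U_def)
  have X: "X h \<in> borel_measurable (P y)" if "0 < h" for h using X_measurable_P[OF yI] that by simp
  have XI: "X h \<omega> \<in> I" if "0 < h" "\<omega> \<in> space (P y)" for h \<omega>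
    using conservative[of h \<omega>] that by (simp add: space_P[OF yI])
  have Hm: "(\<lambda>\<omega>. H r (X h \<omega>)) \<in> borel_measurable (P y)" if "0 \<le> r" "0 < h" for r h
    using H_compose_measurable[OF yI] that by simp
  have Cm: "(\<lambda>\<omega>. \<eta> (X h \<omega>)) \<in> borel_measurable (P y)" if "0 < h" for h
    by (rule measurable_compose[OF X[OF that] \<eta>_meas])
  \<comment> \<open>\<open>W t h y / h\<close> splits into three parts: \<open>A\<close> collects
    positions away from \<open>y\<close>, \<open>B\<close> is the increment of \<open>H\<close> in
    time, and \<open>V\<close> gives the increment in space for the fixed test function
    \<open>H t z * \<eta> z\<close>, to which the limit formula for test functions applies.\<close>
  define A where "A h = (LINT \<omega>|P y. H (t + h) (X h \<omega>) * (1 - \<eta> (X h \<omega>)))" for h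
  define B where "B h = (LINT \<omega>|P y. (H (t + h) (X h \<omega>) - H t (X h \<omega>)) * \<eta> (X h \<omega>) / h)" for h
  define V where "V h = (LINT \<omega>|P y. H t (X h \<omega>) * \<eta> (X h \<omega>))" for h
  have int: "integrable (P y) (\<lambda>\<omega>. H r (X h \<omega>) * \<eta> (X h \<omega>))" "integrable (P y) (\<lambda>\<omega>. H r (X h \<omega>) * (1 - \<eta> (X h \<omega>)))"
    "integrable (P y) (\<lambda>\<omega>. \<eta> (X h \<omega>))"
    if "0 \<le> r" "0 < h" for r h
    using \<eta>(2,3) H_bounds[OF XI[OF that(2)]]
    by (auto intro!: integrable_if_bounded[where C = 1] AE_I2 borel_measurable_times borel_measurable_diff Hm Cm that mult_le_one simp: abs_mult)
  have split: "W t h y / h = A h / h + B h + (V h - H t y * \<eta> y) / h" if h: "0 < h" for h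
  proof -
    have "B h = ((LINT \<omega>|P y. H (t + h) (X h \<omega>) * \<eta> (X h \<omega>)) - V h) / h"
      unfolding B_def V_def using int(1)[OF _ h, of "t + h"] int(1)[OF t(2) h] t h
      by (simp add: left_diff_distrib)
    moreover have "(LINT \<omega>|P y. H (t + h) (X h \<omega>)) = A h + (LINT \<omega>|P y. H (t + h) (X h \<omega>) * \<eta> (X h \<omega>))"
      unfolding A_def using int(1,2)[OF _ h, of "t + h"] t h
      by (subst Bochner_Integration.integral_add[symmetric]) (auto simp: algebra_simps)
    ultimately show ?thesis
      using h t \<eta>y by (simp add: W_eq[OF yI] add_divide_distrib diff_divide_distrib)
  qed
  \<comment> \<open>\<open>e2\<close> is small enough for \<open>y\<close> to count as away from
    \<open>c t\<close> and for \<open>c t - e2\<close> to remain in \<open>J\<close>.\<close>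
  have lim_W: "((\<lambda>h. W t h y / h) \<longlongrightarrow> 0) (at_right 0)"
  proof -
    obtain e1 where e1: "0 < e1" "c t - e1 \<in> J" by (rule ball_J[OF c_in_J[OF t(2,3)]])
    define e2 where "e2 = min e1 \<bar>y - c t\<bar>"
    have "0 < e2" using e1 away by (auto simp: e2_def)
    moreover have "c t - e2 \<in> J" using J_upward[OF e1(2), of "c t - e2"] by (simp add: e2_def)
    ultimately show ?thesis
      by (rule W_small[OF t(2,3)]) (use y in \<open>auto simp: e2_def\<close>)
  qed
  have lim_V: "((\<lambda>h. (V h - H t y * \<eta> y) / h) \<longlongrightarrow> gen y (hy t y) (hyy t y)) (at_right 0)"
    using expectation_test_limit[OF v yJ y] by (simp add: V_def \<eta>y)
  \<comment> \<open>As \<open>H\<close> is at most 1, this part is dominated by one minus the mean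
    of \<open>\<eta>\<close>, which is \<open>o(h)\<close> because the generator of
    \<open>\<eta>\<close> vanishes at \<open>y\<close>.\<close>
  have lim_A: "((\<lambda>h. A h / h) \<longlongrightarrow> 0) (at_right 0)"
  proof (rule tendsto_sandwich[OF _ _ tendsto_const])
    have "((\<lambda>h. - (((LINT \<omega>|P y. \<eta> (X h \<omega>)) - \<eta> y) / h)) \<longlongrightarrow> - gen y (\<eta>1 y) (\<eta>2 y)) (at_right 0)"
      by (intro tendsto_intros expectation_test_limit[OF \<eta>(1) yJ y])
    then show "((\<lambda>h. (1 - (LINT \<omega>|P y. \<eta> (X h \<omega>))) / h) \<longlongrightarrow> 0) (at_right 0)"
      by (simp add: \<eta>y gen_def diff_divide_distrib)
    show "eventually (\<lambda>h. 0 \<le> A h / h) (at_right 0)"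
      using eventually_at_right_0_real[OF zero_less_one]
    proof eventually_elim
      case (elim h)
      then have "0 \<le> A h"
        unfolding A_def using \<eta>(3) H_bounds[OF XI] by (intro Bochner_Integration.integral_nonneg mult_nonneg_nonneg) auto
      with elim show ?case by simp
    qed
    show "eventually (\<lambda>h. A h / h \<le> (1 - (LINT \<omega>|P y. \<eta> (X h \<omega>))) / h) (at_right 0)"
      using eventually_at_right_0_real[OF zero_less_one]
    proof eventually_elim
      case (elim h)
      then have h: "0 < h" by simp
      have "A h \<le> (LINT \<omega>|P y. 1 - \<eta> (X h \<omega>))"
        unfolding A_def
      proof (rule integral_mono)
        show "H (t + h) (X h \<omega>) * (1 - \<eta> (X h \<omega>)) \<le> 1 - \<eta> (X h \<omega>)" if "\<omega> \<in> space (P y)" for \<omega>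
          using \<eta>(3)[of "X h \<omega>"] H_bounds[OF XI[OF h that]] by (intro mult_left_le_one_le) auto
      qed (use int(2)[OF _ h, of "t + h"] int(3)[OF t(2) h] t h in auto)
      also have "\<dots> = 1 - (LINT \<omega>|P y. \<eta> (X h \<omega>))"
        using int(3)[OF t(2) h] by (simp add: prob_space)
      finally show ?case using h by (simp add: divide_right_mono)
    qed
  qed
  \<comment> \<open>Replaces the time increment by \<open>ht\<close> at an intermediate time, which
    gives both the bound and the limit for \<open>B\<close>.\<close>
  have mvt: "\<exists>r. t < r \<and> r < t + h \<and> H (t + h) z - H t z = h * ht r z"
    if h: "0 < h" "h < e" and z: "\<bar>z - y\<bar> \<le> 2 * e" for h z
  proof -
    have "DERIV (\<lambda>r. H r z) r :> ht r z" if "t \<le> r" "r \<le> t + h" for r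
      using that h z by (intro ht box) auto
    then show ?thesis
      using MVT2[of t "t + h" "\<lambda>r. H r z" "\<lambda>r. ht r z"] h by auto
  qed
  have lim_B: "(B \<longlongrightarrow> ht t y) (at_right 0)"
  proof -
    let ?K = "{t - e..t + e} \<times> {y - 2 * e..y + 2 * e}"
    have K_sub: "?K \<subseteq> open_side" using box by (auto simp: abs_le_iff)
    have "continuous_on ?K (\<lambda>p. case p of (t, y) \<Rightarrow> ht t y)"
      by (rule continuous_on_subset[OF ht_cont]) (use K_sub open_side_subset in blast)
    then have "bounded ((\<lambda>p. case p of (t, y) \<Rightarrow> ht t y) ` ?K)"
      by (intro compact_imp_bounded compact_continuous_image compact_Times) auto
    then obtain C where C: "\<forall>p\<in>?K. \<bar>case p of (t, y) \<Rightarrow> ht t y\<bar> \<le> C"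
      by (auto simp: bounded_iff)
    have C0: "0 \<le> C" using bspec[OF C, of "(t, y)"] e by auto
    have bound: "\<bar>(H (t + h) z - H t z) * \<eta> z / h\<bar> \<le> C" if h: "0 < h" "h < e" for h z
    proof (cases "\<eta> z = 0")
      case False
      then have z: "\<bar>z - y\<bar> \<le> 2 * e" by (rule \<eta>_supp)
      obtain r where r: "t < r" "r < t + h" "H (t + h) z - H t z = h * ht r z" using mvt[OF h z] by blast
      have "(r, z) \<in> ?K" using r h z by (auto simp: abs_le_iff)
      then have "\<bar>ht r z\<bar> \<le> C" using C by fastforce
      then have "\<bar>ht r z\<bar> * \<bar>\<eta> z\<bar> \<le> C * 1" using \<eta>(2,3)[of z] by (intro mult_mono) auto
      then show ?thesis using r h by (simp add: abs_mult)
    qed (use C0 in simp)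
    have "((\<lambda>h. LINT \<omega>|P y. (H (t + h) (X h \<omega>) - H t (X h \<omega>)) * \<eta> (X h \<omega>) / h) \<longlongrightarrow> (LINT \<omega>|P y. ht t y)) (at_right 0)"
    proof (rule integral_dominated_convergence_at_right[OF e, where w = "\<lambda>_. C"])
      show "(\<lambda>\<omega>. (H (t + h) (X h \<omega>) - H t (X h \<omega>)) * \<eta> (X h \<omega>) / h) \<in> borel_measurable (P y)" if "0 < h" for h
        using t that by (intro borel_measurable_divide borel_measurable_times borel_measurable_diff Hm Cm) auto
      show "AE \<omega> in P y. \<bar>(H (t + h) (X h \<omega>) - H t (X h \<omega>)) * \<eta> (X h \<omega>) / h\<bar> \<le> C" if "0 < h" "h < e" for h
        using bound[OF that] by simp
      show "AE \<omega> in P y. ((\<lambda>h. (H (t + h) (X h \<omega>) - H t (X h \<omega>)) * \<eta> (X h \<omega>) / h) \<longlongrightarrow> ht t y) (at_right 0)"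
        using AE_X_tendsto[OF yI]
      proof eventually_elim
        case (elim \<omega>)
        show ?case
        proof (rule tendstoI)
          fix d :: real assume d: "0 < d"
          have "(t, y) \<in> side" using ty open_side_subset by auto
          then obtain d1 where d1: "0 < d1" "\<And>p. p \<in> side \<Longrightarrow> dist p (t, y) < d1 \<Longrightarrow> dist (case p of (t, y) \<Rightarrow> ht t y) (ht t y) < d"
            using ht_cont d unfolding continuous_on_iff by (metis (no_types, lifting) case_prod_conv)
          define d2 where "d2 = min e (d1 / 2)"
          have d2: "0 < d2" using e d1 by (simp add: d2_def)
          have "eventually (\<lambda>h. dist (X h \<omega>) y < d2) (at_right 0)"
            using tendstoD[OF elim d2] .
          then show "eventually (\<lambda>h. dist ((H (t + h) (X h \<omega>) - H t (X h \<omega>)) * \<eta> (X h \<omega>) / h) (ht t y) < d) (at_right 0)"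
            using eventually_at_right_0_real[OF d2]
          proof eventually_elim
            case (elim h)
            then have h: "0 < h" "h < e" and z: "\<bar>X h \<omega> - y\<bar> < e" by (auto simp: d2_def dist_real_def)
            have z2: "\<bar>X h \<omega> - y\<bar> \<le> 2 * e" using z e by linarith
            obtain r where r: "t < r" "r < t + h" "H (t + h) (X h \<omega>) - H t (X h \<omega>) = h * ht r (X h \<omega>)"
              using mvt[OF h z2] by blast
            have "\<eta> (X h \<omega>) = 1" using \<eta>(4)[of "X h \<omega>"] z by (auto simp: abs_less_iff)
            then have "(H (t + h) (X h \<omega>) - H t (X h \<omega>)) * \<eta> (X h \<omega>) / h = ht r (X h \<omega>)"
              using r h by simp
            moreover have "(r, X h \<omega>) \<in> side"
              using box[OF _ z2, of r] r h open_side_subset by auto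
            moreover have "dist (r, X h \<omega>) (t, y) < d1"
            proof -
              have "dist (r, X h \<omega>) (t, y) \<le> \<bar>r - t\<bar> + \<bar>X h \<omega> - y\<bar>"
                by (simp add: dist_Pair_Pair dist_real_def order_trans[OF sqrt_sum_squares_le_sum_abs])
              also have "\<dots> < d1"
                using elim r by (auto simp: d2_def dist_real_def)
              finally show ?thesis .
            qed
            ultimately show ?case using d1(2)[of "(r, X h \<omega>)"] by simp
          qed
        qed
      qed
    qed auto
    then show ?thesis by (simp add: B_def[abs_def] prob_space)
  qed
  have "((\<lambda>h. A h / h + B h + (V h - H t y * \<eta> y) / h) \<longlongrightarrow> 0 + ht t y + gen y (hy t y) (hyy t y)) (at_right 0)"
    by (intro tendsto_intros lim_A lim_B lim_V)
  moreover have "eventually (\<lambda>h. W t h y / h = A h / h + B h + (V h - H t y * \<eta> y) / h) (at_right 0)"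
    using eventually_at_right_0_real[OF zero_less_one] by eventually_elim (use split in auto)
  ultimately have "((\<lambda>h. W t h y / h) \<longlongrightarrow> 0 + ht t y + gen y (hy t y) (hyy t y)) (at_right 0)"
    by (simp add: tendsto_cong)
  from tendsto_unique[OF trivial_limit_at_right_real this lim_W] show ?thesis by simp
qed

text \<open>While \<open>z\<close> is on the smooth side, \<open>ht\<close> is bounded on the
  compact set \<open>S\<close>; on the wrong side \<open>H\<close> is zero. The boundary may cross
  the level \<open>z\<close> many times during \<open>{t..t + h}\<close>, which is why
  \<open>lipschitz_off_zeros\<close> replaces the mean value theorem.\<close>

lemma H_lipschitz_in_time:
  assumes t: "0 < t" "ereal (t + h0) < \<zeta>" and a: "a \<in> J"
  obtains C where "0 \<le> C"
    "\<And>h z. 0 < h \<Longrightarrow> h < h0 \<Longrightarrow> z \<in> {a..b} \<Longrightarrow> \<bar>H (t + h) z - H t z\<bar> \<le> C * h"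
proof -
  let ?R = "{t..t + h0} \<times> {a..b}"
  define S where "S = {p \<in> ?R. 0 \<le> \<sigma> * (snd p - c (fst p))}"
  have c_cont: "continuous_on {t..t + h0} c"
    using t by (intro c_continuous_Icc) auto
  have "continuous_on ?R (\<lambda>p. \<sigma> * (snd p - c (fst p)))"
    by (intro continuous_intros continuous_on_compose2[OF c_cont continuous_on_fst[OF continuous_on_id]]) auto
  moreover have "compact ?R" by (intro compact_Times) auto
  ultimately have "closed (?R \<inter> (\<lambda>p. \<sigma> * (snd p - c (fst p))) -` {0..})"
    by (intro continuous_closed_preimage) (auto intro: compact_imp_closed)
  then have "closed S"
    unfolding S_def by (simp add: vimage_def Int_def)
  moreover have "bounded S"
    by (rule bounded_subset[OF compact_imp_bounded[OF \<open>compact ?R\<close>]]) (auto simp: S_def)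
  ultimately have "compact S" by (simp add: compact_eq_bounded_closed)
  have "S \<subseteq> side"
    using t less_zeta_mono[OF t(2)] J_Icc[OF a, of b] by (auto simp: S_def side_def J_def)
  then have "continuous_on S (\<lambda>(t, y). ht t y)"
    by (rule continuous_on_subset[OF ht_cont])
  then have "bounded ((\<lambda>(t, y). ht t y) ` S)"
    using \<open>compact S\<close> by (intro compact_imp_bounded compact_continuous_image)
  then obtain C where C: "\<forall>p\<in>S. \<bar>case p of (t, y) \<Rightarrow> ht t y\<bar> \<le> C"
    by (auto simp: bounded_iff)
  show ?thesis
  proof (rule that[of "max 0 C"])
    fix h z assume h: "0 < h" "h < h0" and z: "z \<in> {a..b}"
    have zJ: "z \<in> J" using subsetD[OF J_Icc[OF a] z] .
    have r: "0 < r" "ereal r < \<zeta>" if "r \<in> {t..t + h}" for r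
      using that t h less_zeta_mono[OF t(2), of r] by auto
    have c_h: "continuous_on {t..t + h} (\<lambda>r. \<sigma> * (z - c r))"
      using h by (intro continuous_intros continuous_on_subset[OF c_cont]) auto
    define S1 where "S1 = {r \<in> {t..t + h}. 0 \<le> \<sigma> * (z - c r)}"
    define S2 where "S2 = {r \<in> {t..t + h}. \<sigma> * (z - c r) \<le> 0}"
    have "continuous_on (S1 \<union> S2) (\<lambda>r. H r z)"
    proof (rule continuous_on_closed_Un)
      have "closed ({t..t + h} \<inter> (\<lambda>r. \<sigma> * (z - c r)) -` {0..})" "closed ({t..t + h} \<inter> (\<lambda>r. \<sigma> * (z - c r)) -` {..0})"
        by (intro continuous_closed_preimage c_h; simp)+
      then show "closed S1" "closed S2"
        by (simp_all add: S1_def S2_def vimage_def Int_def)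
      have "(\<lambda>r. (r, z)) ` S1 \<subseteq> side"
        using r zJ by (auto simp: S1_def side_def J_def)
      from continuous_on_compose2[OF H_cont continuous_on_Pair[OF continuous_on_id continuous_on_const] this]
      show "continuous_on S1 (\<lambda>r. H r z)" by simp
      have "H r' z = 0" if "r' \<in> S2" for r'
        using H_wrong_side[OF JI[OF zJ] less_imp_le[OF r(1)[of r']] r(2)[of r']] that by (simp add: S2_def)
      then show "continuous_on S2 (\<lambda>r. H r z)"
        by (intro continuous_on_eq[OF continuous_on_const[of S2 0]]) simp
    qed
    moreover have "S1 \<union> S2 = {t..t + h}" by (auto simp: S1_def S2_def)
    ultimately have cont: "continuous_on {t..t + h} (\<lambda>r. H r z)" by simp
    have "\<bar>H (t + h) z - H t z\<bar> \<le> max 0 C * (t + h - t)"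
    proof (rule lipschitz_off_zeros[where k = "\<lambda>r. H r z", OF _ _ cont])
      fix r' assume r': "t < r'" "r' < t + h" "H r' z \<noteq> 0"
      then have in_side: "(r', z) \<in> open_side"
        using r[of r'] zJ by (intro H_in_open_side) auto
      then have "(r', z) \<in> S"
        using r' h z by (auto simp: S_def open_side_def)
      then have "\<bar>ht r' z\<bar> \<le> max 0 C" using C by fastforce
      with ht[OF in_side] show "\<exists>D. DERIV (\<lambda>r. H r z) r' :> D \<and> \<bar>D\<bar> \<le> max 0 C" by blast
    qed (use h in auto)
    then show "\<bar>H (t + h) z - H t z\<bar> \<le> max 0 C * h" by simp
  qed simp
qed

text \<open>Green's identity on the smooth side of the boundary. At \<open>c t\<close> the term with
  the derivative of \<open>g\<close> dies because \<open>H t (c t) = 0\<close>, and the term with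
  \<open>hy\<close> survives; at the far end \<open>g\<close> and \<open>g1\<close> vanish. The
  backward equation replaces the generator of \<open>H\<close> by \<open>- ht\<close>. The value
  \<open>L (c t)\<close> is left open, as a single point does not affect the integral.\<close>

lemma green_at_boundary:
  assumes t: "0 < t" "ereal t < \<zeta>" and a: "a \<in> J" "a < c t" "c t < b"
    and g: "C2_supp a b g g1 g2"
  obtains L where "L \<in> borel_measurable lborel"
    "\<And>z. z \<noteq> c t \<Longrightarrow> L z = indicator {z. 0 < \<sigma> * (z - c t)} z * (\<rho> z * (H t z * gen z (g1 z) (g2 z) + g z * ht t z))"
    "(LINT z|lborel. L z) = \<sigma> * g (c t) * hy t (c t) / deriv s (c t)"
proof -
  define f where "f z = \<rho> z * (H t z * gen z (g1 z) (g2 z) + g z * ht t z)" for z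
  define S where "S = (if \<sigma> = 1 then {c t..b} else {a..c t})"
  obtain a' b' where S: "S = {a'..b'}" "a' < b'" "a \<le> a'" "b' \<le> b"
    and ends: "\<sigma> = 1 \<and> a' = c t \<and> b' = b \<or> \<sigma> = - 1 \<and> a' = a \<and> b' = c t"
    using sigma a by (cases "\<sigma> = 1") (auto simp: S_def)
  have S_J: "{a'..b'} \<subseteq> J" using J_Icc[OF a(1)] S by force
  have ct: "c t \<in> J" using c_in_J t by simp
  have S_sub: "{a'..b'} \<subseteq> {z. l < ereal z \<and> 0 \<le> \<sigma> * (z - c t)}"
    using S_J ends by (auto simp: J_def)
  have in_side: "(t, z) \<in> open_side" if "a' < z" "z < b'" for z
    using that S_J ends t by (auto simp: open_side_def J_def subset_eq)
  have H_sec: "continuous_on {a'..b'} (H t)" "continuous_on {a'..b'} (hy t)" "continuous_on {a'..b'} (ht t)"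
    using side_section_continuous[OF H_cont t] side_section_continuous[OF hy_cont t] side_section_continuous[OF ht_cont t]
      S_sub continuous_on_subset by blast+
  have g_der: "\<And>z. DERIV g z :> g1 z" "\<And>z. DERIV g1 z :> g2 z"
    and g_off: "\<And>z. z \<notin> {a<..<b} \<Longrightarrow> g z = 0 \<and> g1 z = 0"
    using g unfolding C2_supp_def by blast+
  have g_cont: "continuous_on {a'..b'} g" "continuous_on {a'..b'} g1"
    using g_der by (auto intro: has_field_derivative_continuous_on)
  have f_cont: "continuous_on {a'..b'} f"
    unfolding f_def by (intro continuous_intros H_sec g_cont continuous_on_subset[OF continuous_rho S_J]
        continuous_on_subset[OF continuous_gen_test[OF g a(1)]]) simp
  have L_eq: "indicator {a'..b'} z *\<^sub>R f z = indicator {z. 0 < \<sigma> * (z - c t)} z * f z" if "z \<noteq> c t" for z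
  proof (cases "z \<in> {a..b}")
    case True
    then show ?thesis using ends that by (auto simp: indicator_def)
  next
    case False
    then have "z \<notin> {a<..<b}" by auto
    then have "f z = 0"
      using g_off gen_test_off_support[OF g] by (simp add: f_def)
    then show ?thesis by simp
  qed
  have L_meas: "(\<lambda>z. indicator {a'..b'} z *\<^sub>R f z) \<in> borel_measurable lborel"
    using borel_measurable_continuous_on_indicator[OF _ f_cont] by simp
  have "(LINT z|lborel. indicator {a'..b'} z *\<^sub>R f z) = (LINT z:{a'..b'}|lborel. f z)"
    by (simp add: set_lebesgue_integral_def)
  also have "\<dots> = integral {a'..b'} f"
    by (intro set_borel_integral_eq_integral borel_integrable_atLeastAtMost' f_cont)
  also have "\<dots> = \<sigma> * g (c t) * hy t (c t) / deriv s (c t)"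
  proof (rule integral_unique)
    have "((\<lambda>z. \<rho> z * (H t z * gen z (g1 z) (g2 z) - g z * gen z (hy t z) (hyy t z))) has_integral
      ((H t b' * g1 b' - g b' * hy t b') / deriv s b' - (H t a' * g1 a' - g a' * hy t a') / deriv s a')) {a'..b'}"
      using S(2) in_side by (intro green_identity S_J H_sec g_cont g_der hy hyy) auto
    moreover have "(H t b' * g1 b' - g b' * hy t b') / deriv s b' - (H t a' * g1 a' - g a' * hy t a') / deriv s a' =
        \<sigma> * g (c t) * hy t (c t) / deriv s (c t)"
      using ends g_off[of a] g_off[of b] H_wrong_side[OF JI[OF ct], of t] t by auto
    ultimately have "((\<lambda>z. \<rho> z * (H t z * gen z (g1 z) (g2 z) - g z * gen z (hy t z) (hyy t z))) has_integral
      \<sigma> * g (c t) * hy t (c t) / deriv s (c t)) {a'..b'}" by simp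
    then show "(f has_integral \<sigma> * g (c t) * hy t (c t) / deriv s (c t)) {a'..b'}"
    proof (rule has_integral_spike_finite[rotated 2])
      show "finite {a', b'}" by simp
      fix z assume "z \<in> {a'..b'} - {a', b'}"
      then have "(t, z) \<in> open_side" by (intro in_side) auto
      from backward_equation[OF this]
      show "f z = \<rho> z * (H t z * gen z (g1 z) (g2 z) - g z * gen z (hy t z) (hyy t z))"
        by (simp add: f_def add_eq_0_iff2)
    qed
  qed
  finally have L_int: "(LINT z|lborel. indicator {a'..b'} z *\<^sub>R f z) = \<sigma> * g (c t) * hy t (c t) / deriv s (c t)" .
  show ?thesis
    by (rule that[OF L_meas _ L_int], subst L_eq) (simp_all only: f_def, simp_all)
qed

text \<open>Symmetry is used for two compactly supported functions, so \<open>H (t + h)\<close> is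
  cut off to the larger interval \<open>{a'..b'}\<close>; the rest \<open>R\<close> is
  \<open>o(h)\<close> because being outside that interval, from the support of \<open>g\<close>, is.
  After the exchange only difference quotients remain, of \<open>g\<close> under the semigroup and
  of \<open>H\<close> in time, and both are bounded uniformly in \<open>z\<close>.\<close>

lemma near_increment_limit:
  assumes t: "0 < t" "ereal t < \<zeta>" and e: "0 < e" "c t - 3 * e \<in> J"
    and g: "C2_supp (c t - 2 * e) (c t + 2 * e) g g1 g2"
  shows "((\<lambda>h. (LINT y|lborel. g y * \<rho> y * W t h y) / h) \<longlongrightarrow> \<sigma> * g (c t) * hy t (c t) / deriv s (c t)) (at_right 0)"
proof -
  \<comment> \<open>The gap \<open>e\<close> between \<open>{a..b}\<close>, which carries
    \<open>g\<close>, and the ends of \<open>{a'..b'}\<close> is what \<open>exit_small\<close>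
    needs.\<close>
  define a b a' b' where "a = c t - 2 * e" and "b = c t + 2 * e" and "a' = c t - 3 * e" and "b' = c t + 3 * e"
  have ab: "a' < a" "a < c t" "c t < b" "b < b'" "a' \<in> J" "a \<in> J"
    using e J_upward[OF e(2)] by (auto simp: a_def b_def a'_def b'_def)
  have J': "{a'..b'} \<subseteq> J" "{a..b} \<subseteq> J" using J_Icc ab by auto
  note g = g[folded a_def b_def]
  obtain h0 where h0: "0 < h0" "ereal (t + h0) < \<zeta>" by (rule zeta_room[OF t(2)])
  have th: "0 \<le> t + h" "ereal (t + h) < \<zeta>" if "0 < h" "h < h0" for h
    using that t less_zeta_mono[OF h0(2), of "t + h"] by auto
  obtain K where K: "0 \<le> K" "\<And>h z. 0 < h \<Longrightarrow> h < h0 \<Longrightarrow> z \<in> {a'..b'} \<Longrightarrow> \<bar>H (t + h) z - H t z\<bar> \<le> K * h"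
    by (rule H_lipschitz_in_time[OF t(1) h0(2) ab(5), of b']) (rule that)
  obtain Cx where Cx: "0 \<le> Cx"
    "\<And>y h. y \<in> {a..b} \<Longrightarrow> 0 < h \<Longrightarrow> (LINT \<omega>|P y. indicator (- {a'..b'}) (X h \<omega>)) \<le> Cx * h"
    "\<And>y. y \<in> {a..b} \<Longrightarrow> ((\<lambda>h. (LINT \<omega>|P y. indicator (- {a'..b'}) (X h \<omega>)) / h) \<longlongrightarrow> 0) (at_right 0)"
    by (rule exit_small[OF ab(5,1) _ ab(4)]) (use ab in simp, rule that)
  obtain Cg where Cg: "0 \<le> Cg" "\<And>y h. y \<in> J \<Longrightarrow> 0 < h \<Longrightarrow> \<bar>(LINT \<omega>|P y. g (X h \<omega>)) - g y\<bar> \<le> Cg * h"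
    by (rule expectation_test_bound[OF g ab(6)]) (rule that)
  obtain Bg where Bg: "0 \<le> Bg" "\<And>z. \<bar>g z\<bar> \<le> Bg"
    by (rule bounded_test[OF g]) (rule that)
  have g_off: "g z = 0" if "z \<notin> {a..b}" for z
    using g that unfolding C2_supp_def by (meson greaterThanLessThan_subseteq_atLeastAtMost_iff order_refl subsetD)
  have g_meas [measurable]: "g \<in> borel_measurable borel"
    by (intro borel_measurable_continuous_onI continuous_test[OF g])
  note [measurable] = speed_measurable
  have Hm: "(\<lambda>y. indicator I y * H r y) \<in> borel_measurable borel" if "0 \<le> r" for r
    by (rule H_measurable[OF that])
  define \<eta> where "\<eta> h z = indicator {a'..b'} z * (indicator I z * H (t + h) z)" for h z
  define R where "R h y = (LINT \<omega>|P y. indicator (- {a'..b'}) (X h \<omega>) * (indicator I (X h \<omega>) * H (t + h) (X h \<omega>)))" for h y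
  define w where "w h z = (LINT \<omega>|P z. g (X h \<omega>))" for h z
  have \<eta>_meas: "\<eta> h \<in> borel_measurable borel" if "0 < h" "h < h0" for h
    unfolding \<eta>_def by (intro borel_measurable_times[OF borel_measurable_indicator Hm[OF th(1)[OF that]]]) simp
  have \<eta>_bound: "\<bar>\<eta> h z\<bar> \<le> 1" for h z
    using H_bounds[of z "t + h"] by (auto simp: \<eta>_def indicator_def)
  have \<eta>_off: "\<eta> h z = 0" if "z \<notin> {a'..b'}" for h z
    using that by (simp add: \<eta>_def)
  have R_bound: "0 \<le> R h y" "R h y \<le> (LINT \<omega>|P y. indicator (- {a'..b'}) (X h \<omega>))"
    and W_split: "W t h y = (LINT \<omega>|P y. \<eta> h (X h \<omega>)) + R h y - H t y"
    if h: "0 < h" "h < h0" and y: "y \<in> I" for h y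
  proof -
    interpret prob_space "P y" by (rule prob[OF y])
    have X: "X h \<in> borel_measurable (P y)" using X_measurable_P[OF y] h by simp
    have XI: "X h \<omega> \<in> I" if "\<omega> \<in> space (P y)" for \<omega>
      using conservative[of h \<omega>] that h by (simp add: space_P[OF y])
    have m1: "(\<lambda>\<omega>. indicator (- {a'..b'}) (X h \<omega>) * (indicator I (X h \<omega>) * H (t + h) (X h \<omega>))) \<in> borel_measurable (P y)"
      using measurable_compose[OF X borel_measurable_times[OF borel_measurable_indicator[of "- {a'..b'}"] Hm[OF th(1)[OF h]]]] by simp
    have bd: "\<bar>indicator (- {a'..b'}) (X h \<omega>) * (indicator I (X h \<omega>) * H (t + h) (X h \<omega>))\<bar> \<le> 1" for \<omega>
      using H_bounds[of "X h \<omega>" "t + h"] by (auto simp: indicator_def)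
    have i1: "integrable (P y) (\<lambda>\<omega>. indicator (- {a'..b'}) (X h \<omega>) * (indicator I (X h \<omega>) * H (t + h) (X h \<omega>)))"
      by (rule integrable_if_bounded[OF m1, of 1]) (use bd in simp)
    have i2: "integrable (P y) (\<lambda>\<omega>. \<eta> h (X h \<omega>))"
      by (rule integrable_if_bounded[OF measurable_compose[OF X \<eta>_meas[OF h]], of 1]) (use \<eta>_bound in simp)
    have i3: "integrable (P y) (\<lambda>\<omega>. indicat_real (- {a'..b'}) (X h \<omega>))"
      using X by (intro integrable_if_bounded[where C = 1]) (auto simp: indicator_def)
    show "0 \<le> R h y"
      unfolding R_def using H_bounds by (intro Bochner_Integration.integral_nonneg) (auto simp: indicator_def)
    show "R h y \<le> (LINT \<omega>|P y. indicator (- {a'..b'}) (X h \<omega>))"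
      unfolding R_def by (rule integral_mono[OF i1 i3]) (use H_bounds in \<open>auto simp: indicator_def\<close>)
    have "(LINT \<omega>|P y. H (t + h) (X h \<omega>)) = (LINT \<omega>|P y. \<eta> h (X h \<omega>) + indicator (- {a'..b'}) (X h \<omega>) * (indicator I (X h \<omega>) * H (t + h) (X h \<omega>)))"
      by (rule Bochner_Integration.integral_cong) (use XI in \<open>auto simp: \<eta>_def indicator_def\<close>)
    also have "\<dots> = (LINT \<omega>|P y. \<eta> h (X h \<omega>)) + R h y"
      unfolding R_def by (rule Bochner_Integration.integral_add[OF i2 i1])
    finally show "W t h y = (LINT \<omega>|P y. \<eta> h (X h \<omega>)) + R h y - H t y"
      using W_eq[OF y, of h t] h t by simp
  qed
  have rho_cont: "continuous_on {a'..b'} \<rho>" by (rule continuous_on_subset[OF continuous_rho J'(1)])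
  then have "bounded (\<rho> ` {a'..b'})" by (intro compact_imp_bounded compact_continuous_image) auto
  then obtain Br where Br: "\<forall>z\<in>{a'..b'}. \<bar>\<rho> z\<bar> \<le> Br" by (auto simp: bounded_iff)
  have Br0: "0 \<le> Br" using bspec[OF Br, of "c t"] ab by auto
  have int_bounded: "integrable lborel f"
    if "f \<in> borel_measurable borel" "\<And>z. \<bar>f z\<bar> \<le> C" "\<And>z. z \<notin> {a'..b'} \<Longrightarrow> f z = 0" for f :: "real \<Rightarrow> real" and C
  proof -
    have "integrable lborel (\<lambda>z. indicator {a'..b'} z *\<^sub>R f z)"
      using that(1,2) by (intro integrableI_bounded_set_indicator[where B = C]) (auto simp: emeasure_lborel_Icc_eq)
    moreover have "(\<lambda>z. indicator {a'..b'} z *\<^sub>R f z) = f"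
      using that(3) by (auto simp: indicator_def fun_eq_iff)
    ultimately show ?thesis by simp
  qed
  have w_int: "integrable lborel (\<lambda>z. indicator {a'..b'} z * C)" for C :: real
    by (rule int_bounded[where C = "\<bar>C\<bar>"]) (auto simp: indicator_def)
  have E_meas: "(\<lambda>z. indicator J z * (LINT \<omega>|P z. f (X h \<omega>))) \<in> borel_measurable borel"
    if "0 < h" "f \<in> borel_measurable borel" for h and f :: "real \<Rightarrow> real"
    by (rule expectation_measurable[OF that])
  have R_meas: "(\<lambda>y. indicator J y * R h y) \<in> borel_measurable borel" if h: "0 < h" "h < h0" for h
    unfolding R_def by (rule E_meas[OF h(1), of "\<lambda>z. indicator (- {a'..b'}) z * (indicator I z * H (t + h) z)"])
      (intro borel_measurable_times[OF borel_measurable_indicator Hm[OF th(1)[OF h]]], simp)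
  \<comment> \<open>Measurability in the starting point is known only after multiplication by the
    indicator of \<open>J\<close>; it can be inserted since \<open>g\<close> vanishes off
    \<open>J\<close>.\<close>
  have gR: "g y * \<rho> y * R h y = g y * \<rho> y * (indicator J y * R h y)" for h y
    using g_off[of y] J'(2) by (cases "y \<in> {a..b}") auto
  have g_rho_bound: "\<bar>g y * \<rho> y\<bar> \<le> Bg * Br" for y
  proof (cases "y \<in> {a..b}")
    case True
    then have "\<bar>\<rho> y\<bar> \<le> Br" using Br ab by auto
    then show ?thesis using Bg by (simp add: abs_mult mult_mono)
  qed (use g_off Bg Br0 in simp)
  have R_limit: "((\<lambda>h. LINT y|lborel. g y * \<rho> y * (R h y / h)) \<longlongrightarrow> (LINT y|(lborel :: real measure). (0::real))) (at_right 0)"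
  proof (rule integral_dominated_convergence_at_right[OF h0(1), where w = "\<lambda>z. indicator {a'..b'} z * (Bg * Br * Cx)"])
    show "(\<lambda>y. g y * \<rho> y * (R h y / h)) \<in> borel_measurable lborel" if h: "0 < h" "h < h0" for h
    proof -
      note [measurable] = R_meas[OF h]
      have "(\<lambda>y. g y * \<rho> y * (indicator J y * R h y) / h) \<in> borel_measurable borel" by measurable
      then show ?thesis unfolding gR[symmetric] by simp
    qed
    show "AE y in lborel. ((\<lambda>h. g y * \<rho> y * (R h y / h)) \<longlongrightarrow> 0) (at_right 0)"
    proof (rule AE_I2)
      fix y
      show "((\<lambda>h. g y * \<rho> y * (R h y / h)) \<longlongrightarrow> 0) (at_right 0)"
      proof (cases "y \<in> {a..b}")
        case True
        then have yI: "y \<in> I" using J'(2) JI by auto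
        have "((\<lambda>h. R h y / h) \<longlongrightarrow> 0) (at_right 0)"
        proof (rule tendsto_sandwich[OF _ _ tendsto_const Cx(3)[OF True]])
          show "eventually (\<lambda>h. 0 \<le> R h y / h) (at_right 0)"
            using eventually_at_right_0_real[OF h0(1)] by eventually_elim (use R_bound(1)[OF _ _ yI] in auto)
          show "eventually (\<lambda>h. R h y / h \<le> (LINT \<omega>|P y. indicator (- {a'..b'}) (X h \<omega>)) / h) (at_right 0)"
            using eventually_at_right_0_real[OF h0(1)]
            by eventually_elim (use R_bound(2)[OF _ _ yI] in \<open>auto intro: divide_right_mono\<close>)
        qed
        then show ?thesis by (rule tendsto_mult_right_zero)
      qed (simp add: g_off)
    qed
    show "AE y in lborel. \<bar>g y * \<rho> y * (R h y / h)\<bar> \<le> indicator {a'..b'} y * (Bg * Br * Cx)" if h: "0 < h" "h < h0" for h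
    proof (rule AE_I2)
      fix y
      show "\<bar>g y * \<rho> y * (R h y / h)\<bar> \<le> indicator {a'..b'} y * (Bg * Br * Cx)"
      proof (cases "y \<in> {a..b}")
        case True
        then have yI: "y \<in> I" and y': "y \<in> {a'..b'}" using J'(2) JI ab by auto
        have "R h y \<le> Cx * h" using R_bound(2)[OF h yI] Cx(2)[OF True h(1)] by simp
        then have "\<bar>R h y / h\<bar> \<le> Cx" using R_bound(1)[OF h yI] h by (simp add: field_simps)
        then have "\<bar>g y * \<rho> y\<bar> * \<bar>R h y / h\<bar> \<le> Bg * Br * Cx"
          using g_rho_bound[of y] Cx(1) Bg Br0 by (intro mult_mono) auto
        then show ?thesis using y' by (simp add: abs_mult)
      next
        case False
        then show ?thesis using g_off Bg Br0 Cx(1) by simp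
      qed
    qed
  qed (use w_int in auto)
  have I1: "indicator I y = (1::real)" "indicator J y = (1::real)" if "y \<in> {a'..b'}" for y
    using J'(1) JI that by auto
  have gI: "g y * x = g y * (indicator J y * x)" "g y * x = g y * (indicator I y * x)" for x y
    using g_off[of y] I1[of y] ab by (cases "y \<in> {a..b}"; simp)+
  have \<eta>I: "\<eta> h z * x = \<eta> h z * (indicator J z * x)" for h x z
    using \<eta>_off[of z] I1[of z] by (cases "z \<in> {a'..b'}") auto
  \<comment> \<open>Discrete product rule: since
    \<open>\<eta> h z * g z = g z * H (t + h) z\<close>, the difference
    \<open>\<eta> h z * w h z - g z * H t z\<close> is \<open>h\<close> times the bracket.\<close>
  define F where "F h z = \<rho> z * (\<eta> h z * ((w h z - g z) / h) + g z * ((H (t + h) z - H t z) / h))" for h z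
  have integral_eq: "(LINT y|lborel. g y * \<rho> y * W t h y) / h = (LINT z|lborel. F h z) + (LINT y|lborel. g y * \<rho> y * (R h y / h))"
    if h: "0 < h" "h < h0" for h
  proof -
    note [measurable] = R_meas[OF h] \<eta>_meas[OF h] E_meas[OF h(1) g_meas] E_meas[OF h(1) \<eta>_meas[OF h]]
      Hm[OF th(1)[OF h]] Hm[OF less_imp_le[OF t(1)]]
    have i_R: "integrable lborel (\<lambda>y. g y * \<rho> y * R h y)"
    proof (rule int_bounded)
      show "(\<lambda>y. g y * \<rho> y * R h y) \<in> borel_measurable borel"
        unfolding gR by measurable
      show "\<bar>g y * \<rho> y * R h y\<bar> \<le> Bg * Br * 1" for y
      proof (cases "y \<in> {a..b}")
        case True
        then have yI: "y \<in> I" using J'(2) JI by auto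
        interpret prob_space "P y" by (rule prob[OF yI])
        have "\<bar>R h y\<bar> \<le> 1"
          unfolding R_def
        proof (rule abs_expectation_le)
          show "(\<lambda>\<omega>. indicator (- {a'..b'}) (X h \<omega>) * (indicator I (X h \<omega>) * H (t + h) (X h \<omega>))) \<in> borel_measurable (P y)"
            using measurable_compose[OF X_measurable_P[OF yI less_imp_le[OF h(1)]] borel_measurable_times[OF borel_measurable_indicator[of "- {a'..b'}"] Hm[OF th(1)[OF h]]]] by simp
        qed (use H_bounds in \<open>auto simp: indicator_def\<close>)
        then show ?thesis
          unfolding abs_mult[of _ "R h y"] using g_rho_bound[of y] Bg Br0 by (intro mult_mono) auto
      qed (use g_off Bg Br0 in simp)
      show "g y * \<rho> y * R h y = 0" if "y \<notin> {a'..b'}" for y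
        using g_off[of y] that ab by auto
    qed
    have i_eta: "integrable lborel (\<lambda>y. g y * \<rho> y * (LINT \<omega>|P y. \<eta> h (X h \<omega>)))"
    proof (rule int_bounded)
      have "(\<lambda>y. \<rho> y * (g y * (indicator J y * (LINT \<omega>|P y. \<eta> h (X h \<omega>))))) \<in> borel_measurable borel"
        by measurable
      then show "(\<lambda>y. g y * \<rho> y * (LINT \<omega>|P y. \<eta> h (X h \<omega>))) \<in> borel_measurable borel"
        by (simp add: gI(1)[symmetric] mult_ac)
      show "\<bar>g y * \<rho> y * (LINT \<omega>|P y. \<eta> h (X h \<omega>))\<bar> \<le> Bg * Br * 1" for y
      proof (cases "y \<in> {a..b}")
        case True
        then have yI: "y \<in> I" using J'(2) JI by auto
        interpret prob_space "P y" by (rule prob[OF yI])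
        have "\<bar>LINT \<omega>|P y. \<eta> h (X h \<omega>)\<bar> \<le> 1"
          by (rule abs_expectation_le[OF measurable_compose[OF X_measurable_P[OF yI less_imp_le[OF h(1)]] \<eta>_meas[OF h]]])
            (use \<eta>_bound in simp)
        then show ?thesis
          unfolding abs_mult[of "g y * \<rho> y"] using g_rho_bound[of y] Bg Br0 by (intro mult_mono) auto
      qed (use g_off Bg Br0 in simp)
      show "g y * \<rho> y * (LINT \<omega>|P y. \<eta> h (X h \<omega>)) = 0" if "y \<notin> {a'..b'}" for y
        using g_off[of y] that ab by auto
    qed
    have i_H: "integrable lborel (\<lambda>y. g y * \<rho> y * H r y)" if "0 \<le> r" for r
    proof (rule int_bounded)
      note [measurable] = Hm[OF that]
      have "(\<lambda>y. \<rho> y * (g y * (indicator I y * H r y))) \<in> borel_measurable borel"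
        by measurable
      then show "(\<lambda>y. g y * \<rho> y * H r y) \<in> borel_measurable borel"
        by (simp add: gI(2)[symmetric] mult_ac)
      show "\<bar>g y * \<rho> y * H r y\<bar> \<le> Bg * Br * 1" for y
      proof (cases "y \<in> {a..b}")
        case True
        then have yI: "y \<in> I" using J'(2) JI by auto
        then show ?thesis
          unfolding abs_mult[of "g y * \<rho> y"] using g_rho_bound[of y] Bg Br0 H_bounds[OF yI, of r] by (intro mult_mono) auto
      qed (use g_off Bg Br0 in simp)
      show "g y * \<rho> y * H r y = 0" if "y \<notin> {a'..b'}" for y
        using g_off[of y] that ab by auto
    qed
    have i_w: "integrable lborel (\<lambda>z. \<eta> h z * \<rho> z * w h z)"
    proof (rule int_bounded)
      have "(\<lambda>z. \<rho> z * (\<eta> h z * (indicator J z * w h z))) \<in> borel_measurable borel"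
        unfolding w_def by measurable
      also have "(\<lambda>z. \<rho> z * (\<eta> h z * (indicator J z * w h z))) = (\<lambda>z. \<eta> h z * \<rho> z * w h z)"
        by (rule ext, subst \<eta>I[symmetric], simp only: mult_ac)
      finally show "(\<lambda>z. \<eta> h z * \<rho> z * w h z) \<in> borel_measurable borel" .
      show "\<bar>\<eta> h z * \<rho> z * w h z\<bar> \<le> 1 * Br * Bg" for z
      proof (cases "z \<in> {a'..b'}")
        case True
        then have zI: "z \<in> I" using J'(1) JI by auto
        interpret prob_space "P z" by (rule prob[OF zI])
        have "\<bar>w h z\<bar> \<le> Bg"
          unfolding w_def by (rule abs_expectation_le[OF measurable_compose[OF X_measurable_P[OF zI less_imp_le[OF h(1)]] g_meas]])
            (use Bg in simp)
        moreover have "\<bar>\<rho> z\<bar> \<le> Br" using Br True by auto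
        ultimately show ?thesis
          unfolding abs_mult using \<eta>_bound[of h z] Br0 by (intro mult_mono mult_nonneg_nonneg) auto
      qed (use \<eta>_off Bg Br0 in simp)
      show "\<eta> h z * \<rho> z * w h z = 0" if "z \<notin> {a'..b'}" for z
        using \<eta>_off that by simp
    qed
    have eta_g: "\<eta> h z * g z = g z * H (t + h) z" for z
      using g_off[of z] I1[of z] ab by (cases "z \<in> {a..b}") (auto simp: \<eta>_def)
    have "(LINT y|lborel. g y * \<rho> y * W t h y) =
        (LINT y|lborel. g y * \<rho> y * (LINT \<omega>|P y. \<eta> h (X h \<omega>)) + g y * \<rho> y * R h y - g y * \<rho> y * H t y)"
    proof (rule Bochner_Integration.integral_cong[OF refl])
      fix y
      show "g y * \<rho> y * W t h y = g y * \<rho> y * (LINT \<omega>|P y. \<eta> h (X h \<omega>)) + g y * \<rho> y * R h y - g y * \<rho> y * H t y"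
      proof (cases "y \<in> {a..b}")
        case True
        then have "y \<in> I" using J'(2) JI by auto
        from W_split[OF h this] show ?thesis by (simp only: right_diff_distrib distrib_left)
      qed (simp add: g_off)
    qed
    also have "\<dots> = (LINT y|lborel. g y * \<rho> y * (LINT \<omega>|P y. \<eta> h (X h \<omega>))) + (LINT y|lborel. g y * \<rho> y * R h y) - (LINT y|lborel. g y * \<rho> y * H t y)"
      using i_eta i_R i_H t by (simp add: less_imp_le)
    \<comment> \<open>Here the semigroup passes from \<open>\<eta> h\<close>, which is not smooth,
      to the C^2 function \<open>g\<close>.\<close>
    also have "(LINT y|lborel. g y * \<rho> y * (LINT \<omega>|P y. \<eta> h (X h \<omega>))) = (LINT z|lborel. \<eta> h z * \<rho> z * w h z)"
      unfolding w_def
      by (rule expectation_symmetric[OF h(1) ab(6,5) g_meas Bg(2) g_off \<eta>_meas[OF h] \<eta>_bound \<eta>_off])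
    also have "(LINT z|lborel. \<eta> h z * \<rho> z * w h z) + (LINT y|lborel. g y * \<rho> y * R h y) - (LINT y|lborel. g y * \<rho> y * H t y)
        = (LINT z|lborel. \<eta> h z * \<rho> z * w h z - g z * \<rho> z * H t z) + (LINT y|lborel. g y * \<rho> y * R h y)"
      using i_w i_H t by (simp add: less_imp_le)
    also have "(\<lambda>z. \<eta> h z * \<rho> z * w h z - g z * \<rho> z * H t z) = (\<lambda>z. h * F h z)"
    proof
      fix z
      have "h * F h z = \<rho> z * (\<eta> h z * (h * ((w h z - g z) / h)) + g z * (h * ((H (t + h) z - H t z) / h)))"
        unfolding F_def by algebra
      also have "\<dots> = \<rho> z * (\<eta> h z * (w h z - g z) + g z * (H (t + h) z - H t z))"
        using h by simp
      also have "\<dots> = \<rho> z * (\<eta> h z * w h z - \<eta> h z * g z + g z * H (t + h) z - g z * H t z)"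
        by (simp add: algebra_simps)
      finally have "h * F h z = \<rho> z * (\<eta> h z * w h z - g z * H (t + h) z + g z * H (t + h) z - g z * H t z)"
        unfolding eta_g .
      then show "\<eta> h z * \<rho> z * w h z - g z * \<rho> z * H t z = h * F h z"
        by (simp add: algebra_simps)
    qed
    finally show ?thesis
      using h by (simp add: add_divide_distrib)
  qed
  obtain L where L_meas: "L \<in> borel_measurable lborel"
    and L: "\<And>z. z \<noteq> c t \<Longrightarrow> L z = indicator {z. 0 < \<sigma> * (z - c t)} z * (\<rho> z * (H t z * gen z (g1 z) (g2 z) + g z * ht t z))"
    and L_int: "(LINT z|lborel. L z) = \<sigma> * g (c t) * hy t (c t) / deriv s (c t)"
    by (rule green_at_boundary[OF t ab(6,2,3) g]) (rule that)
  have F_limit: "((\<lambda>h. LINT z|lborel. F h z) \<longlongrightarrow> (LINT z|lborel. L z)) (at_right 0)"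
  proof (rule integral_dominated_convergence_at_right[OF h0(1), where w = "\<lambda>z. indicator {a'..b'} z * (Br * (1 * Cg + Bg * K))"])
    show "F h \<in> borel_measurable lborel" if h: "0 < h" "h < h0" for h
    proof -
      note [measurable] = \<eta>_meas[OF h] E_meas[OF h(1) g_meas] Hm[OF th(1)[OF h]] Hm[OF less_imp_le[OF t(1)]]
      have "F h z = \<rho> z * (\<eta> h z * (indicator J z * w h z) - \<eta> h z * g z + g z * (indicator I z * H (t + h) z) - g z * (indicator I z * H t z)) / h" for z
        unfolding gI(2)[symmetric] \<eta>I[symmetric] F_def using h by (simp add: field_simps)
      then have "F h = (\<lambda>z. \<rho> z * (\<eta> h z * (indicator J z * w h z) - \<eta> h z * g z + g z * (indicator I z * H (t + h) z) - g z * (indicator I z * H t z)) / h)"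
        by auto
      also have "\<dots> \<in> borel_measurable lborel"
        unfolding w_def by measurable
      finally show ?thesis .
    qed
    show "AE z in lborel. \<bar>F h z\<bar> \<le> indicator {a'..b'} z * (Br * (1 * Cg + Bg * K))" if h: "0 < h" "h < h0" for h
    proof (rule AE_I2)
      fix z
      show "\<bar>F h z\<bar> \<le> indicator {a'..b'} z * (Br * (1 * Cg + Bg * K))"
      proof (cases "z \<in> {a'..b'}")
        case True
        then have zJ: "z \<in> J" using J'(1) by auto
        have "\<bar>(w h z - g z) / h\<bar> \<le> Cg"
          using Cg(2)[OF zJ h(1)] h by (simp add: w_def abs_divide field_simps)
        moreover have "\<bar>(H (t + h) z - H t z) / h\<bar> \<le> K"
          using K(2)[OF h True] h by (simp add: abs_divide field_simps)
        ultimately have "\<bar>\<eta> h z * ((w h z - g z) / h)\<bar> \<le> 1 * Cg" "\<bar>g z * ((H (t + h) z - H t z) / h)\<bar> \<le> Bg * K"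
          unfolding abs_mult using \<eta>_bound[of h z] Bg by (intro mult_mono; simp)+
        then have "\<bar>\<eta> h z * ((w h z - g z) / h) + g z * ((H (t + h) z - H t z) / h)\<bar> \<le> 1 * Cg + Bg * K"
          by linarith
        moreover have "\<bar>\<rho> z\<bar> \<le> Br" using Br True by blast
        ultimately have "\<bar>F h z\<bar> \<le> Br * (1 * Cg + Bg * K)"
          unfolding F_def abs_mult[of "\<rho> z"] using Br0 by (intro mult_mono) auto
        then show ?thesis using True by simp
      next
        case False
        then have "g z = 0" "\<eta> h z = 0" using g_off[of z] \<eta>_off ab by auto
        then show ?thesis using False by (simp add: F_def)
      qed
    qed
    \<comment> \<open>The point \<open>c t\<close> is left out: there the difference quotient of
      \<open>H\<close> in time need not converge.\<close>
    show "AE z in lborel. ((\<lambda>h. F h z) \<longlongrightarrow> L z) (at_right 0)"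
      using AE_lborel_singleton[of "c t"]
    proof eventually_elim
      case (elim z)
      show ?case
      proof (cases "z \<in> {a'..b'}")
        case True
        then have zJ: "z \<in> J" using J'(1) by auto
        have zI: "z \<in> I" by (rule JI[OF zJ])
        define D where "D = (if 0 < \<sigma> * (z - c t) then ht t z else 0)"
        have w_lim: "((\<lambda>h. (w h z - g z) / h) \<longlongrightarrow> gen z (g1 z) (g2 z)) (at_right 0)"
          unfolding w_def by (rule expectation_test_limit[OF g ab(6) zJ])
        have "((\<lambda>h. K * h) \<longlongrightarrow> K * 0) (at_right 0)" by (intro tendsto_intros)
        then have null: "((\<lambda>h. K * h) \<longlongrightarrow> 0) (at_right 0)" by simp
        have "eventually (\<lambda>h. norm (\<eta> h z - H t z) \<le> K * h) (at_right 0)"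
          using eventually_at_right_0_real[OF h0(1)]
        proof eventually_elim
          case (elim h)
          then show ?case
            using K(2)[of h z] True I1[OF True] by (simp add: \<eta>_def)
        qed
        from Lim_null_comparison[OF this null]
        have eta_lim: "((\<lambda>h. \<eta> h z) \<longlongrightarrow> H t z) (at_right 0)"
          by (rule iffD2[OF Lim_null])
        have D_lim: "((\<lambda>h. (H (t + h) z - H t z) / h) \<longlongrightarrow> D) (at_right 0)"
        proof (cases "0 < \<sigma> * (z - c t)")
          case True
          then have "(t, z) \<in> open_side" using t zJ by (simp add: open_side_def J_def)
          from ht[OF this] have "((\<lambda>h. (H (t + h) z - H t z) / h) \<longlongrightarrow> ht t z) (at 0)"
            by (simp add: DERIV_def)
          then show ?thesis using True by (simp add: D_def filterlim_at_split)
        next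
          case False
          then have neg: "\<sigma> * (z - c t) < 0" using elim sigma by auto
          \<comment> \<open>On the wrong side the boundary needs some time to reach
            \<open>z\<close>; until then both values of \<open>H\<close> are zero, and so is the
            quotient.\<close>
          obtain d where d: "0 < d" "ereal (t + d) < \<zeta>" "\<And>r. r \<in> {t..t + d} \<Longrightarrow> \<bar>c r - c t\<bar> < \<bar>z - c t\<bar>"
            by (rule c_near[OF less_imp_le[OF t(1)] t(2), of "\<bar>z - c t\<bar>"]) (use elim in simp, rule that)
          have "(H (t + h) z - H t z) / h = 0" if h: "0 < h" "h < d" for h
          proof -
            have "\<bar>c (t + h) - c t\<bar> < \<bar>z - c t\<bar>" using h by (intro d(3)) auto
            then have "\<sigma> * (z - c (t + h)) \<le> 0" using neg sigma by (auto simp: abs_if split: if_splits)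
            moreover have "ereal (t + h) < \<zeta>" by (rule less_zeta_mono[OF d(2)]) (use h in simp)
            ultimately have "H (t + h) z = 0" using t h by (intro H_wrong_side zI) auto
            moreover have "H t z = 0" using t neg by (intro H_wrong_side zI) auto
            ultimately show ?thesis by simp
          qed
          then have "eventually (\<lambda>h. (H (t + h) z - H t z) / h = 0) (at_right 0)"
            using eventually_at_right_0_real[OF d(1)] by (auto elim!: eventually_mono)
          then show ?thesis using False by (simp add: D_def tendsto_eventually)
        qed
        have "((\<lambda>h. F h z) \<longlongrightarrow> \<rho> z * (H t z * gen z (g1 z) (g2 z) + g z * D)) (at_right 0)"
          unfolding F_def by (intro tendsto_intros eta_lim w_lim D_lim)
        moreover have "\<rho> z * (H t z * gen z (g1 z) (g2 z) + g z * D) = L z"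
          using H_wrong_side[OF zI less_imp_le[OF t(1)] t(2)] using L[OF elim] by (auto simp: D_def not_less)
        ultimately show ?thesis by simp
      next
        case False
        then have "z \<notin> {a<..<b}" "z \<notin> {a..b}" using ab by auto
        then have "g z = 0" "gen z (g1 z) (g2 z) = 0" "\<And>h. \<eta> h z = 0"
          using g_off gen_test_off_support[OF g] \<eta>_off[OF False] by auto
        then show ?thesis by (simp add: F_def L[OF elim])
      qed
    qed
  qed (use w_int L_meas in simp_all)
  have "((\<lambda>h. (LINT z|lborel. F h z) + (LINT y|lborel. g y * \<rho> y * (R h y / h))) \<longlongrightarrow> (LINT z|lborel. L z) + (LINT y|(lborel :: real measure). (0::real))) (at_right 0)"
    by (intro tendsto_add F_limit R_limit)
  then have "((\<lambda>h. (LINT z|lborel. F h z) + (LINT y|lborel. g y * \<rho> y * (R h y / h))) \<longlongrightarrow> \<sigma> * g (c t) * hy t (c t) / deriv s (c t)) (at_right 0)"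
    by (simp add: L_int)
  moreover have "eventually (\<lambda>h. (LINT y|lborel. g y * \<rho> y * W t h y) / h = (LINT z|lborel. F h z) + (LINT y|lborel. g y * \<rho> y * (R h y / h))) (at_right 0)"
    using eventually_at_right_0_real[OF h0(1)] by eventually_elim (use integral_eq in blast)
  ultimately show ?thesis by (simp add: tendsto_cong)
qed

text \<open>A bump around \<open>c t\<close> separates far from near. The near part is an integral
  of \<open>W\<close> against the speed density and \<open>g z = q t x z * \<phi> z\<close>, and at
  \<open>c t\<close>, where the bump is 1, \<open>g\<close> has the value of
  \<open>q t x\<close>.\<close>

lemma nocross_prob_right_derivative:
  assumes x: "x \<in> I" and t: "0 < t" "ereal t < \<zeta>"
  shows "((\<lambda>h. (measure (P x) (nocross (t + h) (t + h)) - measure (P x) (nocross t t)) / h)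
    \<longlongrightarrow> \<sigma> * hy t (c t) / deriv s (c t) * q t x (c t)) (at_right 0)"
proof -
  interpret prob_space "P x" by (rule prob[OF x])
  obtain e0 where e0: "0 < e0" "c t - e0 \<in> J"
    by (rule ball_J[OF c_in_J[OF less_imp_le[OF t(1)] t(2)]])
  \<comment> \<open>Leaves room in \<open>J\<close> for the interval of half-width
    \<open>3 * e\<close> used in \<open>near_increment_limit\<close>.\<close>
  define e where "e = e0 / 3"
  have e: "0 < e" "c t - 3 * e \<in> J" "c t - 2 * e \<in> J" "c t - e \<in> J"
    using e0 J_upward[OF e0(2)] by (auto simp: e_def)
  obtain \<phi> \<phi>1 \<phi>2 where \<phi>: "C2_supp (c t - 2 * e) (c t + 2 * e) \<phi> \<phi>1 \<phi>2" "\<And>w. 0 \<le> \<phi> w" "\<And>w. \<phi> w \<le> 1"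
    "\<And>w. w \<in> {c t - e..c t + e} \<Longrightarrow> \<phi> w = 1 \<and> \<phi>1 w = 0 \<and> \<phi>2 w = 0"
    by (rule C2_supp_bump[of "c t - 2 * e" "c t - e" "c t + e" "c t + 2 * e"]) (use e in auto)
  have \<phi>_meas: "\<phi> \<in> borel_measurable borel"
    by (intro borel_measurable_continuous_onI continuous_test[OF \<phi>(1)])
  obtain q1 q2 where q12: "\<And>z. z \<in> J \<Longrightarrow> DERIV (q t x) z :> q1 z" "\<And>z. z \<in> J \<Longrightarrow> DERIV q1 z :> q2 z"
    "continuous_on J q2"
    by (rule q_section_C2[OF t(1) x]) (rule that)
  define g where "g z = q t x z * \<phi> z" for z
  have g: "C2_supp (c t - 2 * e) (c t + 2 * e) g (\<lambda>z. q1 z * \<phi> z + q t x z * \<phi>1 z)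
    (\<lambda>z. q2 z * \<phi> z + 2 * (q1 z * \<phi>1 z) + q t x z * \<phi>2 z)"
    unfolding g_def by (rule C2_supp_mult[OF \<phi>(1) open_J J_Icc[OF e(3)] q12])
  have g_c: "g (c t) = q t x (c t)" using \<phi>(4)[of "c t"] e by (simp add: g_def)
  have far: "((\<lambda>h. (LINT \<omega>|P x. (1 - \<phi> (X t \<omega>)) * W t h (X t \<omega>)) / h) \<longlongrightarrow> 0) (at_right 0)"
  proof (rule far_increment_small[OF x t e(1,4) \<phi>_meas \<phi>(2,3)])
    show "\<phi> y = 1" if "\<bar>y - c t\<bar> \<le> e" for y using \<phi>(4)[of y] that by (auto simp: abs_le_iff)
  qed
  have near: "((\<lambda>h. (LINT y|lborel. g y * \<rho> y * W t h y) / h) \<longlongrightarrow> \<sigma> * g (c t) * hy t (c t) / deriv s (c t)) (at_right 0)"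
    by (rule near_increment_limit[OF t e(1,2) g])
  have split: "(measure (P x) (nocross (t + h) (t + h)) - measure (P x) (nocross t t)) / h =
      (LINT \<omega>|P x. (1 - \<phi> (X t \<omega>)) * W t h (X t \<omega>)) / h + (LINT y|lborel. g y * \<rho> y * W t h y) / h" if h: "0 < h" for h
  proof -
    have X: "X t \<in> borel_measurable (P x)" using X_measurable_P[OF x] t by simp
    have XI: "X t \<omega> \<in> I" if "\<omega> \<in> space (P x)" for \<omega>
      using conservative[of t \<omega>] that t by (simp add: space_P[OF x])
    have Wm: "(\<lambda>\<omega>. W t h (X t \<omega>)) \<in> borel_measurable (P x)"
      using W_compose_measurable[OF x] t h by simp
    have Pm: "(\<lambda>\<omega>. \<phi> (X t \<omega>)) \<in> borel_measurable (P x)"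
      by (rule measurable_compose[OF X \<phi>_meas])
    have W1: "\<bar>W t h (X t \<omega>)\<bar> \<le> 1" if "\<omega> \<in> space (P x)" for \<omega>
      using W_nonneg[OF XI[OF that], of t h] W_le_1[OF XI[OF that], of t h] t h by simp
    have i1: "integrable (P x) (\<lambda>\<omega>. \<phi> (X t \<omega>) * W t h (X t \<omega>))" "integrable (P x) (\<lambda>\<omega>. W t h (X t \<omega>))"
      using \<phi>(2,3) W1
      by (auto intro!: integrable_if_bounded[where C = 1] AE_I2 borel_measurable_times Pm Wm mult_le_one simp: abs_mult)
    have "measure (P x) (nocross (t + h) (t + h)) - measure (P x) (nocross t t) = (LINT \<omega>|P x. W t h (X t \<omega>))"
      using nocross_increment[OF x, of t h] t h by simp
    also have "\<dots> = (LINT \<omega>|P x. (1 - \<phi> (X t \<omega>)) * W t h (X t \<omega>)) + (LINT \<omega>|P x. \<phi> (X t \<omega>) * W t h (X t \<omega>))"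
      using i1 by (simp add: left_diff_distrib)
    also have "(LINT \<omega>|P x. \<phi> (X t \<omega>) * W t h (X t \<omega>)) = (LINT \<omega>|P x. \<phi> (X t \<omega>) * (indicator I (X t \<omega>) * W t h (X t \<omega>)))"
      by (rule Bochner_Integration.integral_cong) (use XI in auto)
    also have "\<dots> = (LINT y|lborel. pdens t x y * (\<phi> y * (indicator I y * W t h y)))"
      using t h by (intro expectation_X(1)[OF t(1) x] borel_measurable_times \<phi>_meas W_measurable) auto
    also have "\<dots> = (LINT y|lborel. g y * \<rho> y * W t h y)"
    proof (rule Bochner_Integration.integral_cong[OF refl])
      fix y
      show "pdens t x y * (\<phi> y * (indicator I y * W t h y)) = g y * \<rho> y * W t h y"
      proof (cases "y \<in> {c t - 2 * e<..<c t + 2 * e}")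
        case True
        then have "y \<in> J" using J_upward[OF e(3)] by auto
        then show ?thesis using JI by (simp add: pdens_def g_def)
      next
        case False
        then have "\<phi> y = 0" using \<phi>(1) unfolding C2_supp_def by blast
        then show ?thesis by (simp add: g_def)
      qed
    qed
    finally show ?thesis by (simp add: add_divide_distrib)
  qed
  have "((\<lambda>h. (LINT \<omega>|P x. (1 - \<phi> (X t \<omega>)) * W t h (X t \<omega>)) / h + (LINT y|lborel. g y * \<rho> y * W t h y) / h)
    \<longlongrightarrow> 0 + \<sigma> * g (c t) * hy t (c t) / deriv s (c t)) (at_right 0)"
    by (intro tendsto_add far near)
  moreover have "eventually (\<lambda>h. (measure (P x) (nocross (t + h) (t + h)) - measure (P x) (nocross t t)) / h =
      (LINT \<omega>|P x. (1 - \<phi> (X t \<omega>)) * W t h (X t \<omega>)) / h + (LINT y|lborel. g y * \<rho> y * W t h y) / h) (at_right 0)"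
    using eventually_at_right_0_real[OF zero_less_one] by eventually_elim (use split in blast)
  ultimately show ?thesis
    by (simp add: tendsto_cong g_c mult_ac)
qed

text \<open>\<open>U\<close> increases from 0 to 1 and has the continuous right derivative
  \<open>k\<close>, which is therefore its derivative. Monotonicity gives \<open>0 \<le> k\<close>,
  and the nonnegative form of the fundamental theorem provides integrability on the possibly
  infinite interval.\<close>

lemma fredholm_equation:
  assumes x: "x \<in> I" and side0: "\<sigma> * (x - c 0) < 0"
  shows "set_integrable lborel (einterval 0 \<zeta>) (\<lambda>t. \<sigma> * hy t (c t) / deriv s (c t) * q t x (c t))"
    and "(LBINT t=0..\<zeta>. \<sigma> * hy t (c t) / deriv s (c t) * q t x (c t)) = 1"
proof -
  define U where "U r = measure (P x) (nocross r r)" for r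
  define k where "k t = \<sigma> * hy t (c t) / deriv s (c t) * q t x (c t)" for t
  define T where "T = {t. 0 < t \<and> ereal t < \<zeta>}"
  have T: "open T"
    unfolding T_def by (intro open_Collect_conj open_Collect_less continuous_intros)
  have der: "((\<lambda>h. (U (t + h) - U t) / h) \<longlongrightarrow> k t) (at_right 0)" if "t \<in> T" for t
    unfolding U_def k_def using that by (intro nocross_prob_right_derivative x) (auto simp: T_def)
  have cT: "continuous_on T c"
    by (rule continuous_on_subset[OF c_continuous]) (auto simp: T_def)
  have c_J: "c t \<in> J" if "t \<in> T" for t using that c_in_J by (auto simp: T_def)
  have k_cont: "continuous_on T k"
  proof -
    have "(\<lambda>t. (t, c t)) ` T \<subseteq> side"
      using c_J by (auto simp: side_def T_def J_def)
    from continuous_on_compose2[OF hy_cont continuous_on_Pair[OF continuous_on_id cT] this]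
    have "continuous_on T (\<lambda>t. hy t (c t))" by simp
    moreover have "continuous_on T (\<lambda>t. deriv s (c t))"
      by (rule continuous_on_compose2[OF continuous_scale_derivs(1) cT]) (use c_J in auto)
    moreover have "continuous_on T (\<lambda>t. q t x (c t))"
      by (rule continuous_on_q[OF continuous_on_id continuous_on_const cT]) (use c_J JI x in \<open>auto simp: T_def\<close>)
    moreover have "deriv s (c t) \<noteq> 0" if "t \<in> T" for t
      using scale_derivs(2)[OF c_J[OF that]] by simp
    ultimately show ?thesis
      unfolding k_def by (intro continuous_intros) auto
  qed
  have U_cont: "continuous_on T U"
    unfolding continuous_on_eq_continuous_at[OF T]
  proof
    fix t assume t: "t \<in> T"
    \<comment> \<open>The difference quotient multiplied by \<open>h\<close> gives right
      continuity.\<close>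
    have "((\<lambda>h. h * ((U (t + h) - U t) / h)) \<longlongrightarrow> 0 * k t) (at_right 0)"
      by (intro tendsto_mult der[OF t] tendsto_ident_at)
    moreover have "eventually (\<lambda>h. h * ((U (t + h) - U t) / h) = U (t + h) - U t) (at_right 0)"
      using eventually_at_right_0_real[OF zero_less_one] by eventually_elim simp
    ultimately have "((\<lambda>h. U (t + h) - U t) \<longlongrightarrow> 0) (at_right 0)"
      by (simp add: tendsto_cong)
    then have "((\<lambda>h. U (h + t)) \<longlongrightarrow> U t) (at_right 0)"
      using iffD2[OF Lim_null, of "\<lambda>h. U (t + h)" "U t"] by (simp add: add.commute)
    then have "(U \<longlongrightarrow> U t) (at_right t)"
      by (subst filterlim_at_right_to_0)
    moreover have "(U \<longlongrightarrow> U t) (at_left t)"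
      unfolding U_def using t by (intro nocross_prob_left_continuous x) (auto simp: T_def)
    ultimately show "isCont U t"
      by (simp add: isCont_def filterlim_at_split)
  qed
  have D: "DERIV U t :> k t" if "t \<in> T" for t
    by (rule continuous_right_derivative_imp_DERIV[OF T U_cont k_cont der that])
  have k_nonneg: "0 \<le> k t" if t: "t \<in> T" for t
  proof (rule tendsto_lowerbound[OF der[OF t]])
    show "eventually (\<lambda>h. 0 \<le> (U (t + h) - U t) / h) (at_right 0)"
      using eventually_at_right_0_real[OF zero_less_one]
    proof eventually_elim
      case (elim h)
      then have "U t \<le> U (t + h)"
        unfolding U_def using t by (intro nocross_prob_mono x) (auto simp: T_def)
      with elim show ?case by simp
    qed
  qed simp
  have in_T: "t \<in> T" if "0 < ereal t" "ereal t < \<zeta>" for t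
    using that by (simp add: T_def zero_ereal_def)
  have A: "((U \<circ> real_of_ereal) \<longlongrightarrow> 0) (at_right 0)"
    using nocross_prob_at_zero[OF x side0] by (simp add: U_def[abs_def])
  have B: "((U \<circ> real_of_ereal) \<longlongrightarrow> 1) (at_left \<zeta>)"
    using nocross_prob_at_zeta[OF x] by (simp add: U_def[abs_def])
  have isCont_k: "isCont k t" if "t \<in> T" for t
    using k_cont that by (simp add: continuous_on_eq_continuous_at[OF T])
  note FTC = interval_integral_FTC_nonneg[of 0 \<zeta> U k 0 1, OF zeta_pos D[OF in_T] isCont_k[OF in_T] _ A B]
  have nn: "AE t in lborel. 0 < ereal t \<longrightarrow> ereal t < \<zeta> \<longrightarrow> 0 \<le> k t"
    using k_nonneg in_T by auto
  show "set_integrable lborel (einterval 0 \<zeta>) (\<lambda>t. \<sigma> * hy t (c t) / deriv s (c t) * q t x (c t))"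
    unfolding k_def[symmetric] by (rule FTC(1)) (use nn in auto)
  show "(LBINT t=0..\<zeta>. \<sigma> * hy t (c t) / deriv s (c t) * q t x (c t)) = 1"
    unfolding k_def[symmetric] by (subst FTC(2)) (use nn in auto)
qed

text \<open>\<open>H t\<close> and \<open>hy t\<close> are continuous up to \<open>c t\<close>, so
  l'Hopital's rule applies on the side on which \<open>H\<close> is smooth.\<close>

lemma H_one_sided_derivative:
  assumes t: "0 < t" "ereal t < \<zeta>"
  shows "(H t has_real_derivative hy t (c t)) (at (c t) within {y. 0 < \<sigma> * (y - c t)})"
proof -
  define S where "S = {z. l < ereal z \<and> 0 \<le> \<sigma> * (z - c t)}"
  have ct: "c t \<in> J" using c_in_J t by simp
  have cS: "c t \<in> S" using ct by (simp add: S_def J_def)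
  have sec: "(H t \<longlongrightarrow> H t (c t)) (at (c t) within S)" "(hy t \<longlongrightarrow> hy t (c t)) (at (c t) within S)"
    using side_section_continuous[OF H_cont t] side_section_continuous[OF hy_cont t] cS
    by (auto simp: continuous_on_def S_def)
  obtain e where e: "0 < e" "c t - e \<in> J" by (rule ball_J[OF ct])
  show ?thesis
  proof (cases "\<sigma> = 1")
    case True
    have "{c t<..} \<subseteq> S" using True J_upward[OF ct] by (auto simp: S_def J_def)
    moreover have "(t, y) \<in> open_side" if "c t < y" for y
      unfolding open_side_def using True t J_upward[OF ct, of y] that by (simp add: J_def)
    then have "eventually (\<lambda>y. DERIV (H t) y :> hy t y) (at_right (c t))"
      by (intro eventually_at_rightI[of _ "c t + 1"] hy) auto
    ultimately have "(H t has_real_derivative hy t (c t)) (at_right (c t))"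
      using sec by (intro DERIV_right_from_limit[where k' = "hy t"]) (auto intro: tendsto_within_subset)
    then show ?thesis using True by (simp add: greaterThan_def)
  next
    case False
    then have \<sigma>: "\<sigma> = - 1" using sigma by simp
    have in_J: "z \<in> J" if "c t - e \<le> z" for z
      using J_upward[OF e(2), of z] that by simp
    \<comment> \<open>For an upper boundary the side is limited below by \<open>l\<close>, so limits
      within it are compared with left limits on \<open>{c t - e..c t}\<close> only.\<close>
    have S_left: "(F \<longlongrightarrow> L) (at_left (c t))" if "(F \<longlongrightarrow> L) (at (c t) within S)" for F :: "real \<Rightarrow> real" and L
    proof -
      have "at (c t) within {c t - e..c t} = at_left (c t)"
        using e by (intro at_within_Icc_at_left) simp
      moreover have "{c t - e..c t} \<subseteq> S"
        using \<sigma> in_J by (auto simp: S_def J_def)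
      ultimately show ?thesis using tendsto_within_subset[OF that] by metis
    qed
    have "(t, y) \<in> open_side" if "c t - e < y" "y < c t" for y
      unfolding open_side_def using \<sigma> t in_J[of y] that by (simp add: J_def)
    then have "eventually (\<lambda>y. DERIV (H t) y :> hy t y) (at_left (c t))"
      using e by (intro eventually_at_leftI[of "c t - e"] hy) auto
    then have "(H t has_real_derivative hy t (c t)) (at_left (c t))"
      using S_left[OF sec(1)] S_left[OF sec(2)] by (intro DERIV_left_from_limit[where k' = "hy t"])
    moreover have "{y. 0 < \<sigma> * (y - c t)} = {..<c t}" using \<sigma> by auto
    ultimately show ?thesis by simp
  qed
qed

end

section \<open>The Fredholm equation\<close>

lemma first_passage_eq_infinity_iff:
  "first_passage X g \<omega> = \<infinity> \<longleftrightarrow> (\<forall>t\<ge>0. ereal (X t \<omega>) \<noteq> g t)"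
  unfolding first_passage_def top_ereal_def[symmetric] Inf_top_conv by (auto simp: top_ereal_def)

lemma lifetime_le: "0 \<le> t \<Longrightarrow> f t = l \<Longrightarrow> lifetime l f \<le> ereal t"
  unfolding lifetime_def by (rule Inf_lower) blast

text \<open>The times at which the continuous \<open>f\<close> equals \<open>l\<close> form a closed
  set, so it contains its infimum.\<close>

lemma lifetime_attained:
  assumes f: "continuous_on {0..} f" and fin: "lifetime l f \<noteq> \<infinity>"
  obtains T where "0 \<le> T" "lifetime l f = ereal T" "f T = l"
proof -
  define K where "K = {t \<in> {0..}. f t = l}"
  have "K \<noteq> {}"
  proof
    assume "K = {}"
    then have "{ereal t | t. 0 \<le> t \<and> f t = l} = {}" by (auto simp: K_def)
    then have "lifetime l f = Inf {}" unfolding lifetime_def by (simp only:)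
    then show False using fin by (simp add: top_ereal_def)
  qed
  moreover have "closed K"
    unfolding K_def by (rule continuous_closed_preimage_constant[OF f]) simp
  moreover have bdd: "bdd_below K" by (auto simp: K_def intro: bdd_belowI[of _ 0])
  ultimately have "Inf K \<in> K" by (intro closed_contains_Inf)
  then have T: "0 \<le> Inf K" "f (Inf K) = l" by (auto simp: K_def)
  have "lifetime l f = ereal (Inf K)"
  proof (rule antisym)
    show "lifetime l f \<le> ereal (Inf K)" by (rule lifetime_le[where f = f and l = l, OF T])
    show "ereal (Inf K) \<le> lifetime l f"
      unfolding lifetime_def
    proof (rule Inf_greatest)
      fix e assume "e \<in> {ereal t | t. 0 \<le> t \<and> f t = l}"
      then obtain t where "e = ereal t" "t \<in> K" by (auto simp: K_def)
      then show "ereal (Inf K) \<le> e" using cInf_lower[OF _ bdd] by simp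
    qed
  qed
  with T show ?thesis by (intro that)
qed

text \<open>Translates between the extended-valued boundary and the real function \<open>c\<close>,
  meaningful before \<open>\<zeta>\<close>. \<open>F\<close> is the boundary met by the process: it
  follows \<open>f\<close> up to \<open>\<zeta>\<close> and is \<open>-\<infinity>\<close>
  afterwards, so that a passage of the shifted \<open>F\<close> is exactly a meeting with
  \<open>c\<close> before \<open>\<zeta>\<close>.\<close>

lemma fredholm_equation_no_passage:
  fixes F f :: "real \<Rightarrow> ereal" and P :: "real \<Rightarrow> 'w measure"
  defines "c \<equiv> \<lambda>t. real_of_ereal (f t)"
  assumes diffusion: "linear_diffusion l I M P X s \<rho> q" and \<sigma>: "\<sigma> = 1 \<or> \<sigma> = - 1" and \<zeta>: "0 < \<zeta>"
    and f: "\<And>t. 0 \<le> t \<Longrightarrow> ereal t < \<zeta> \<Longrightarrow> l < f t \<and> f t < \<infinity>"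
    and f_cont: "continuous_on {t. 0 \<le> t \<and> ereal t < \<zeta>} f"
    and F: "\<And>t. 0 \<le> t \<Longrightarrow> F t = (if ereal t < \<zeta> then f t else - \<infinity>)"
    and ev: "\<And>x. x \<in> I \<Longrightarrow> AE \<omega> in P x.
      \<exists>T\<ge>0. ereal T < \<zeta> \<and> (\<forall>u\<ge>T. ereal u < \<zeta> \<longrightarrow> 0 < \<sigma> * (X u \<omega> - c u))"
    and C12: "C12_on {(t, y). 0 < t \<and> ereal t < \<zeta> \<and> l < ereal y \<and> 0 \<le> \<sigma> * (y - c t)} (no_passage_prob P X F)"
    and x: "x \<in> I" "\<sigma> * (x - c 0) < 0"
  shows "set_integrable lborel (einterval 0 \<zeta>) (\<lambda>t. \<sigma> * (1 / deriv s (c t) *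
      vector_derivative (\<lambda>y. no_passage_prob P X F t y) (at (c t) within {y. 0 < \<sigma> * (y - c t)})) * q t x (c t))" (is ?A)
    and "(LBINT t=0..\<zeta>. \<sigma> * (1 / deriv s (c t) *
      vector_derivative (\<lambda>y. no_passage_prob P X F t y) (at (c t) within {y. 0 < \<sigma> * (y - c t)})) * q t x (c t)) = 1" (is ?B)
proof -
  interpret linear_diffusion l I M P X s \<rho> q by (rule diffusion)
  have f_c: "f t = ereal (c t)" if "0 \<le> t" "ereal t < \<zeta>" for t
    using f[OF that] by (cases "f t") (auto simp: c_def)
  interpret moving_boundary l I M P X s \<rho> q \<zeta> c \<sigma>
  proof unfold_locales
    show "continuous_on {t. 0 \<le> t \<and> ereal t < \<zeta>} c"
      unfolding continuous_on_def
    proof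
      fix t assume t: "t \<in> {t. 0 \<le> t \<and> ereal t < \<zeta>}"
      then have "(f \<longlongrightarrow> f t) (at t within {t. 0 \<le> t \<and> ereal t < \<zeta>})"
        using f_cont by (auto simp: continuous_on_def)
      then show "(c \<longlongrightarrow> c t) (at t within {t. 0 \<le> t \<and> ereal t < \<zeta>})"
        using t f_c[of t] unfolding c_def by (intro lim_real_of_ereal) simp
    qed
    show "l < ereal (c t)" if "0 \<le> t" "ereal t < \<zeta>" for t
      using f[OF that] f_c[OF that] by simp
    show "AE \<omega> in P x. \<exists>T. ereal T < \<zeta> \<and> (\<forall>u. T \<le> u \<and> ereal u < \<zeta> \<longrightarrow> 0 < \<sigma> * (X u \<omega> - c u))"
      if "x \<in> I" for x
      using ev[OF that] by eventually_elim blast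
  qed (use \<sigma> \<zeta> in auto)
  have H_eq: "no_passage_prob P X F t y = H t y" if "0 \<le> t" "y \<in> I" for t y
  proof -
    have "first_passage X (shift t F) \<omega> = \<infinity> \<longleftrightarrow> (\<forall>u\<ge>0. ereal (t + u) < \<zeta> \<longrightarrow> X u \<omega> \<noteq> c (t + u))" for \<omega>
      unfolding first_passage_eq_infinity_iff shift_def using F f_c that(1) by auto
    then show ?thesis
      unfolding no_passage_prob_def H_def nocross_def using space_P[OF that(2)] by simp
  qed
  have side_eq: "{(t, y). 0 < t \<and> ereal t < \<zeta> \<and> l < ereal y \<and> 0 \<le> \<sigma> * (y - c t)} = side"
    by (simp add: side_def)
  obtain ht hy hyy where cont: "continuous_on side (\<lambda>(t, y). ht t y)" "continuous_on side (\<lambda>(t, y). hy t y)"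
      "continuous_on side (\<lambda>(t, y). hyy t y)"
    and der: "\<forall>(t, y)\<in>interior side. DERIV (\<lambda>r. no_passage_prob P X F r y) t :> ht t y \<and>
      DERIV (\<lambda>z. no_passage_prob P X F t z) y :> hy t y \<and> DERIV (\<lambda>z. hy t z) y :> hyy t y"
    using C12 unfolding C12_on_def side_eq by blast
  have int: "p \<in> interior side" if "p \<in> open_side" for p
    using interior_maximal[OF open_side_subset open_open_side] that by auto
  interpret smooth_boundary l I M P X s \<rho> q \<zeta> c \<sigma> ht hy hyy
  proof unfold_locales
    have "continuous_on side (\<lambda>(t, y). no_passage_prob P X F t y)"
      using C12 unfolding C12_on_def side_eq by blast
    then show "continuous_on side (\<lambda>(t, y). H t y)"
      by (rule continuous_on_eq) (use H_eq JI in \<open>auto simp: side_def J_def\<close>)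
    fix t y assume ty: "(t, y) \<in> open_side"
    then have t: "0 < t" and y: "y \<in> J" by (auto simp: open_side_def J_def)
    have d: "DERIV (\<lambda>r. no_passage_prob P X F r y) t :> ht t y" "DERIV (\<lambda>z. no_passage_prob P X F t z) y :> hy t y"
      "DERIV (\<lambda>z. hy t z) y :> hyy t y"
      using bspec[OF der int[OF ty]] by auto
    show "DERIV (\<lambda>z. hy t z) y :> hyy t y" by (rule d(3))
    have "eventually (\<lambda>r. r \<in> {0<..}) (nhds t)" using t by (intro eventually_nhds_in_open) auto
    then have "eventually (\<lambda>r. no_passage_prob P X F r y = H r y) (nhds t)"
      by eventually_elim (use H_eq[OF _ JI[OF y]] in simp)
    then show "DERIV (\<lambda>r. H r y) t :> ht t y" by (rule DERIV_transform_nhds[OF d(1)])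
    have "eventually (\<lambda>z. z \<in> J) (nhds y)" by (rule eventually_nhds_in_open[OF open_J y])
    then have "eventually (\<lambda>z. no_passage_prob P X F t z = H t z) (nhds y)"
      by eventually_elim (use H_eq[OF less_imp_le[OF t]] JI in simp)
    then show "DERIV (\<lambda>z. H t z) y :> hy t y" by (rule DERIV_transform_nhds[OF d(2)])
  qed (rule cont)+
  have vd: "vector_derivative (\<lambda>y. no_passage_prob P X F t y) (at (c t) within {y. 0 < \<sigma> * (y - c t)}) = hy t (c t)"
    if t: "t \<in> einterval 0 \<zeta>" for t
  proof -
    have t': "0 < t" "ereal t < \<zeta>" using t by (auto simp: einterval_def zero_ereal_def)
    have ct: "c t \<in> J" using c_in_J t' by simp
    have "eventually (\<lambda>z. z \<in> J) (nhds (c t))" by (rule eventually_nhds_in_open[OF open_J ct])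
    then have ev: "eventually (\<lambda>z. z \<in> {y. 0 < \<sigma> * (y - c t)} \<longrightarrow> H t z = no_passage_prob P X F t z) (nhds (c t))"
      by eventually_elim (use H_eq[OF less_imp_le[OF t'(1)]] JI in simp)
    have "(H t has_vector_derivative hy t (c t)) (at (c t) within {y. 0 < \<sigma> * (y - c t)})"
      using H_one_sided_derivative[OF t'] by (simp add: has_real_derivative_iff_has_vector_derivative)
    then have "((\<lambda>y. no_passage_prob P X F t y) has_vector_derivative hy t (c t)) (at (c t) within {y. 0 < \<sigma> * (y - c t)})"
      by (rule iffD1[OF has_vector_derivative_cong_ev[OF ev H_eq[symmetric, OF less_imp_le[OF t'(1)] JI[OF ct]]]])
    \<comment> \<open>\<open>vector_derivative\<close> is a choice operator; uniqueness of the
      derivative, and with it the value \<open>hy t (c t)\<close>, requires a limit point.\<close>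
    moreover have "at (c t) within {y. 0 < \<sigma> * (y - c t)} \<noteq> bot"
    proof (cases "\<sigma> = 1")
      case True
      then have "{y. 0 < \<sigma> * (y - c t)} = {c t<..}" by auto
      then show ?thesis by (simp add: trivial_limit_at_right_real)
    next
      case False
      then have "{y. 0 < \<sigma> * (y - c t)} = {..<c t}" using \<sigma> by auto
      then show ?thesis by (simp add: trivial_limit_at_left_real)
    qed
    ultimately show ?thesis by (intro vector_derivative_within)
  qed
  have eq: "\<sigma> * hy t (c t) / deriv s (c t) * q t x (c t) = \<sigma> * (1 / deriv s (c t) *
      vector_derivative (\<lambda>y. no_passage_prob P X F t y) (at (c t) within {y. 0 < \<sigma> * (y - c t)})) * q t x (c t)"
    if "t \<in> einterval 0 \<zeta>" for t
    by (simp add: vd[OF that])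
  show ?A
    by (rule iffD1[OF set_integrable_cong[OF refl refl eq] fredholm_equation(1)[OF x]])
  have "(LBINT t=0..\<zeta>. \<sigma> * hy t (c t) / deriv s (c t) * q t x (c t)) = (LBINT t=0..\<zeta>. \<sigma> * (1 / deriv s (c t) *
      vector_derivative (\<lambda>y. no_passage_prob P X F t y) (at (c t) within {y. 0 < \<sigma> * (y - c t)})) * q t x (c t))"
    by (rule interval_lebesgue_integral_cong[OF less_imp_le[OF \<zeta>] eq]) auto
  with fredholm_equation(2)[OF x] show ?B by simp
qed

context linear_diffusion
begin

text \<open>At the finite time \<open>z\<close> the process is in \<open>J\<close> almost surely, as
  its law has a density, while the boundary has come to \<open>l\<close>. A level \<open>m\<close>
  strictly in between separates the two near \<open>z\<close>.\<close>

lemma eventually_above_boundary_ending: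
  assumes x: "x \<in> I" and f: "continuous_on {0..} f" and z: "0 < z" "f z = l"
    and fin: "\<And>t. 0 \<le> t \<Longrightarrow> t < z \<Longrightarrow> l < f t \<and> f t < \<infinity>"
  shows "AE \<omega> in P x. \<exists>T\<ge>0. T < z \<and> (\<forall>u\<ge>T. u < z \<longrightarrow> 0 < X u \<omega> - real_of_ereal (f u))"
  using AE_X_in_J[OF z(1) x] AE_space
proof eventually_elim
  case (elim \<omega>)
  then have w: "\<omega> \<in> space M" and above: "l < ereal (X z \<omega>)" by (auto simp: space_P[OF x] J_def)
  obtain m where m: "l < ereal m" "ereal m < ereal (X z \<omega>)" using ereal_dense2[OF above] by blast
  have "(f \<longlongrightarrow> f z) (at z within {0..})" using f z by (auto simp: continuous_on_def)
  then have "eventually (\<lambda>u. f u < ereal m) (at z within {0..})"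
    using m(1) z(2) by (intro order_tendstoD) auto
  moreover have "((\<lambda>u. X u \<omega>) \<longlongrightarrow> X z \<omega>) (at z within {0..})"
    using X_continuous[OF w] z by (auto simp: continuous_on_def)
  then have "eventually (\<lambda>u. m < X u \<omega>) (at z within {0..})"
    using m(2) by (intro order_tendstoD) auto
  ultimately have "eventually (\<lambda>u. f u < ereal m \<and> m < X u \<omega>) (at z within {0..})"
    by eventually_elim simp
  then obtain d where d: "0 < d" "\<And>u. 0 \<le> u \<Longrightarrow> u \<noteq> z \<Longrightarrow> dist u z < d \<Longrightarrow> f u < ereal m \<and> m < X u \<omega>"
    unfolding eventually_at by auto
  show ?case
  proof (intro exI[of _ "max 0 (z - d / 2)"] conjI allI impI)
    fix u assume u: "max 0 (z - d / 2) \<le> u" "u < z"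
    then have "f u < ereal m" "m < X u \<omega>" using d(2)[of u] d(1) by (auto simp: dist_real_def)
    moreover have "f u = ereal (real_of_ereal (f u))"
      using fin[of u] u by (cases "f u") auto
    ultimately show "0 < X u \<omega> - real_of_ereal (f u)"
      by (metis diff_gt_0_iff_gt less_ereal.simps(1) less_trans)
  qed (use d z in auto)
qed

end

theorem corollary23:
  fixes l :: ereal and I :: "real set"
    and M :: "'w measure" and P :: "real \<Rightarrow> 'w measure" and X :: "real \<Rightarrow> 'w \<Rightarrow> real"
    and s \<rho> :: "real \<Rightarrow> real" and q :: "real \<Rightarrow> real \<Rightarrow> real \<Rightarrow> real"
    and f :: "real \<Rightarrow> ereal"
  assumes "linear_diffusion l I M P X s \<rho> q"
  shows
    "(let \<zeta> = lifetime l f;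
          H = no_passage_prob P X (killed l f);
          \<Phi> = (\<lambda>t. let c = real_of_ereal (f t) in
                  1 / deriv s c * vector_derivative (\<lambda>y. H t y) (at_right c))
      in
        continuous_on {0..} f \<and> (\<forall>t\<ge>0. l \<le> f t \<and> f t < \<infinity>) \<and>
        (\<lambda>t. real_of_ereal (f t)) C1_differentiable_on {t. 0 < t \<and> f t \<noteq> -\<infinity>} \<and>
        0 < \<zeta> \<and>
        (\<zeta> = \<infinity> \<longrightarrow> (\<forall>x\<in>I. AE \<omega> in P x.
            \<exists>L>0. ((\<lambda>t. ereal (X t \<omega>) - f t) \<longlongrightarrow> L) at_top)) \<and>
        C12_on {(t, y). 0 < t \<and> ereal t < \<zeta> \<and> l < ereal y \<and> f t \<le> ereal y} H \<and>
        (\<forall>x t. l < ereal x \<and> 0 < t \<longrightarrow>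
            ((\<lambda>y. 1 / deriv s y * deriv (\<lambda>z. H t z) y * q t x y) \<longlongrightarrow> 0) at_top)
      \<longrightarrow>
        (\<forall>x\<in>I. ereal x < f 0 \<longrightarrow>
            interval_lebesgue_integrable lborel 0 \<zeta> (\<lambda>t. \<Phi> t * q t x (real_of_ereal (f t))) \<and>
            (LBINT t=0..\<zeta>. \<Phi> t * q t x (real_of_ereal (f t))) = 1))
     \<and>
     (let H = no_passage_prob P X f;
          \<Phi> = (\<lambda>t. let c = real_of_ereal (f t) in
                  - (1 / deriv s c * vector_derivative (\<lambda>y. H t y) (at_left c)))
      in
        (l = -\<infinity> \<longrightarrow> natural_left l s (speed_measure I \<rho>)) \<and>
        (l > -\<infinity> \<longrightarrow> entrance_not_exit_left l s (speed_measure I \<rho>)) \<and>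
        continuous_on {0..} f \<and> (\<forall>t\<ge>0. l < f t \<and> f t < \<infinity>) \<and>
        (\<lambda>t. real_of_ereal (f t)) C1_differentiable_on {0<..} \<and>
        lifetime l f = \<infinity> \<and>
        (\<forall>x\<in>I. AE \<omega> in P x.
            \<exists>L<0. ((\<lambda>t. ereal (X t \<omega>) - f t) \<longlongrightarrow> L) at_top) \<and>
        C12_on {(t, y). 0 < t \<and> l < ereal y \<and> ereal y \<le> f t} H \<and>
        (\<forall>x t. l < ereal x \<and> 0 < t \<longrightarrow>
            ((\<lambda>y. 1 / deriv s (real_of_ereal y) * deriv (\<lambda>z. H t z) (real_of_ereal y)
                * q t x (real_of_ereal y)) \<longlongrightarrow> 0) (at_right l))
      \<longrightarrow>
        (\<forall>x\<in>I. f 0 < ereal x \<longrightarrow>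
            interval_lebesgue_integrable lborel 0 \<infinity> (\<lambda>t. \<Phi> t * q t x (real_of_ereal (f t))) \<and>
            (LBINT t=0..\<infinity>. \<Phi> t * q t x (real_of_ereal (f t))) = 1))"
proof -
  interpret linear_diffusion l I M P X s \<rho> q by (rule assms)
  have lower: "interval_lebesgue_integrable lborel 0 (lifetime l f) (\<lambda>t. 1 / deriv s (real_of_ereal (f t)) *
        vector_derivative (\<lambda>y. no_passage_prob P X (killed l f) t y) (at_right (real_of_ereal (f t))) * q t x (real_of_ereal (f t))) \<and>
      (LBINT t=0..lifetime l f. 1 / deriv s (real_of_ereal (f t)) *
        vector_derivative (\<lambda>y. no_passage_prob P X (killed l f) t y) (at_right (real_of_ereal (f t))) * q t x (real_of_ereal (f t))) = 1"
    if cont: "continuous_on {0..} f" and range: "\<forall>t\<ge>0. l \<le> f t \<and> f t < \<infinity>" and pos: "0 < lifetime l f"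
      and above: "lifetime l f = \<infinity> \<longrightarrow> (\<forall>x\<in>I. AE \<omega> in P x. \<exists>L>0. ((\<lambda>t. ereal (X t \<omega>) - f t) \<longlongrightarrow> L) at_top)"
      and C12: "C12_on {(t, y). 0 < t \<and> ereal t < lifetime l f \<and> l < ereal y \<and> f t \<le> ereal y} (no_passage_prob P X (killed l f))"
      and x: "x \<in> I" "ereal x < f 0" for x
  proof -
    have f: "l < f t \<and> f t < \<infinity>" if "0 \<le> t" "ereal t < lifetime l f" for t
      using range that lifetime_le[OF that(1), of f l] by (metis leD order_le_imp_less_or_eq)
    have f_c: "f t = ereal (real_of_ereal (f t))" if "0 \<le> t" "ereal t < lifetime l f" for t
      using f[OF that] by (cases "f t") auto
    \<comment> \<open>With infinite lifetime a positive limit of the gap makes it eventually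
      positive; with finite lifetime this comes from the boundary reaching \<open>l\<close>.\<close>
    have ev: "AE \<omega> in P x. \<exists>T\<ge>0. ereal T < lifetime l f \<and>
      (\<forall>u\<ge>T. ereal u < lifetime l f \<longrightarrow> 0 < 1 * (X u \<omega> - real_of_ereal (f u)))" if x: "x \<in> I" for x
    proof (cases "lifetime l f = \<infinity>")
      case True
      then have "AE \<omega> in P x. \<exists>L>0. ((\<lambda>t. ereal (X t \<omega>) - f t) \<longlongrightarrow> L) at_top"
        using above x by blast
      then show ?thesis
      proof eventually_elim
        case (elim \<omega>)
        then obtain L where "0 < L" "((\<lambda>t. ereal (X t \<omega>) - f t) \<longlongrightarrow> L) at_top" by blast
        then have "eventually (\<lambda>t. 0 < ereal (X t \<omega>) - f t) at_top"
          by (intro order_tendstoD)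
        then obtain N where N: "\<And>t. N \<le> t \<Longrightarrow> 0 < ereal (X t \<omega>) - f t"
          by (auto simp: eventually_at_top_linorder)
        have "0 < X u \<omega> - real_of_ereal (f u)" if u: "max N 0 \<le> u" for u
        proof -
          have "0 < ereal (X u \<omega>) - ereal (real_of_ereal (f u))"
            using N[of u] u f_c[of u] True by simp
          then show ?thesis by simp
        qed
        then show ?case using True by (intro exI[of _ "max N 0"]) (simp del: ereal_max)
      qed
    next
      case False
      then obtain z where z: "0 \<le> z" "lifetime l f = ereal z" "f z = l"
        by (rule lifetime_attained[OF cont])
      have "AE \<omega> in P x. \<exists>T\<ge>0. T < z \<and> (\<forall>u\<ge>T. u < z \<longrightarrow> 0 < X u \<omega> - real_of_ereal (f u))"
        using f pos z by (intro eventually_above_boundary_ending x cont) (auto simp: zero_ereal_def)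
      then show ?thesis by (simp add: z(2))
    qed
    have D: "{(t, y). 0 < t \<and> ereal t < lifetime l f \<and> l < ereal y \<and> 0 \<le> 1 * (y - real_of_ereal (f t))} =
        {(t, y). 0 < t \<and> ereal t < lifetime l f \<and> l < ereal y \<and> f t \<le> ereal y}"
    proof -
      have "0 \<le> y - real_of_ereal (f t) \<longleftrightarrow> f t \<le> ereal y" if "0 < t" "ereal t < lifetime l f" for t y
        using f_c[OF less_imp_le[OF that(1)] that(2)] by (metis diff_ge_0_iff_ge ereal_less_eq(3))
      then show ?thesis by auto
    qed
    have x0: "1 * (x - real_of_ereal (f 0)) < 0"
      using x(2) f_c[of 0] pos by (metis diff_less_0_iff_less less_ereal.simps(1) mult_1 order_refl zero_ereal_def)
    have side: "{y. 0 < 1 * (y - real_of_ereal (f t))} = {real_of_ereal (f t)<..}" for t by auto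
    have main: "set_integrable lborel (einterval 0 (lifetime l f)) (\<lambda>t. 1 * (1 / deriv s (real_of_ereal (f t)) *
        vector_derivative (\<lambda>y. no_passage_prob P X (killed l f) t y) (at_right (real_of_ereal (f t)))) * q t x (real_of_ereal (f t)))"
      "(LBINT t=0..lifetime l f. 1 * (1 / deriv s (real_of_ereal (f t)) *
        vector_derivative (\<lambda>y. no_passage_prob P X (killed l f) t y) (at_right (real_of_ereal (f t)))) * q t x (real_of_ereal (f t))) = 1"
      by (rule fredholm_equation_no_passage[where \<sigma> = 1 and F = "killed l f", OF assms disjI1[OF refl] pos f
        continuous_on_subset[OF cont] _ ev C12[folded D] x(1) x0, unfolded side]; auto simp: killed_def)+
    then show ?thesis
      using pos by (simp add: interval_lebesgue_integrable_def less_imp_le)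
  qed
  \<comment> \<open>The mirrored case \<open>\<sigma> = - 1\<close> with
    \<open>\<zeta> = \<infinity>\<close>: the boundary never ends, so it is used without killing,
    and \<open>\<sigma>\<close> is the sign in front of the kernel.\<close>
  have upper: "interval_lebesgue_integrable lborel 0 \<infinity> (\<lambda>t. - (1 / deriv s (real_of_ereal (f t)) *
        vector_derivative (\<lambda>y. no_passage_prob P X f t y) (at_left (real_of_ereal (f t)))) * q t x (real_of_ereal (f t))) \<and>
      (LBINT t=0..\<infinity>. - (1 / deriv s (real_of_ereal (f t)) *
        vector_derivative (\<lambda>y. no_passage_prob P X f t y) (at_left (real_of_ereal (f t)))) * q t x (real_of_ereal (f t))) = 1"
    if cont: "continuous_on {0..} f" and f: "\<forall>t\<ge>0. l < f t \<and> f t < \<infinity>"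
      and below: "\<forall>x\<in>I. AE \<omega> in P x. \<exists>L<0. ((\<lambda>t. ereal (X t \<omega>) - f t) \<longlongrightarrow> L) at_top"
      and C12: "C12_on {(t, y). 0 < t \<and> l < ereal y \<and> ereal y \<le> f t} (no_passage_prob P X f)"
      and x: "x \<in> I" "f 0 < ereal x" for x
  proof -
    have f_c: "f t = ereal (real_of_ereal (f t))" if "0 \<le> t" for t
      using f that by (cases "f t") auto
    have ev: "AE \<omega> in P x. \<exists>T\<ge>0. ereal T < \<infinity> \<and>
      (\<forall>u\<ge>T. ereal u < \<infinity> \<longrightarrow> 0 < - 1 * (X u \<omega> - real_of_ereal (f u)))" if x: "x \<in> I" for x
      using bspec[OF below x]
    proof eventually_elim
      case (elim \<omega>)
      then obtain L where "L < 0" "((\<lambda>t. ereal (X t \<omega>) - f t) \<longlongrightarrow> L) at_top" by blast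
      then have "eventually (\<lambda>t. ereal (X t \<omega>) - f t < 0) at_top"
        by (intro order_tendstoD)
      then obtain N where N: "\<And>t. N \<le> t \<Longrightarrow> ereal (X t \<omega>) - f t < 0"
        by (auto simp: eventually_at_top_linorder)
      have "X u \<omega> - real_of_ereal (f u) < 0" if u: "max N 0 \<le> u" for u
      proof -
        have "ereal (X u \<omega>) - ereal (real_of_ereal (f u)) < 0"
          using N[of u] u f_c[of u] by simp
        then show ?thesis by simp
      qed
      then show ?case by (intro exI[of _ "max N 0"]) (simp del: ereal_max)
    qed
    have D: "{(t, y). 0 < t \<and> ereal t < \<infinity> \<and> l < ereal y \<and> 0 \<le> - 1 * (y - real_of_ereal (f t))} =
        {(t, y). 0 < t \<and> l < ereal y \<and> ereal y \<le> f t}"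
    proof -
      have "0 \<le> - 1 * (y - real_of_ereal (f t)) \<longleftrightarrow> ereal y \<le> f t" if "0 < t" for t y
        using f_c[OF less_imp_le[OF that]] ereal_less_eq(3)[of y "real_of_ereal (f t)"] by simp
      then show ?thesis by auto
    qed
    have x0: "- 1 * (x - real_of_ereal (f 0)) < 0"
      using x(2) f_c[of 0] less_ereal.simps(1)[of "real_of_ereal (f 0)" x] by simp
    have side: "{y. 0 < - 1 * (y - real_of_ereal (f t))} = {..<real_of_ereal (f t)}" for t by auto
    have main: "set_integrable lborel (einterval 0 \<infinity>) (\<lambda>t. - 1 * (1 / deriv s (real_of_ereal (f t)) *
        vector_derivative (\<lambda>y. no_passage_prob P X f t y) (at_left (real_of_ereal (f t)))) * q t x (real_of_ereal (f t)))"
      "(LBINT t=0..\<infinity>. - 1 * (1 / deriv s (real_of_ereal (f t)) *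
        vector_derivative (\<lambda>y. no_passage_prob P X f t y) (at_left (real_of_ereal (f t)))) * q t x (real_of_ereal (f t))) = 1"
      by (rule fredholm_equation_no_passage[where \<sigma> = "- 1" and F = f, OF assms disjI2[OF refl] _ _
        continuous_on_subset[OF cont] _ ev C12[folded D] x(1) x0, unfolded side]; use f in auto)+
    then show ?thesis
      by (simp add: interval_lebesgue_integrable_def)
  qed
  show ?thesis
    unfolding Let_def using lower upper by (intro conjI impI ballI; elim conjE) blast+
qed

end
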